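(* Let $\nu$ be a measure (a Poisson mean measure) on the Borel sets of a Hausdorff space $\Omega$ with $\nu(\Omega)<\infty$, let $\Theta$ be a closed linear subspace of $L_2(\nu)$ containing the constant function $\lambda_c\equiv1$, and let $\Theta_0,\Theta_1\subset\Theta$ be sets of Poisson intensity functions $\lambda=d\mu/d\nu$, $\mu\ll\nu$. Let $\kappa_1,\ldots,\kappa_n$ be independent realizations of a Poisson random process on $\Omega$ with mean measure $\mu$, $d\mu=\lambda\,d\nu$, and consider testing $H_0:\lambda\in\Theta_0$ versus $H_1:\lambda\in\Theta_1$. Suppose $\Theta_0$ and $\Theta_1$ are bounded in $L_2(\nu)$. Then the set of hypotheses $\Theta_0$ and the set of alternatives $\Theta_1$ are (i) indistinguishable if there does not exist a finite dimensional subspace $\Gamma\subset\Theta$ such that $\Pi_\Gamma\bar\Theta_0\cap\Pi_\Gamma\bar\Theta_1=\emptyset$; (ii) distinguishable if there exists a finite dimensional subspace $\Gamma\subset\Theta$ such that $\Pi_\Gamma\bar\Theta_0\cap\Pi_\Gamma\bar\Theta_1=\emptyset$.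
   Context: $\Pi_\Gamma$ is the projection operator of $L_2(\nu)$ onto the subspace $\Gamma$. For a set $\Psi\subset L_2(\nu)$, $\bar\Psi$ is the closure of $\Psi$ in $L_2(\nu)$; thus $\Pi_\Gamma\bar\Theta_i$ is the projection of the closure of $\Theta_i$. A test is a measurable function $K_n=K_n(\kappa_1,\ldots,\kappa_n)$ with values in $[0,1]$; $\alpha(K_n)=\sup_{\lambda\in\Theta_0}E_\lambda[K_n]$ and $\beta(K_n)=\sup_{\lambda\in\Theta_1}E_\lambda[1-K_n]$, where $E_\lambda$ is expectation when the processes have intensity $\lambda$ with respect to $\nu$. $H_0$ and $H_1$ are distinguishable if for every $0<\alpha<1$ there are tests $K_n$, $n=1,2,\ldots$, with $\alpha(K_n)<\alpha$ and $\lim_{n\to\infty}\beta(K_n)=0$. They are indistinguishable if $\alpha(K_n)+\beta(K_n)\ge1$ for every $n$ and every test $K_n$.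
   Formalization: The closures of Θ_0 and Θ_1 are taken in the weak topology of L_2(ν), not in norm; with norm closures (ii) is false (Θ_1={1}, Θ_0={1+c(e_0/m+e_m)}, Γ=span e_0), while (i) becomes stronger. *)

theory Defs
  imports "HOL-Probability.Probability"
begin

section \<open>The Hilbert space \<open>L\<^sub>2(\<nu>)\<close>\<close>

text \<open>
  Elements of \<open>L\<^sub>2(\<nu>)\<close> are represented by square integrable functions, and a subspace by the set
  of all representatives of its elements; subspaces are therefore required to be closed
  under \<open>\<nu>\<close>-almost everywhere equality.
\<close>

definition L2 :: "'a measure \<Rightarrow> ('a \<Rightarrow> real) set" where
  "L2 \<nu> = {f \<in> borel_measurable \<nu>. integrable \<nu> (\<lambda>x. (f x)\<^sup>2)}"

definition l2_inner :: "'a measure \<Rightarrow> ('a \<Rightarrow> real) \<Rightarrow> ('a \<Rightarrow> real) \<Rightarrow> real" where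
  "l2_inner \<nu> f g = (\<integral>x. f x * g x \<partial>\<nu>)"

definition l2_norm :: "'a measure \<Rightarrow> ('a \<Rightarrow> real) \<Rightarrow> real" where
  "l2_norm \<nu> f = sqrt (l2_inner \<nu> f f)"

definition l2_bounded :: "'a measure \<Rightarrow> ('a \<Rightarrow> real) set \<Rightarrow> bool" where
  "l2_bounded \<nu> \<Psi> \<longleftrightarrow> (\<exists>C. \<forall>f\<in>\<Psi>. l2_norm \<nu> f \<le> C)"

definition l2_subspace :: "'a measure \<Rightarrow> ('a \<Rightarrow> real) set \<Rightarrow> bool" where
  "l2_subspace \<nu> S \<longleftrightarrow> S \<subseteq> L2 \<nu> \<and> (\<lambda>_. 0) \<in> S
     \<and> (\<forall>f\<in>S. \<forall>g\<in>S. (\<lambda>x. f x + g x) \<in> S)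
     \<and> (\<forall>c. \<forall>f\<in>S. (\<lambda>x. c * f x) \<in> S)
     \<and> (\<forall>f\<in>S. \<forall>g\<in>L2 \<nu>. (AE x in \<nu>. f x = g x) \<longrightarrow> g \<in> S)"

definition l2_closed :: "'a measure \<Rightarrow> ('a \<Rightarrow> real) set \<Rightarrow> bool" where
  "l2_closed \<nu> S \<longleftrightarrow>
     (\<forall>f\<in>L2 \<nu>. (\<forall>\<epsilon>>0. \<exists>g\<in>S. l2_norm \<nu> (\<lambda>x. f x - g x) < \<epsilon>) \<longrightarrow> f \<in> S)"

definition l2_finite_dim :: "'a measure \<Rightarrow> ('a \<Rightarrow> real) set \<Rightarrow> bool" where
  "l2_finite_dim \<nu> S \<longleftrightarrow>
     (\<exists>B. finite B \<and> B \<subseteq> S \<and> (\<forall>f\<in>S. \<exists>c. AE x in \<nu>. f x = (\<Sum>b\<in>B. c b * b x)))"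

text \<open>
  The closure in \<open>L\<^sub>2(\<nu>)\<close> is taken in the weak topology. With the norm closure the distinguishability
  half of the theorem fails: take \<open>\<nu>\<close> Lebesgue measure on \<open>[0,1]\<close>, \<open>e\<^sub>0, e\<^sub>1, \<dots>\<close> a bounded orthonormal
  system orthogonal to \<open>1\<close>, \<open>\<Theta>\<^sub>1 = {1}\<close> and \<open>\<Theta>\<^sub>0 = {1 + c (e\<^sub>0 / m + e\<^sub>m) | m \<ge> 1}\<close> with a small \<open>c > 0\<close>.
  Both sets are bounded and norm closed and have disjoint projections onto the span of \<open>e\<^sub>0\<close>, but \<open>1\<close> is
  a weak limit of elements of \<open>\<Theta>\<^sub>0\<close>, which makes the two sets indistinguishable. The weak closure contains
  the norm closure, and the two coincide on convex sets.
\<close>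

definition l2_closure :: "'a measure \<Rightarrow> ('a \<Rightarrow> real) set \<Rightarrow> ('a \<Rightarrow> real) set" where
  "l2_closure \<nu> \<Psi> = {f \<in> L2 \<nu>. \<forall>H \<epsilon>. finite H \<longrightarrow> H \<subseteq> L2 \<nu> \<longrightarrow> \<epsilon> > 0 \<longrightarrow>
      (\<exists>g\<in>\<Psi>. \<forall>h\<in>H. \<bar>l2_inner \<nu> (\<lambda>x. f x - g x) h\<bar> < \<epsilon>)}"

text \<open>The image of \<open>\<Psi>\<close> under the orthogonal projection onto \<open>\<Gamma>\<close>, consisting of all representatives.\<close>

definition l2_proj :: "'a measure \<Rightarrow> ('a \<Rightarrow> real) set \<Rightarrow> ('a \<Rightarrow> real) set \<Rightarrow> ('a \<Rightarrow> real) set" where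
  "l2_proj \<nu> \<Gamma> \<Psi> = {g \<in> \<Gamma>. \<exists>f\<in>\<Psi>. \<forall>h\<in>\<Gamma>. l2_inner \<nu> (\<lambda>x. f x - g x) h = 0}"


section \<open>Poisson processes with finite mean measure\<close>

text \<open>
  The measurable space of finite counting measures on \<open>K\<close>, with the \<open>\<sigma>\<close>-algebra generated by the
  evaluations. As \<open>\<infinity>\<close> is not in the range of \<open>of_nat\<close>, the counts are finite.
\<close>

definition counting_algebra :: "'a measure \<Rightarrow> 'a measure measure" where
  "counting_algebra K = (SUP A \<in> sets K. vimage_algebra
     {m. sets m = sets K \<and> (\<forall>B\<in>sets K. emeasure m B \<in> range of_nat)} (\<lambda>m. emeasure m A) borel)"

definition poisson_process :: "'w measure \<Rightarrow> 'a measure \<Rightarrow> ('w \<Rightarrow> 'a measure) \<Rightarrow> bool" where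
  "poisson_process M \<mu> N \<longleftrightarrow> prob_space M \<and> N \<in> measurable M (counting_algebra \<mu>)
     \<and> (\<forall>A\<in>sets \<mu>. \<forall>k::nat. measure M {\<omega> \<in> space M. emeasure (N \<omega>) A = of_nat k}
            = measure \<mu> A ^ k / fact k * exp (- measure \<mu> A))
     \<and> (\<forall>(I::nat set) A. finite I \<longrightarrow> A ` I \<subseteq> sets \<mu> \<longrightarrow> disjoint_family_on A I \<longrightarrow>
            prob_space.indep_vars M (\<lambda>_. borel) (\<lambda>i \<omega>. emeasure (N \<omega>) (A i)) I)"

text \<open>
  \<open>M l\<close> is the underlying probability space when the processes \<open>\<kappa> 1, \<kappa> 2, \<dots>\<close> have intensity \<open>l\<close>.
  \<open>density\<close> ignores the negative part of \<open>l\<close>, so it is used for \<open>l \<ge> 0\<close> a.e. only.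
\<close>

definition poisson_sample ::
  "'a measure \<Rightarrow> (('a \<Rightarrow> real) \<Rightarrow> 'w measure) \<Rightarrow> (nat \<Rightarrow> 'w \<Rightarrow> 'a measure) \<Rightarrow> ('a \<Rightarrow> real) \<Rightarrow> bool" where
  "poisson_sample \<nu> M \<kappa> l \<longleftrightarrow> prob_space (M l)
     \<and> (\<forall>i\<ge>1. poisson_process (M l) (density \<nu> (\<lambda>x. ennreal (l x))) (\<kappa> i))
     \<and> prob_space.indep_vars (M l) (\<lambda>_. counting_algebra \<nu>) \<kappa> {1..}"


section \<open>Tests\<close>

definition is_test :: "'a measure \<Rightarrow> nat \<Rightarrow> ((nat \<Rightarrow> 'a measure) \<Rightarrow> real) \<Rightarrow> bool" where
  "is_test \<nu> n K \<longleftrightarrow> K \<in> borel_measurable (PiM {1..n} (\<lambda>_. counting_algebra \<nu>))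
     \<and> (\<forall>k \<in> space (PiM {1..n} (\<lambda>_. counting_algebra \<nu>)). 0 \<le> K k \<and> K k \<le> 1)"

text \<open>Error probabilities are taken in \<open>ennreal\<close>, where the supremum over the empty set is \<open>0\<close>.\<close>

definition test_alpha :: "(('a \<Rightarrow> real) \<Rightarrow> 'w measure) \<Rightarrow> (nat \<Rightarrow> 'w \<Rightarrow> 'a measure) \<Rightarrow>
    ('a \<Rightarrow> real) set \<Rightarrow> nat \<Rightarrow> ((nat \<Rightarrow> 'a measure) \<Rightarrow> real) \<Rightarrow> ennreal" where
  "test_alpha M \<kappa> \<Theta>0 n K =
     (SUP l\<in>\<Theta>0. \<integral>\<^sup>+\<omega>. ennreal (K (\<lambda>i\<in>{1..n}. \<kappa> i \<omega>)) \<partial>M l)"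

definition test_beta :: "(('a \<Rightarrow> real) \<Rightarrow> 'w measure) \<Rightarrow> (nat \<Rightarrow> 'w \<Rightarrow> 'a measure) \<Rightarrow>
    ('a \<Rightarrow> real) set \<Rightarrow> nat \<Rightarrow> ((nat \<Rightarrow> 'a measure) \<Rightarrow> real) \<Rightarrow> ennreal" where
  "test_beta M \<kappa> \<Theta>1 n K =
     (SUP l\<in>\<Theta>1. \<integral>\<^sup>+\<omega>. ennreal (1 - K (\<lambda>i\<in>{1..n}. \<kappa> i \<omega>)) \<partial>M l)"

definition distinguishable :: "'a measure \<Rightarrow> (('a \<Rightarrow> real) \<Rightarrow> 'w measure) \<Rightarrow>
    (nat \<Rightarrow> 'w \<Rightarrow> 'a measure) \<Rightarrow> ('a \<Rightarrow> real) set \<Rightarrow> ('a \<Rightarrow> real) set \<Rightarrow> bool" where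
  "distinguishable \<nu> M \<kappa> \<Theta>0 \<Theta>1 \<longleftrightarrow>
     (\<forall>\<alpha>::real. 0 < \<alpha> \<longrightarrow> \<alpha> < 1 \<longrightarrow>
       (\<exists>K. (\<forall>n\<ge>1. is_test \<nu> n (K n) \<and> test_alpha M \<kappa> \<Theta>0 n (K n) < ennreal \<alpha>)
          \<and> (\<lambda>n. test_beta M \<kappa> \<Theta>1 n (K n)) \<longlonglongrightarrow> 0))"

definition indistinguishable :: "'a measure \<Rightarrow> (('a \<Rightarrow> real) \<Rightarrow> 'w measure) \<Rightarrow>
    (nat \<Rightarrow> 'w \<Rightarrow> 'a measure) \<Rightarrow> ('a \<Rightarrow> real) set \<Rightarrow> ('a \<Rightarrow> real) set \<Rightarrow> bool" where
  "indistinguishable \<nu> M \<kappa> \<Theta>0 \<Theta>1 \<longleftrightarrow>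
     (\<forall>n\<ge>1. \<forall>K. is_test \<nu> n K \<longrightarrow> test_alpha M \<kappa> \<Theta>0 n K + test_beta M \<kappa> \<Theta>1 n K \<ge> 1)"

end

theory Submission
  imports Defs
begin

text \<open>
  Identify an intensity \<open>l\<close> with its masses \<open>\<integral>\<^sub>A l d\<nu>\<close> over the measurable sets \<open>A\<close>. On a bounded
  subset of \<open>L\<^sub>2(\<nu>)\<close> convergence of all masses is weak convergence, because simple functions are
  dense. Everything follows from the question whether the weak closures of \<open>\<Theta>\<^sub>0\<close> and \<open>\<Theta>\<^sub>1\<close> meet.

  \<^item> They meet if and only if the projections meet for each finite dimensional \<open>\<Gamma> \<subseteq> \<Theta>\<close>. A common point
    has a projection onto each \<open>\<Gamma>\<close> (\<open>common_point_imp_projections_meet\<close>). Conversely, take for \<open>\<Gamma>\<close> the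
    span of approximate projections onto \<open>\<Theta>\<close> of finitely many indicators: there are \<open>f \<in> \<Theta>\<^sub>0\<close> and
    \<open>g \<in> \<Theta>\<^sub>1\<close> with nearly the same masses on the given sets
    (\<open>inseparable_projections_imp_weakly_close\<close>), and weak compactness turns a net of such pairs into
    a common weak limit (\<open>weakly_close_imp_common_limit\<close>). The limit is found without Hilbert space
    theory: by Tychonoff the masses converge along a finer filter, and the limiting set function has
    a Radon-Nikodym density.

  \<^item> If they do not meet, then compactness gives finitely many sets whose masses separate \<open>\<Theta>\<^sub>0\<close> from
    \<open>\<Theta>\<^sub>1\<close> by a fixed amount. The average count of the sample in \<open>A\<close> has mean \<open>\<integral>\<^sub>A l d\<nu>\<close> and a
    variance of order \<open>1 / n\<close>, uniformly over both sets, so Chebyshev's inequality controls both errors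
    of the test that accepts when the averages are near the masses of some element of \<open>\<Theta>\<^sub>0\<close>
    (\<open>separated_imp_distinguishable\<close>).

  \<^item> If nets in \<open>\<Theta>\<^sub>0\<close> and \<open>\<Theta>\<^sub>1\<close> have the same weak limit \<open>l\<close>, then for every test the expectations
    along both nets converge to the expectation under \<open>l\<close>, so the two error probabilities
    cannot add up to less than \<open>1\<close> (\<open>common_weak_limit_imp_indistinguishable\<close>). The point is that the
    Poisson law depends setwise continuously on the intensity for the weak topology on bounded sets
    (\<open>poisson_law_setwise_limit\<close>). For the counts in the cells of a finite partition this is visible from
    the product of Poisson probabilities. It passes to all events because every Poisson law
    with intensity \<open>l\<close> is controlled by the law \<open>Q\<close> with intensity \<open>1\<close> through
    \<open>(\<integral>F dP)\<^sup>2 \<le> D \<cdot> \<integral>F\<^sup>2 dQ\<close>, with a constant \<open>D\<close> depending only on \<open>\<nu>(\<Omega>)\<close> and the norm of \<open>l\<close>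
    (\<open>poisson_law_square_le\<close>); hence the tails of a disjoint union are uniformly small. The limit \<open>l\<close>
    need not belong to \<open>\<Theta>\<^sub>0\<close> or \<open>\<Theta>\<^sub>1\<close>, so its Poisson law is constructed.
\<close>

section \<open>Events determined by finitely many counts\<close>

lemma space_counting_algebra:
  "space (counting_algebra K) = {m. sets m = sets K \<and> (\<forall>B\<in>sets K. emeasure m B \<in> range of_nat)}"
  unfolding counting_algebra_def by (subst space_Sup_eq_UN) auto

lemma measurable_emeasure_counting [measurable]:
  assumes "A \<in> sets K"
  shows "(\<lambda>m. emeasure m A) \<in> borel_measurable (counting_algebra K)"
  unfolding counting_algebra_def
  by (rule measurable_SUP1[OF assms measurable_vimage_algebra1]) auto

lemma measurable_counting_algebra:
  assumes "\<And>x. x \<in> space N \<Longrightarrow> f x \<in> space (counting_algebra K)"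
    and "\<And>A. A \<in> sets K \<Longrightarrow> (\<lambda>x. emeasure (f x) A) \<in> borel_measurable N"
  shows "f \<in> measurable N (counting_algebra K)"
  unfolding counting_algebra_def
  using assms unfolding space_counting_algebra
  by (intro measurable_SUP2 measurable_vimage_algebra2) auto

lemma counting_algebra_cong: "sets K = sets K' \<Longrightarrow> counting_algebra K = counting_algebra K'"
  by (simp add: counting_algebra_def)

lemma counting_algebra_setsD:
  assumes "m \<in> space (counting_algebra K)" shows "sets m = sets K" "space m = space K"
  using assms sets_eq_imp_space_eq by (auto simp: space_counting_algebra)

text \<open>
  A map \<open>c\<close> into the natural numbers stands for the partition of the space into the cells
  \<open>c -` {i}\<close>. The counts in disjoint cells are independent under a Poisson process.
\<close>

definition cell_event :: "'a measure \<Rightarrow> ('a \<Rightarrow> nat) \<Rightarrow> nat set \<Rightarrow> (nat \<Rightarrow> nat) \<Rightarrow> 'a measure set" where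
  "cell_event K c I n = {m \<in> space (counting_algebra K).
     \<forall>i\<in>I. emeasure m (c -` {i} \<inter> space K) = of_nat (n i)}"

lemma cell_event_sets [measurable]:
  assumes [measurable]: "c \<in> measurable K (count_space UNIV)" and "finite I"
  shows "cell_event K c I n \<in> sets (counting_algebra K)"
proof -
  have [measurable]: "(\<lambda>m. emeasure m (c -` {i} \<inter> space K)) \<in> borel_measurable (counting_algebra K)" for i
    by (rule measurable_emeasure_counting) measurable
  show ?thesis unfolding cell_event_def using \<open>finite I\<close> by measurable
qed

text \<open>
  The sets \<open>A j\<close> may overlap, which makes these events stable under intersection.
\<close>

definition count_event :: "'a measure \<Rightarrow> nat \<Rightarrow> (nat \<Rightarrow> 'a set) \<Rightarrow> (nat \<Rightarrow> nat) \<Rightarrow> 'a measure set" where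
  "count_event K r A n = {m \<in> space (counting_algebra K). \<forall>j<r. emeasure m (A j) = of_nat (n j)}"


lemma Int_stable_count_event:
  "Int_stable {count_event K r A n | r A n. A ` {..<r} \<subseteq> sets K}"
proof (rule Int_stableI)
  fix E E' assume "E \<in> {count_event K r A n | r A n. A ` {..<r} \<subseteq> sets K}"
    and "E' \<in> {count_event K r A n | r A n. A ` {..<r} \<subseteq> sets K}"
  then obtain r A n r' A' n' where E: "E = count_event K r A n" "A ` {..<r} \<subseteq> sets K"
    and E': "E' = count_event K r' A' n'" "A' ` {..<r'} \<subseteq> sets K" by blast
  define B where "B j = (if j < r then A j else A' (j - r))" for j
  define k where "k j = (if j < r then n j else n' (j - r))" for j
  have split: "(\<forall>j<r + r'. P j) \<longleftrightarrow> (\<forall>j<r. P j) \<and> (\<forall>j<r'. P (r + j))" for P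
  proof safe
    fix j assume *: "\<forall>j<r. P j" "\<forall>j<r'. P (r + j)" "j < r + r'"
    show "P j" using * by (cases "j < r") (auto dest: spec[of _ "j - r"])
  qed auto
  have "E \<inter> E' = count_event K (r + r') B k"
    unfolding E E' count_event_def split B_def k_def by auto
  moreover have "B ` {..<r + r'} \<subseteq> sets K" using E E' by (auto simp: B_def image_subset_iff)
  ultimately show "E \<inter> E' \<in> {count_event K r A n | r A n. A ` {..<r} \<subseteq> sets K}" by blast
qed

lemma sets_counting_algebra:
  "sets (counting_algebra K) = sigma_sets (space (counting_algebra K))
     {count_event K r A n | r A n. A ` {..<r} \<subseteq> sets K}" (is "_ = sigma_sets ?X ?G")
proof
  have "E \<in> sets (counting_algebra K)" if "E \<in> ?G" for E
  proof -
    from that obtain r A n where E: "E = count_event K r A n" "A ` {..<r} \<subseteq> sets K" by blast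
    have "{m \<in> space (counting_algebra K). emeasure m (A j) = of_nat (n j)}
        \<in> sets (counting_algebra K)" if "j \<in> {..<r}" for j
    proof -
      have [measurable]: "(\<lambda>m. emeasure m (A j)) \<in> borel_measurable (counting_algebra K)"
        using E that by (intro measurable_emeasure_counting) auto
      show ?thesis by measurable
    qed
    then have "{m \<in> space (counting_algebra K). \<forall>j\<in>{..<r}. emeasure m (A j) = of_nat (n j)}
        \<in> sets (counting_algebra K)"
      by (intro sets.sets_Collect_finite_All) auto
    then show ?thesis unfolding E(1) count_event_def lessThan_iff Ball_def by assumption
  qed
  then show "sigma_sets ?X ?G \<subseteq> sets (counting_algebra K)"
    by (intro sets.sigma_sets_subset subsetI)
next
  have GX: "?G \<subseteq> Pow ?X" by (auto simp: count_event_def)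
  have space: "space (sigma ?X ?G) = ?X" and sets: "sets (sigma ?X ?G) = sigma_sets ?X ?G"
    using GX by (rule space_measure_of, rule sets_measure_of)
  have "(\<lambda>m. m) \<in> measurable (sigma ?X ?G) (counting_algebra K)"
  proof (rule measurable_counting_algebra)
    fix A assume A: "A \<in> sets K"
    show "(\<lambda>m. emeasure m A) \<in> borel_measurable (sigma ?X ?G)"
    proof (rule measurableI)
      fix S :: "ennreal set"
      have count: "m \<in> count_event K 1 (\<lambda>_. A) (\<lambda>_. k) \<longleftrightarrow> m \<in> ?X \<and> emeasure m A = of_nat k" for m k
        by (simp add: count_event_def)
      have "\<exists>k. emeasure m A = of_nat k" if "m \<in> ?X" for m
        using that A unfolding space_counting_algebra by blast
      then have "m \<in> (\<lambda>m. emeasure m A) -` S \<inter> ?X \<longleftrightarrow>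
          m \<in> (\<Union>k\<in>{k. of_nat k \<in> S}. count_event K 1 (\<lambda>_. A) (\<lambda>_. k))" for m
        unfolding UN_iff Bex_def count Int_iff vimage_eq mem_Collect_eq
        by (cases "m \<in> ?X") (force, simp only: simp_thms)
      then have "(\<lambda>m. emeasure m A) -` S \<inter> ?X
        = (\<Union>k\<in>{k. of_nat k \<in> S}. count_event K 1 (\<lambda>_. A) (\<lambda>_. k))"
        by (rule set_eqI)
      also have "\<dots> \<in> sets (sigma ?X ?G)"
      proof (rule sets.countable_UN'')
        fix k
        have "(\<lambda>_. A) ` {..<1::nat} \<subseteq> sets K" using A by blast
        then show "count_event K 1 (\<lambda>_. A) (\<lambda>_. k) \<in> sets (sigma ?X ?G)"
          unfolding sets by (intro sigma_sets.Basic) blast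
      qed auto
      finally show "(\<lambda>m. emeasure m A) -` S \<inter> space (sigma ?X ?G) \<in> sets (sigma ?X ?G)"
        unfolding space .
    qed simp
  qed (simp only: space)
  show "sets (counting_algebra K) \<subseteq> sigma_sets ?X ?G"
  proof
    fix E assume E: "E \<in> sets (counting_algebra K)"
    have "(\<lambda>m. m) -` E \<inter> ?X \<in> sigma_sets ?X ?G"
      using measurable_sets[OF \<open>(\<lambda>m. m) \<in> _\<close> E] unfolding space sets .
    moreover have "(\<lambda>m. m) -` E \<inter> ?X = E" using sets.sets_into_space[OF E] by blast
    ultimately show "E \<in> sigma_sets ?X ?G" by simp
  qed
qed

text \<open>
  The cells are the atoms of the algebra generated by \<open>A 0, \<dots>, A (r - 1)\<close>: the number of the cell of
  a point \<open>x\<close> encodes the set of all \<open>j\<close> with \<open>x \<in> A j\<close>. The count in \<open>A j\<close> is the sum of the counts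
  in the atoms inside \<open>A j\<close>, so the event splits according to the vector of all atom counts.
\<close>

lemma count_event_eq_Union_cell_event:
  fixes A :: "nat \<Rightarrow> 'a set"
  assumes A: "A ` {..<r} \<subseteq> sets K"
  obtains c I V where "c \<in> measurable K (count_space UNIV)" "finite I" "c ` space K \<subseteq> I"
    "V \<subseteq> I \<rightarrow>\<^sub>E UNIV" "count_event K r A n = (\<Union>v\<in>V. cell_event K c I v)"
proof -
  define c where "c x = set_encode {j. j < r \<and> x \<in> A j}" for x
  define I where "I = set_encode ` Pow {..<r}"
  have fin: "finite I" by (simp add: I_def)
  have cI: "c ` space K \<subseteq> I" by (auto simp: c_def I_def)
  have dec: "set_decode (c x) = {j. j < r \<and> x \<in> A j}" for x
    by (simp add: c_def)
  have A': "A j \<in> sets K" if "j < r" for j using A that by auto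
  have c: "c \<in> measurable K (count_space UNIV)"
  proof (subst measurable_count_space_eq_countable)
    have "c -` {a} \<inter> space K \<in> sets K" for a
    proof -
      have "c -` {a} \<inter> space K = {x\<in>space K. c x = a \<and> a \<in> I}" using cI by auto
      also have "\<dots> = {x\<in>space K. a \<in> I \<and> (\<forall>j\<in>{..<r}. x \<in> A j \<longleftrightarrow> j \<in> set_decode a)}"
      proof -
        have "c x = a \<longleftrightarrow> (\<forall>j\<in>{..<r}. x \<in> A j \<longleftrightarrow> j \<in> set_decode a)" if "a \<in> I" for x
        proof -
          from that obtain T where T: "T \<subseteq> {..<r}" "a = set_encode T" by (auto simp: I_def)
          then have "finite T" by (auto dest: finite_subset)
          then have "c x = a \<longleftrightarrow> {j. j < r \<and> x \<in> A j} = T"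
            unfolding c_def T by (subst set_encode_eq) auto
          then show ?thesis using T \<open>finite T\<close> by (auto simp: set_eq_iff)
        qed
        then show ?thesis by auto
      qed
      also have "\<dots> \<in> sets K"
        using A' by (intro sets.sets_Collect sets.sets_Collect_finite_All) auto
      finally show ?thesis .
    qed
    then show "c \<in> space K \<rightarrow> UNIV \<and> (\<forall>a\<in>UNIV. c -` {a} \<inter> space K \<in> sets K)" by auto
  qed auto
  define V where "V = {v \<in> I \<rightarrow>\<^sub>E UNIV. \<forall>j<r. (\<Sum>i | i \<in> I \<and> j \<in> set_decode i. v i) = n j}"
  have count: "emeasure m (A j) = (\<Sum>i | i \<in> I \<and> j \<in> set_decode i. emeasure m (c -` {i} \<inter> space K))"
    if m: "m \<in> space (counting_algebra K)" and j: "j < r" for m j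
  proof -
    have "A j = (\<Union>i\<in>{i. i \<in> I \<and> j \<in> set_decode i}. c -` {i} \<inter> space K)"
      using cI j sets.sets_into_space[OF A'[OF j]] by (fastforce simp: dec)
    moreover have "emeasure m (\<Union>i\<in>{i. i \<in> I \<and> j \<in> set_decode i}. c -` {i} \<inter> space K)
       = (\<Sum>i | i \<in> I \<and> j \<in> set_decode i. emeasure m (c -` {i} \<inter> space K))"
      using fin measurable_sets[OF c]
      by (intro sum_emeasure[symmetric])
        (auto simp: counting_algebra_setsD[OF m] disjoint_family_on_def)
    ultimately show ?thesis by simp
  qed
  have "count_event K r A n = (\<Union>v\<in>V. cell_event K c I v)"
  proof (intro equalityI subsetI)
    fix m assume "m \<in> count_event K r A n"
    then have m: "m \<in> space (counting_algebra K)" "\<And>j. j < r \<Longrightarrow> emeasure m (A j) = of_nat (n j)"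
      by (auto simp: count_event_def)
    have "\<forall>i. \<exists>k. emeasure m (c -` {i} \<inter> space K) = of_nat k"
      using m(1) measurable_sets[OF c] by (auto simp: space_counting_algebra)
    then obtain k where k: "\<And>i. emeasure m (c -` {i} \<inter> space K) = of_nat (k i)" by metis
    define v where "v = restrict k I"
    have "(\<Sum>i | i \<in> I \<and> j \<in> set_decode i. v i) = n j" if "j < r" for j
    proof -
      have "of_nat (\<Sum>i | i \<in> I \<and> j \<in> set_decode i. v i) = (of_nat (n j) :: ennreal)"
        using m(2)[OF that] count[OF m(1) that] by (simp add: k v_def)
      then show ?thesis by (simp only: of_nat_eq_iff)
    qed
    then have "v \<in> V" by (auto simp: V_def v_def)
    moreover have "m \<in> cell_event K c I v" using m(1) by (auto simp: cell_event_def k v_def)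
    ultimately show "m \<in> (\<Union>v\<in>V. cell_event K c I v)" by blast
  next
    fix m assume "m \<in> (\<Union>v\<in>V. cell_event K c I v)"
    then obtain v where v: "v \<in> V" "m \<in> space (counting_algebra K)"
      "\<And>i. i \<in> I \<Longrightarrow> emeasure m (c -` {i} \<inter> space K) = of_nat (v i)"
      by (auto simp: cell_event_def)
    have "emeasure m (A j) = of_nat (n j)" if "j < r" for j
      using v that by (simp add: count V_def flip: of_nat_sum)
    then show "m \<in> count_event K r A n" using v by (auto simp: count_event_def)
  qed
  with c fin cI show ?thesis by (intro that[of c I V]) (auto simp: V_def)
qed

text \<open>
  By Dynkin's theorem a property that is stable under complements and countable disjoint unions need only
  be checked on cell events, where the Poisson probabilities are explicit.
\<close>

lemma counting_algebra_induct [consumes 1, case_names cell empty compl union]: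
  assumes E: "E \<in> sets (counting_algebra K)"
    and cell: "\<And>c I n. c \<in> measurable K (count_space UNIV) \<Longrightarrow> finite I \<Longrightarrow> c ` space K \<subseteq> I \<Longrightarrow>
        P (cell_event K c I n)"
    and empty: "P {}"
    and compl: "\<And>A. A \<in> sets (counting_algebra K) \<Longrightarrow> P A \<Longrightarrow> P (space (counting_algebra K) - A)"
    and union: "\<And>A. disjoint_family A \<Longrightarrow> range A \<subseteq> sets (counting_algebra K) \<Longrightarrow>
        (\<And>i::nat. P (A i)) \<Longrightarrow> P (\<Union>i. A i)"
  shows "P E"
proof -
  have union': "P (\<Union>v\<in>V. cell_event K c I v)"
    if V: "V \<subseteq> I \<rightarrow>\<^sub>E UNIV" "c \<in> measurable K (count_space UNIV)" "finite I" "c ` space K \<subseteq> I"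
    for c V I
  proof -
    have "countable V"
      using V by (intro countable_subset[OF V(1)] countable_PiE) auto
    define F where "F i = (if i \<in> to_nat_on V ` V then cell_event K c I (from_nat_into V i) else {})" for i
    have "(\<Union>v\<in>V. cell_event K c I v) = (\<Union>i. F i)"
      using \<open>countable V\<close> by (auto simp: F_def split: if_splits)
    moreover have "disjoint_family F"
    unfolding disjoint_family_on_def
    proof (intro ballI impI)
      fix i j :: nat assume "i \<noteq> j"
      show "F i \<inter> F j = {}"
      proof (rule ccontr)
        assume "F i \<inter> F j \<noteq> {}"
        then obtain m where m: "m \<in> F i" "m \<in> F j" by blast
        have "\<exists>v\<in>V. a = to_nat_on V v \<and> m \<in> cell_event K c I v" if "m \<in> F a" for a
          using that \<open>countable V\<close> by (auto simp: F_def split: if_splits)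
        with m obtain v w where *: "i = to_nat_on V v" "j = to_nat_on V w" "v \<in> V" "w \<in> V"
            "m \<in> cell_event K c I v" "m \<in> cell_event K c I w" by meson
        then have "v a = w a" if "a \<in> I" for a
          using that by (auto simp: cell_event_def)
        with * V have "v = w" by (intro PiE_ext[of v I _ w]) auto
        with * \<open>i \<noteq> j\<close> show False by simp
      qed
    qed
    moreover have "range F \<subseteq> sets (counting_algebra K)"
      using V by (auto simp: F_def)
    moreover have "P (F i)" for i using V by (auto simp: F_def empty intro!: cell)
    ultimately show ?thesis using union by simp
  qed
  have GX: "{count_event K r A n | r A n. A ` {..<r} \<subseteq> sets K} \<subseteq> Pow (space (counting_algebra K))"
    by (auto simp: count_event_def)
  from E have "E \<in> sigma_sets (space (counting_algebra K))
      {count_event K r A n | r A n. A ` {..<r} \<subseteq> sets K}"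
    by (simp only: sets_counting_algebra)
  then show ?thesis
  proof (induction rule: sigma_sets_induct_disjoint[OF Int_stable_count_event GX, consumes 1,
        case_names basic empty compl union])
    case (basic A)
    then obtain r B n where A: "A = count_event K r B n" "B ` {..<r} \<subseteq> sets K" by blast
    from count_event_eq_Union_cell_event[OF A(2), of n] union' show ?case
      unfolding A by metis
  next
    case (compl A) then show ?case using assms(4) by (simp add: sets_counting_algebra)
  next
    case (union A) then show ?case using assms(5)[of A] by (simp add: sets_counting_algebra)
  qed (rule empty)
qed

section \<open>The Poisson law of a finite measure\<close>

definition add_point :: "'a measure \<Rightarrow> 'a \<Rightarrow> 'a measure" where
  "add_point m x = measure_of (space m) (sets m) (\<lambda>A. emeasure m A + indicator A x)"

lemma sets_add_point [simp]: "sets (add_point m x) = sets m"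
  by (simp add: add_point_def)

lemma emeasure_add_point:
  assumes "A \<in> sets m"
  shows "emeasure (add_point m x) A = emeasure m A + indicator A x"
  unfolding add_point_def
proof (rule emeasure_measure_of_sigma[OF sets.sigma_algebra_axioms _ _ assms])
  show "positive (sets m) (\<lambda>A. emeasure m A + indicator A x)"
    by (simp add: positive_def)
  show "countably_additive (sets m) (\<lambda>A. emeasure m A + indicator A x)"
    unfolding countably_additive_def
  proof (intro allI impI)
    fix A :: "nat \<Rightarrow> 'a set"
    assume A: "range A \<subseteq> sets m" "disjoint_family A" "\<Union> (range A) \<in> sets m"
    have "(\<Sum>i. emeasure m (A i) + indicator (A i) x)
        = (\<Sum>i. emeasure m (A i)) + (\<Sum>i. emeasure (return m x) (A i))"
      using A by (subst suminf_add[symmetric]) auto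
    also have "\<dots> = emeasure m (\<Union> (range A)) + emeasure (return m x) (\<Union> (range A))"
      using A by (subst (1 2) suminf_emeasure) auto
    finally show "(\<Sum>i. emeasure m (A i) + indicator (A i) x)
        = emeasure m (\<Union> (range A)) + indicator (\<Union> (range A)) x"
      using A by simp
  qed
qed

lemma add_point_in_counting_algebra:
  assumes "m \<in> space (counting_algebra K)"
  shows "add_point m x \<in> space (counting_algebra K)"
  unfolding space_counting_algebra
proof (safe; (elim conjE)?)
  fix B assume B: "B \<in> sets K"
  obtain k where "emeasure m B = of_nat k"
    using assms B by (auto simp: space_counting_algebra)
  then have "emeasure (add_point m x) B = of_nat (k + (if x \<in> B then 1 else 0))"
    using B counting_algebra_setsD[OF assms] by (simp add: emeasure_add_point indicator_def)
  then show "emeasure (add_point m x) B \<in> range of_nat" by blast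
qed (use counting_algebra_setsD[OF assms] in auto)

lemma measurable_add_point [measurable]:
  "case_prod add_point \<in> measurable (counting_algebra K \<Otimes>\<^sub>M K) (counting_algebra K)"
proof (rule measurable_counting_algebra)
  fix A assume [measurable]: "A \<in> sets K"
  have "(\<lambda>p. emeasure (fst p) A + indicator A (snd p)) \<in> borel_measurable (counting_algebra K \<Otimes>\<^sub>M K)"
    by measurable
  also have "?this \<longleftrightarrow> (\<lambda>p. emeasure (case_prod add_point p) A)
      \<in> borel_measurable (counting_algebra K \<Otimes>\<^sub>M K)"
    by (intro measurable_cong)
      (auto simp: space_pair_measure emeasure_add_point counting_algebra_setsD)
  finally show "(\<lambda>p. emeasure (case_prod add_point p) A) \<in> borel_measurable (counting_algebra K \<Otimes>\<^sub>M K)" .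
qed (auto simp: space_pair_measure add_point_in_counting_algebra)

lemma null_measure_in_counting_algebra: "null_measure K \<in> space (counting_algebra K)"
  by (auto simp: space_counting_algebra intro!: range_eqI[of _ _ 0])

text \<open>
  The integral over the position of one additional point with distribution \<open>\<mu>\<close>. Its iterates, started
  at the null measure, integrate a function over all configurations of \<open>k\<close> points; this replaces
  integration over the \<open>k\<close>-fold product of \<open>\<mu>\<close>.
\<close>

definition point_integral :: "'a measure \<Rightarrow> ('a measure \<Rightarrow> ennreal) \<Rightarrow> 'a measure \<Rightarrow> ennreal" where
  "point_integral \<mu> F m = (\<integral>\<^sup>+x. F (add_point m x) \<partial>\<mu>)"

abbreviation points_integral :: "'a measure \<Rightarrow> nat \<Rightarrow> ('a measure \<Rightarrow> ennreal) \<Rightarrow> 'a measure \<Rightarrow> ennreal" where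
  "points_integral \<mu> k \<equiv> point_integral \<mu> ^^ k"

text \<open>
  A Poisson process with mean measure \<open>\<mu>\<close> has \<open>k\<close> points with probability \<open>exp (- L) L\<^sup>k / k!\<close>,
  \<open>L = \<mu>(\<Omega>)\<close>, and given that, they are independent with distribution \<open>\<mu> / L\<close>. The powers of
  \<open>L\<close> cancel, so that \<open>\<mu> = 0\<close> is not exceptional.
\<close>

definition poisson_expectation :: "'a measure \<Rightarrow> ('a measure \<Rightarrow> ennreal) \<Rightarrow> ennreal" where
  "poisson_expectation \<mu> F =
     (\<Sum>k. ennreal (exp (- measure \<mu> (space \<mu>)) / fact k) * points_integral \<mu> k F (null_measure \<mu>))"

definition poisson_law :: "'a measure \<Rightarrow> 'a measure measure" where
  "poisson_law \<mu> = measure_of (space (counting_algebra \<mu>)) (sets (counting_algebra \<mu>))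
     (\<lambda>E. poisson_expectation \<mu> (indicator E))"

lemma sets_poisson_law [simp, measurable_cong]: "sets (poisson_law \<mu>) = sets (counting_algebra \<mu>)"
  and space_poisson_law [simp]: "space (poisson_law \<mu>) = space (counting_algebra \<mu>)"
  by (simp_all add: poisson_law_def)

context finite_measure
begin

lemma measurable_points_integral [measurable]:
  assumes "F \<in> borel_measurable (counting_algebra M)"
  shows "points_integral M k F \<in> borel_measurable (counting_algebra M)"
proof (induction k)
  case (Suc k)
  note Suc[measurable]
  have "(\<lambda>m. \<integral>\<^sup>+x. points_integral M k F (case_prod add_point (m, x)) \<partial>M)
      \<in> borel_measurable (counting_algebra M)"
    by measurable
  then show ?case by (simp add: point_integral_def[abs_def])
qed (simp add: assms)

lemma measurable_comp_add_point:
  assumes [measurable]: "F \<in> borel_measurable (counting_algebra M)"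
    and "m \<in> space (counting_algebra M)"
  shows "(\<lambda>x. F (add_point m x)) \<in> borel_measurable M"
proof -
  have "(\<lambda>x. F (case_prod add_point (m, x))) \<in> borel_measurable M"
    using assms(2) by measurable
  then show ?thesis by simp
qed

lemma points_integral_cong:
  assumes "\<And>m. m \<in> space (counting_algebra M) \<Longrightarrow> F m = G m"
    and "m \<in> space (counting_algebra M)"
  shows "points_integral M k F m = points_integral M k G m"
  using assms(2)
  by (induction k arbitrary: m)
    (auto simp: assms(1) point_integral_def add_point_in_counting_algebra intro!: nn_integral_cong)

lemma points_integral_mono:
  assumes "\<And>m. m \<in> space (counting_algebra M) \<Longrightarrow> F m \<le> G m"
    and "m \<in> space (counting_algebra M)"
  shows "points_integral M k F m \<le> points_integral M k G m"
  using assms(2)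
  by (induction k arbitrary: m)
    (auto simp: assms(1) point_integral_def add_point_in_counting_algebra intro!: nn_integral_mono)

lemma points_integral_Suc:
  "points_integral M (Suc k) F m = (\<integral>\<^sup>+x. points_integral M k F (add_point m x) \<partial>M)"
  by (simp add: point_integral_def)

lemma points_integral_cmult:
  assumes [measurable]: "F \<in> borel_measurable (counting_algebra M)"
    and "m \<in> space (counting_algebra M)"
  shows "points_integral M k (\<lambda>m. a * F m) m = a * points_integral M k F m"
  using assms(2)
proof (induction k arbitrary: m)
  note [measurable] = measurable_comp_add_point
  case (Suc k)
  then have "points_integral M (Suc k) (\<lambda>m. a * F m) m
      = (\<integral>\<^sup>+x. a * points_integral M k F (add_point m x) \<partial>M)"
    by (simp add: points_integral_Suc add_point_in_counting_algebra del: funpow.simps cong: nn_integral_cong)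
  also have "\<dots> = a * points_integral M (Suc k) F m"
    using Suc.prems by (simp add: points_integral_Suc del: funpow.simps add: nn_integral_cmult)
  finally show ?case .
qed simp

lemma points_integral_add:
  assumes [measurable]: "F \<in> borel_measurable (counting_algebra M)" "G \<in> borel_measurable (counting_algebra M)"
    and "m \<in> space (counting_algebra M)"
  shows "points_integral M k (\<lambda>m. F m + G m) m = points_integral M k F m + points_integral M k G m"
  using assms(3)
proof (induction k arbitrary: m)
  note [measurable] = measurable_comp_add_point
  case (Suc k)
  then have "points_integral M (Suc k) (\<lambda>m. F m + G m) m
      = (\<integral>\<^sup>+x. points_integral M k F (add_point m x) + points_integral M k G (add_point m x) \<partial>M)"
    by (simp add: points_integral_Suc add_point_in_counting_algebra del: funpow.simps cong: nn_integral_cong)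
  also have "\<dots> = points_integral M (Suc k) F m + points_integral M (Suc k) G m"
    using Suc.prems by (simp add: points_integral_Suc del: funpow.simps add: nn_integral_add)
  finally show ?case .
qed simp

lemma points_integral_sum:
  assumes "finite I" and [measurable]: "\<And>i. i \<in> I \<Longrightarrow> F i \<in> borel_measurable (counting_algebra M)"
    and "m \<in> space (counting_algebra M)"
  shows "points_integral M k (\<lambda>m. \<Sum>i\<in>I. F i m) m = (\<Sum>i\<in>I. points_integral M k (F i) m)"
  using assms(1,2)
proof (induction I)
  case empty
  have "points_integral M k (\<lambda>m. 0 * 0) m = 0 * points_integral M k (\<lambda>m. 0) m"
    using assms(3) by (intro points_integral_cmult) auto
  then show ?case by simp
next
  case (insert i I)
  then have "points_integral M k (\<lambda>m. F i m + (\<Sum>i\<in>I. F i m)) m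
      = points_integral M k (F i) m + points_integral M k (\<lambda>m. \<Sum>i\<in>I. F i m) m"
    using assms(3) by (intro points_integral_add) auto
  with insert show ?case by simp
qed

lemma points_integral_zero: "points_integral M k (\<lambda>m. 0) (null_measure M) = 0"
  using points_integral_sum[of "{}" _ "null_measure M" k] by (simp add: null_measure_in_counting_algebra)

lemma points_integral_SUP:
  assumes [measurable]: "\<And>i. F i \<in> borel_measurable (counting_algebra M)" and "incseq F"
    and "m \<in> space (counting_algebra M)"
  shows "points_integral M k (\<lambda>m. \<Squnion>i. F i m) m = (\<Squnion>i. points_integral M k (F i) m)"
  using assms(3)
proof (induction k arbitrary: m)
  note [measurable] = measurable_comp_add_point
  case (Suc k)
  then have "points_integral M (Suc k) (\<lambda>m. \<Squnion>i. F i m) m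
      = (\<integral>\<^sup>+x. (\<Squnion>i. points_integral M k (F i) (add_point m x)) \<partial>M)"
    by (simp add: points_integral_Suc add_point_in_counting_algebra del: funpow.simps cong: nn_integral_cong)
  also have "\<dots> = (\<integral>\<^sup>+x. (\<Squnion>i. indicator (space M) x * points_integral M k (F i) (add_point m x)) \<partial>M)"
    by (intro nn_integral_cong) simp
  also have "\<dots> = (\<Squnion>i. \<integral>\<^sup>+x. indicator (space M) x * points_integral M k (F i) (add_point m x) \<partial>M)"
  proof (rule nn_integral_monotone_convergence_SUP)
    show "incseq (\<lambda>i x. indicator (space M) x * points_integral M k (F i) (add_point m x))"
      using assms(2) Suc.prems add_point_in_counting_algebra
      by (auto simp: incseq_def le_fun_def intro!: mult_left_mono points_integral_mono)
  qed (use Suc.prems in measurable)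
  also have "\<dots> = (\<Squnion>i. points_integral M (Suc k) (F i) m)"
    by (auto simp: points_integral_Suc simp del: funpow.simps intro!: SUP_cong nn_integral_cong)
  finally show ?case .
qed simp

lemma points_integral_suminf:
  assumes [measurable]: "\<And>i. F i \<in> borel_measurable (counting_algebra M)"
    and "m \<in> space (counting_algebra M)"
  shows "points_integral M k (\<lambda>m. \<Sum>i. F i m) m = (\<Sum>i. points_integral M k (F i) m)"
  using assms(2)
proof (induction k arbitrary: m)
  note [measurable] = measurable_comp_add_point
  case (Suc k)
  then have "points_integral M (Suc k) (\<lambda>m. \<Sum>i. F i m) m
      = (\<integral>\<^sup>+x. (\<Sum>i. points_integral M k (F i) (add_point m x)) \<partial>M)"
    by (simp add: points_integral_Suc add_point_in_counting_algebra del: funpow.simps cong: nn_integral_cong)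
  also have "\<dots> = (\<Sum>i. points_integral M (Suc k) (F i) m)"
    using Suc.prems by (simp add: points_integral_Suc del: funpow.simps add: nn_integral_suminf)
  finally show ?case .
qed simp

lemma poisson_expectation_suminf:
  assumes [measurable]: "\<And>i. F i \<in> borel_measurable (counting_algebra M)"
  shows "poisson_expectation M (\<lambda>m. \<Sum>i. F i m) = (\<Sum>i. poisson_expectation M (F i))"
proof -
  have "poisson_expectation M (\<lambda>m. \<Sum>i. F i m)
      = (\<Sum>k. \<Sum>i. ennreal (exp (- measure M (space M)) / fact k) * points_integral M k (F i) (null_measure M))"
    unfolding poisson_expectation_def
    by (simp add: points_integral_suminf null_measure_in_counting_algebra)
  also have "\<dots> = (\<Sum>i. poisson_expectation M (F i))"
    unfolding poisson_expectation_def nn_integral_count_space_nat[symmetric]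
    by (rule nn_integral_count_space_nn_integral) auto
  finally show ?thesis .
qed

lemma poisson_expectation_cong:
  assumes "\<And>m. m \<in> space (counting_algebra M) \<Longrightarrow> F m = G m"
  shows "poisson_expectation M F = poisson_expectation M G"
  unfolding poisson_expectation_def
  by (intro suminf_cong) (simp add: points_integral_cong[OF assms] null_measure_in_counting_algebra)

lemma emeasure_poisson_law:
  assumes "E \<in> sets (counting_algebra M)"
  shows "emeasure (poisson_law M) E = poisson_expectation M (indicator E)"
  unfolding poisson_law_def
proof (rule emeasure_measure_of_sigma[OF sets.sigma_algebra_axioms _ _ assms])
  have "(indicator {} :: 'a measure \<Rightarrow> ennreal) = (\<lambda>m. 0)" by auto
  then show "positive (sets (counting_algebra M)) (\<lambda>E. poisson_expectation M (indicator E))"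
    by (simp add: positive_def poisson_expectation_def points_integral_zero)
  show "countably_additive (sets (counting_algebra M)) (\<lambda>E. poisson_expectation M (indicator E))"
    unfolding countably_additive_def
  proof (intro allI impI)
    fix A :: "nat \<Rightarrow> _"
    assume A: "range A \<subseteq> sets (counting_algebra M)" "disjoint_family A"
    have "poisson_expectation M (\<lambda>m. \<Sum>i. indicator (A i) m) = (\<Sum>i. poisson_expectation M (indicator (A i)))"
      using A by (intro poisson_expectation_suminf) auto
    then show "(\<Sum>i. poisson_expectation M (indicator (A i))) = poisson_expectation M (indicator (\<Union> (range A)))"
      using A by (simp add: suminf_indicator)
  qed
qed

lemma nn_integral_poisson_law:
  assumes "F \<in> borel_measurable (counting_algebra M)"
  shows "(\<integral>\<^sup>+m. F m \<partial>poisson_law M) = poisson_expectation M F"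
proof -
  from assms have "F \<in> borel_measurable (poisson_law M)" by simp
  then show ?thesis
  proof (induction rule: borel_measurable_induct)
    case (cong f g)
    then have "poisson_expectation M f = poisson_expectation M g"
      by (intro poisson_expectation_cong) auto
    with cong show ?case by (simp cong: nn_integral_cong_simp)
  next
    case (set A)
    then show ?case by (simp add: emeasure_poisson_law)
  next
    case (mult u c)
    then show ?case
      by (simp add: nn_integral_cmult poisson_expectation_def points_integral_cmult
          null_measure_in_counting_algebra mult.left_commute flip: ennreal_suminf_cmult)
  next
    case (add u v)
    then show ?case
      by (simp add: nn_integral_add poisson_expectation_def points_integral_add
          null_measure_in_counting_algebra distrib_left suminf_add)
  next
    case (seq U)
    have [measurable]: "U i \<in> borel_measurable (counting_algebra M)" for i using seq(1)[of i] by simp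
    have "(\<integral>\<^sup>+m. (\<Squnion>i. U i) m \<partial>poisson_law M) = (\<Squnion>i. \<integral>\<^sup>+m. U i m \<partial>poisson_law M)"
      using seq by (simp add: SUP_apply[abs_def] nn_integral_monotone_convergence_SUP)
    also have "\<dots> = (\<Squnion>i. poisson_expectation M (U i))"
      using seq by simp
    also have "\<dots> = poisson_expectation M (\<lambda>m. \<Squnion>i. U i m)"
    proof -
      have "incseq (\<lambda>i. points_integral M k (U i) (null_measure M))" for k
        using seq(3) null_measure_in_counting_algebra
        by (auto simp: incseq_def le_fun_def intro!: points_integral_mono)
      then have "(\<Squnion>i. poisson_expectation M (U i))
        = (\<Sum>k. \<Squnion>i. ennreal (exp (- measure M (space M)) / fact k) * points_integral M k (U i) (null_measure M))"
        unfolding poisson_expectation_def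
        by (intro ennreal_suminf_SUP_eq[symmetric]) (auto simp: incseq_def intro!: mult_left_mono)
      then show ?thesis
        unfolding poisson_expectation_def
        by (simp add: points_integral_SUP seq(3) null_measure_in_counting_algebra SUP_mult_left_ennreal)
    qed
    finally show ?case by (simp add: SUP_apply[abs_def])
  qed
qed

lemma prob_space_poisson_law: "prob_space (poisson_law M)"
proof
  let ?L = "measure M (space M)"
  have one: "points_integral M k (\<lambda>_. 1) m = ennreal (?L ^ k)" for k m
    by (induction k arbitrary: m)
      (simp_all add: point_integral_def emeasure_eq_measure ennreal_mult mult.commute)
  have "emeasure (poisson_law M) (space (poisson_law M)) = poisson_expectation M (\<lambda>_. 1)"
    by (simp add: emeasure_poisson_law) (rule poisson_expectation_cong, simp)
  also have "\<dots> = (\<Sum>k. ennreal (exp (- ?L) * (?L ^ k / fact k)))"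
    by (simp add: poisson_expectation_def one flip: ennreal_mult)
  also have "\<dots> = ennreal (exp (- ?L) * exp ?L)"
    using sums_mult[OF exp_converges[of ?L], of "exp (- ?L)"]
    by (intro suminf_ennreal_eq) (auto simp: scaleR_conv_of_real divide_inverse mult.commute)
  also have "\<dots> = 1" by (simp flip: exp_add)
  finally show "emeasure (poisson_law M) (space (poisson_law M)) = 1" .
qed

text \<open>
  A new point in cell \<open>i\<close> leads to the counts \<open>n\<close> exactly if the old counts were \<open>n\<close> with one point
  less in cell \<open>i\<close>.
\<close>

lemma point_integral_cell_event:
  assumes c[measurable]: "c \<in> measurable M (count_space UNIV)" and I: "finite I" "c ` space M \<subseteq> I"
    and m: "m \<in> space (counting_algebra M)"
  shows "point_integral M (indicator (cell_event M c I n)) m =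
    (\<Sum>i\<in>I. emeasure M (c -` {i} \<inter> space M) *
       (if n i > 0 then indicator (cell_event M c I (n(i := n i - 1))) m else 0))"
proof -
  define g where "g i = (if n i > 0 then indicator (cell_event M c I (n(i := n i - 1))) m else 0 :: ennreal)" for i
  have cs: "c -` {i} \<inter> space M \<in> sets M" for i by measurable
  have ind [measurable]: "(indicator (c -` {i} \<inter> space M) :: 'a \<Rightarrow> ennreal) \<in> borel_measurable M" for i
    using cs by (rule borel_measurable_indicator)
  have eq: "indicator (cell_event M c I n) (add_point m x) = (\<Sum>i\<in>I. indicator (c -` {i} \<inter> space M) x * g i)"
    if x: "x \<in> space M" for x
  proof -
    have cx: "c x \<in> I" using x I by auto
    have "(\<Sum>i\<in>I. indicator (c -` {i} \<inter> space M) x * g i) = g (c x)"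
      using I x cx by (subst sum.remove[of _ "c x"]) (auto intro!: sum.neutral)
    moreover have "indicator (cell_event M c I n) (add_point m x) = g (c x)"
    proof -
      have "\<forall>i. \<exists>k. emeasure m (c -` {i} \<inter> space M) = of_nat k"
        using m cs by (auto simp: space_counting_algebra)
      then obtain k where k: "\<And>i. emeasure m (c -` {i} \<inter> space M) = of_nat (k i)" by metis
      have "emeasure (add_point m x) (c -` {i} \<inter> space M) = of_nat (k i + (if i = c x then 1 else 0))" for i
        using cs x counting_algebra_setsD[OF m] by (auto simp: emeasure_add_point k indicator_def)
      then have "add_point m x \<in> cell_event M c I n \<longleftrightarrow> (\<forall>i\<in>I. k i + (if i = c x then 1 else 0) = n i)"
        unfolding cell_event_def using m add_point_in_counting_algebra[of m M x]
        by (simp only: of_nat_eq_iff mem_Collect_eq) simp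
      also have "\<dots> \<longleftrightarrow> n (c x) > 0 \<and> (\<forall>i\<in>I. k i = (n(c x := n (c x) - 1)) i)"
        using cx by (auto split: if_splits)
      also have "\<dots> \<longleftrightarrow> n (c x) > 0 \<and> m \<in> cell_event M c I (n(c x := n (c x) - 1))"
        unfolding cell_event_def using m by (simp only: k of_nat_eq_iff mem_Collect_eq) simp
      finally show ?thesis by (auto simp: g_def indicator_def)
    qed
    ultimately show ?thesis by simp
  qed
  have "point_integral M (indicator (cell_event M c I n)) m
      = (\<integral>\<^sup>+x. (\<Sum>i\<in>I. indicator (c -` {i} \<inter> space M) x * g i) \<partial>M)"
    unfolding point_integral_def by (intro nn_integral_cong eq)
  also have "\<dots> = (\<Sum>i\<in>I. emeasure M (c -` {i} \<inter> space M) * g i)"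
    using cs by (subst nn_integral_sum) (simp_all add: nn_integral_multc ind)
  finally show ?thesis unfolding g_def .
qed

text \<open>
  The multinomial distribution of \<open>k\<close> independent points over the cells, by the recursion of the preceding
  lemma. Each summand of the recursion is \<open>n i\<close> times the same product, and the \<open>n i\<close> add up to \<open>k + 1\<close>.
\<close>

lemma points_integral_cell_event:
  assumes c[measurable]: "c \<in> measurable M (count_space UNIV)" and I: "finite I" "c ` space M \<subseteq> I"
  shows "points_integral M k (indicator (cell_event M c I n)) (null_measure M) =
    ennreal (if (\<Sum>i\<in>I. n i) = k
      then fact k * (\<Prod>i\<in>I. measure M (c -` {i} \<inter> space M) ^ n i / fact (n i)) else 0)"
proof (induction k arbitrary: n)
  case 0
  have "null_measure M \<in> cell_event M c I n \<longleftrightarrow> (\<forall>i\<in>I. n i = 0)"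
    using null_measure_in_counting_algebra[of M] by (auto simp: cell_event_def)
  then show ?case using I by (auto simp: indicator_def)
next
  case (Suc k)
  define w where "w i = measure M (c -` {i} \<inter> space M)" for i
  define p where "p n = (\<Prod>i\<in>I. w i ^ n i / fact (n i))" for n :: "nat \<Rightarrow> nat"
  define n' where "n' i = n(i := n i - 1)" for i
  have w0: "w i \<ge> 0" for i by (simp add: w_def)
  have p0: "p n \<ge> 0" for n by (auto simp: p_def w0 intro!: prod_nonneg)
  have cell: "cell_event M c I n \<in> sets (counting_algebra M)" for n
    using I by measurable
  let ?z = "null_measure M"
  have "points_integral M (Suc k) (indicator (cell_event M c I n)) ?z
      = points_integral M k (point_integral M (indicator (cell_event M c I n))) ?z"
    by (simp add: funpow_swap1)
  also have "\<dots> = points_integral M k (\<lambda>m. \<Sum>i\<in>I. ennreal (w i) *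
       (if n i > 0 then indicator (cell_event M c I (n' i)) m else 0)) ?z"
    using assms by (intro points_integral_cong)
      (simp_all add: point_integral_cell_event null_measure_in_counting_algebra w_def n'_def emeasure_eq_measure
        cong: if_cong)
  also have "\<dots> = (\<Sum>i\<in>I. ennreal (w i) * points_integral M k
       (\<lambda>m. (if n i > 0 then 1 else 0) * indicator (cell_event M c I (n' i)) m) ?z)"
    using I cell null_measure_in_counting_algebra[of M]
    by (subst points_integral_sum)
      (auto simp: points_integral_cmult points_integral_zero intro!: sum.cong)
  also have "\<dots> = (\<Sum>i\<in>I. ennreal (w i) * ((if n i > 0 then 1 else 0) *
        points_integral M k (indicator (cell_event M c I (n' i))) ?z))"
    using cell null_measure_in_counting_algebra[of M] by (subst points_integral_cmult) auto
  also have "\<dots> = (\<Sum>i\<in>I. ennreal (if sum n I = Suc k then fact k * (n i * p n) else 0))"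
  proof (intro sum.cong refl)
    fix i assume i: "i \<in> I"
    show "ennreal (w i) * ((if n i > 0 then 1 else 0) * points_integral M k (indicator (cell_event M c I (n' i))) ?z)
        = ennreal (if sum n I = Suc k then fact k * (n i * p n) else 0)"
    proof (cases "n i")
      case (Suc a)
      have "sum n I = Suc (sum (n' i) I)"
        using I i Suc by (simp add: sum.remove[of I i] n'_def)
      moreover have "w i * p (n' i) = n i * p n"
      proof -
        have "p (n' i) = w i ^ a / fact a * (\<Prod>j\<in>I - {i}. w j ^ n j / fact (n j))"
          using I i Suc by (simp add: p_def prod.remove[of I i] n'_def)
        moreover have "p n = w i ^ n i / fact (n i) * (\<Prod>j\<in>I - {i}. w j ^ n j / fact (n j))"
          using I i Suc by (simp add: p_def prod.remove[of I i])
        moreover have "n i * (w i ^ n i / fact (n i)) = w i * (w i ^ a / fact a)"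
          by (simp add: Suc del: of_nat_Suc)
        ultimately show ?thesis by (simp only: mult.assoc[symmetric])
      qed
      ultimately show ?thesis
        unfolding Suc.IH w_def[symmetric] p_def[symmetric] using Suc w0 p0
        by (auto simp: mult.left_commute simp flip: ennreal_mult)
    qed simp
  qed
  also have "\<dots> = ennreal (\<Sum>i\<in>I. if sum n I = Suc k then fact k * (n i * p n) else 0)"
    using p0 by (intro sum_ennreal) auto
  also have "(\<Sum>i\<in>I. if sum n I = Suc k then fact k * (n i * p n) else 0)
      = (if sum n I = Suc k then fact k * (real (sum n I) * p n) else 0)"
  proof -
    have "(\<Sum>i\<in>I. fact k * (real (n i) * p n)) = fact k * (real (sum n I) * p n)"
      by (simp add: sum_distrib_left sum_distrib_right)
    then show ?thesis by (simp del: of_nat_sum)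
  qed
  also have "\<dots> = (if sum n I = Suc k then fact (Suc k) * p n else 0)"
    by (auto simp: algebra_simps)
  finally show ?case unfolding p_def w_def .
qed

text \<open>
  Only configurations with exactly \<open>sum n I\<close> points contribute, and \<open>exp (- L)\<close> factors over the cells.
\<close>

lemma measure_poisson_law_cell_event:
  assumes c[measurable]: "c \<in> measurable M (count_space UNIV)" and I: "finite I" "c ` space M \<subseteq> I"
  shows "measure (poisson_law M) (cell_event M c I n) =
    (\<Prod>i\<in>I. measure M (c -` {i} \<inter> space M) ^ n i / fact (n i) * exp (- measure M (c -` {i} \<inter> space M)))"
proof -
  define w where "w i = measure M (c -` {i} \<inter> space M)" for i
  define p where "p = (\<Prod>i\<in>I. w i ^ n i / fact (n i))"
  define L where "L = measure M (space M)"
  have p0: "p \<ge> 0" by (auto simp: p_def w_def intro!: prod_nonneg)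
  have "space M = (\<Union>i\<in>I. c -` {i} \<inter> space M)" using I by auto
  then have "L = measure M (\<Union>i\<in>I. c -` {i} \<inter> space M)" by (simp add: L_def)
  also have "\<dots> = sum w I" unfolding w_def
    using I by (intro finite_measure_finite_Union) (auto simp: disjoint_family_on_def)
  finally have L: "L = sum w I" .
  have "emeasure (poisson_law M) (cell_event M c I n)
      = (\<Sum>k. ennreal (if k = sum n I then exp (- L) * p else 0))"
    using assms by (simp add: emeasure_poisson_law poisson_expectation_def)
      (auto simp: points_integral_cell_event p_def[symmetric] w_def[symmetric] L_def p0
        intro!: suminf_cong simp flip: ennreal_mult)
  also have "\<dots> = ennreal (exp (- L) * p)"
    using sums_single[of "sum n I" "\<lambda>_. exp (- L) * p"] p0
    by (intro suminf_ennreal_eq) auto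
  finally have "measure (poisson_law M) (cell_event M c I n) = exp (- L) * p"
    using p0 by (simp add: measure_def)
  also have "\<dots> = (\<Prod>i\<in>I. w i ^ n i / fact (n i) * exp (- w i))"
    using I by (simp add: p_def L exp_sum prod.distrib[symmetric] sum_negf[symmetric] mult.commute)
  finally show ?thesis by (simp add: w_def)
qed

lemma poisson_law_unique:
  assumes P: "prob_space P" and sets: "sets P = sets (counting_algebra M)"
    and cell: "\<And>c I n. c \<in> measurable M (count_space UNIV) \<Longrightarrow> finite I \<Longrightarrow> c ` space M \<subseteq> I \<Longrightarrow>
      measure P (cell_event M c I n) = (\<Prod>i\<in>I. measure M (c -` {i} \<inter> space M) ^ n i / fact (n i)
         * exp (- measure M (c -` {i} \<inter> space M)))"
  shows "P = poisson_law M"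
proof -
  interpret P: prob_space P by fact
  interpret Q: prob_space "poisson_law M" by (rule prob_space_poisson_law)
  have space: "space P = space (counting_algebra M)" using sets by (rule sets_eq_imp_space_eq)
  have "measure P E = measure (poisson_law M) E" if "E \<in> sets (counting_algebra M)" for E
    using that
  proof (induction rule: counting_algebra_induct)
    case (cell c I n)
    then show ?case by (simp add: assms(3) measure_poisson_law_cell_event)
  next
    case (compl A)
    then show ?case using P.prob_compl[of A] Q.prob_compl[of A] by (simp add: sets space)
  next
    case (union A)
    have "(\<lambda>i. measure P (A i)) sums measure P (\<Union>i. A i)"
      using union by (intro P.finite_measure_UNION) (auto simp: sets)
    moreover have "(\<lambda>i. measure (poisson_law M) (A i)) sums measure (poisson_law M) (\<Union>i. A i)"
      using union by (intro Q.finite_measure_UNION) auto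
    ultimately show ?case using union(3) sums_unique2 by simp blast
  qed simp
  then show ?thesis
    by (intro measure_eqI) (auto simp: sets P.emeasure_eq_measure Q.emeasure_eq_measure)
qed

lemma finite_measure_density_L2:
  assumes l: "l \<in> L2 M"
  shows "finite_measure (density M (\<lambda>x. ennreal (l x)))"
proof
  have [measurable]: "l \<in> borel_measurable M" and int: "integrable M (\<lambda>x. (l x)\<^sup>2)"
    using l by (auto simp: L2_def)
  have "integrable M (\<lambda>x. 1 + (l x)\<^sup>2)" using int by simp
  then have "(\<integral>\<^sup>+x. ennreal (1 + (l x)\<^sup>2) \<partial>M) < \<infinity>"
    by (subst nn_integral_eq_integral) auto
  moreover have "(\<integral>\<^sup>+x. ennreal (l x) \<partial>M) \<le> (\<integral>\<^sup>+x. ennreal (1 + (l x)\<^sup>2) \<partial>M)"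
  proof (intro nn_integral_mono ennreal_leI)
    fix x have "0 \<le> (l x - 1)\<^sup>2" by simp
    then have "2 * l x \<le> 1 + (l x)\<^sup>2" by (simp add: power2_diff)
    with zero_le_power2[of "l x"] show "l x \<le> 1 + (l x)\<^sup>2" by linarith
  qed
  ultimately have "(\<integral>\<^sup>+x. ennreal (l x) \<partial>M) < \<infinity>" by (rule le_less_trans[rotated])
  then show "emeasure (density M (\<lambda>x. ennreal (l x))) (space (density M (\<lambda>x. ennreal (l x)))) \<noteq> \<infinity>"
    by (simp add: emeasure_density cong: nn_integral_cong)
qed

text \<open>
  Each added point costs one application of the Cauchy-Schwarz inequality, hence one factor
  \<open>c \<ge> \<integral>l\<^sup>2\<close>.
\<close>

lemma points_integral_square_le:
  assumes l: "l \<in> L2 M" and c: "(\<integral>\<^sup>+x. (ennreal (l x))\<^sup>2 \<partial>M) \<le> c"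
    and F[measurable]: "F \<in> borel_measurable (counting_algebra M)"
    and m: "m \<in> space (counting_algebra M)"
  shows "(points_integral (density M (\<lambda>x. ennreal (l x))) k F m)\<^sup>2
    \<le> c ^ k * points_integral M k (\<lambda>m. (F m)\<^sup>2) m"
  using m
proof (induction k arbitrary: m)
  case (Suc k)
  let ?\<mu> = "density M (\<lambda>x. ennreal (l x))"
  interpret \<mu>: finite_measure ?\<mu> by (rule finite_measure_density_L2[OF l])
  have [measurable]: "l \<in> borel_measurable M" using l by (auto simp: L2_def)
  have "counting_algebra ?\<mu> = counting_algebra M" by (rule counting_algebra_cong) simp
  then have [measurable]: "points_integral ?\<mu> k F \<in> borel_measurable (counting_algebra M)"
    using \<mu>.measurable_points_integral[of F k] by simp
  note [measurable] = Suc.prems measurable_comp_add_point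
  have "(points_integral ?\<mu> (Suc k) F m)\<^sup>2
      = (\<integral>\<^sup>+x. ennreal (l x) * points_integral ?\<mu> k F (add_point m x) \<partial>M)\<^sup>2"
    by (simp add: \<mu>.points_integral_Suc nn_integral_density del: funpow.simps)
  also have "\<dots> \<le> (\<integral>\<^sup>+x. (ennreal (l x))\<^sup>2 \<partial>M) * (\<integral>\<^sup>+x. (points_integral ?\<mu> k F (add_point m x))\<^sup>2 \<partial>M)"
    by (rule Cauchy_Schwarz_nn_integral) measurable
  also have "\<dots> \<le> c * (\<integral>\<^sup>+x. c ^ k * points_integral M k (\<lambda>m. (F m)\<^sup>2) (add_point m x) \<partial>M)"
    by (intro mult_mono c nn_integral_mono Suc.IH add_point_in_counting_algebra Suc.prems) auto
  also have "\<dots> = c ^ Suc k * points_integral M (Suc k) (\<lambda>m. (F m)\<^sup>2) m"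
    by (simp add: points_integral_Suc nn_integral_cmult mult.assoc del: funpow.simps)
  finally show ?case .
qed simp

text \<open>
  This is a bound on the second moment of the density of the Poisson law with intensity \<open>l\<close> relative to the
  one with intensity \<open>1\<close>, uniform over bounded sets of intensities.
\<close>

lemma poisson_law_square_le:
  assumes l: "l \<in> L2 M" and c: "(\<integral>\<^sup>+x. (ennreal (l x))\<^sup>2 \<partial>M) \<le> ennreal c" and "c > 0"
    and F[measurable]: "F \<in> borel_measurable (counting_algebra M)"
  shows "(\<integral>\<^sup>+m. F m \<partial>poisson_law (density M (\<lambda>x. ennreal (l x))))\<^sup>2
    \<le> ennreal (exp (c + measure M (space M))) * (\<integral>\<^sup>+m. (F m)\<^sup>2 \<partial>poisson_law M)"
proof -
  let ?\<mu> = "density M (\<lambda>x. ennreal (l x))" and ?z = "null_measure M"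
  interpret \<mu>: finite_measure ?\<mu> by (rule finite_measure_density_L2[OF l])
  have alg: "counting_algebra ?\<mu> = counting_algebra M" by (rule counting_algebra_cong) simp
  have z: "null_measure ?\<mu> = ?z" by (rule measure_eqI) auto
  define f g where "f k = points_integral ?\<mu> k F ?z" and "g k = points_integral M k (\<lambda>m. (F m)\<^sup>2) ?z" for k
  have fg: "(f k)\<^sup>2 \<le> ennreal (c ^ k) * g k" for k
    using points_integral_square_le[OF l c F null_measure_in_counting_algebra, of k] \<open>c > 0\<close>
    by (simp add: f_def g_def ennreal_power)
  \<comment> \<open>The factorization \<open>f k / k! = u k \<cdot> v k\<close> makes \<open>\<Sum>(v k)\<^sup>2 = exp c\<close>, and \<open>(u k)\<^sup>2\<close> absorbs the factor \<open>c\<^sup>k\<close> of \<open>fg\<close>.\<close>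
  define u v where "u k = f k * ennreal (1 / sqrt (c ^ k * fact k))"
    and "v k = ennreal (sqrt (c ^ k / fact k))" for k
  have uv: "ennreal (1 / fact k) * f k = u k * v k" for k
  proof -
    have "1 / sqrt (c ^ k * fact k) * sqrt (c ^ k / fact k) = 1 / fact k"
      using \<open>c > 0\<close> by (simp add: real_sqrt_mult real_sqrt_divide field_simps)
    then show ?thesis
      using \<open>c > 0\<close> unfolding u_def v_def by (simp add: mult.commute mult.left_commute flip: ennreal_mult)
  qed
  have u: "(u k)\<^sup>2 \<le> ennreal (1 / fact k) * g k" for k
  proof -
    have "(u k)\<^sup>2 = (f k)\<^sup>2 * ennreal (1 / (c ^ k * fact k))"
      using \<open>c > 0\<close> by (simp add: u_def power_mult_distrib ennreal_power power_divide real_sqrt_pow2)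
    also have "\<dots> \<le> ennreal (c ^ k) * g k * ennreal (1 / (c ^ k * fact k))"
      by (intro mult_right_mono fg) simp
    also have "\<dots> = ennreal (c ^ k) * ennreal (1 / (c ^ k * fact k)) * g k"
      by (simp add: mult_ac)
    also have "ennreal (c ^ k) * ennreal (1 / (c ^ k * fact k)) = ennreal (1 / fact k)"
      using \<open>c > 0\<close> by (simp flip: ennreal_mult)
    finally show ?thesis .
  qed
  have v: "(\<Sum>k. (v k)\<^sup>2) = ennreal (exp c)"
  proof -
    have "(v k)\<^sup>2 = ennreal (c ^ k / fact k)" for k
      using \<open>c > 0\<close> by (simp add: v_def ennreal_power)
    moreover have "(\<lambda>k. c ^ k / fact k) sums exp c"
      using exp_converges[of c] by (simp add: scaleR_conv_of_real divide_inverse mult.commute)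
    ultimately show ?thesis
      using \<open>c > 0\<close> by (simp only:) (intro suminf_ennreal_eq, auto)
  qed
  have le: "(\<integral>\<^sup>+m. F m \<partial>poisson_law ?\<mu>) \<le> (\<Sum>k. ennreal (1 / fact k) * f k)"
    unfolding \<mu>.nn_integral_poisson_law[OF F[folded alg]] poisson_expectation_def f_def z
    by (intro suminf_le mult_right_mono ennreal_leI divide_right_mono) auto
  have "(\<integral>\<^sup>+m. F m \<partial>poisson_law ?\<mu>)\<^sup>2 \<le> (\<Sum>k. u k * v k)\<^sup>2"
    using le unfolding uv by (intro power_mono) auto
  also have "\<dots> \<le> (\<Sum>k. (u k)\<^sup>2) * (\<Sum>k. (v k)\<^sup>2)"
    unfolding nn_integral_count_space_nat[symmetric] by (rule Cauchy_Schwarz_nn_integral) auto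
  also have "\<dots> \<le> (\<Sum>k. ennreal (1 / fact k) * g k) * ennreal (exp c)"
    unfolding v by (intro mult_right_mono suminf_le u) auto
  also have "(\<Sum>k. ennreal (1 / fact k) * g k)
      = ennreal (exp (measure M (space M))) * (\<integral>\<^sup>+m. (F m)\<^sup>2 \<partial>poisson_law M)"
    by (simp add: nn_integral_poisson_law poisson_expectation_def g_def mult.assoc[symmetric]
        flip: ennreal_suminf_cmult ennreal_mult exp_add)
  finally show ?thesis
    by (simp add: exp_add ennreal_mult mult_ac)
qed

end

section \<open>The geometry of \<open>L\<^sub>2\<close>\<close>

lemma l2_inner_commute: "l2_inner M f g = l2_inner M g f"
  by (simp add: l2_inner_def mult.commute)

context
  fixes M :: "'a measure"
begin

lemma L2_measurable: "f \<in> L2 M \<Longrightarrow> f \<in> borel_measurable M"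
  and L2_integrable_square: "f \<in> L2 M \<Longrightarrow> integrable M (\<lambda>x. (f x)\<^sup>2)"
  by (auto simp: L2_def)

lemma L2_mult_integrable:
  assumes "f \<in> L2 M" "g \<in> L2 M" shows "integrable M (\<lambda>x. f x * g x)"
proof (rule Bochner_Integration.integrable_bound)
  show "integrable M (\<lambda>x. (f x)\<^sup>2 + (g x)\<^sup>2)"
    using assms L2_integrable_square by simp
  have "\<bar>f x * g x\<bar> \<le> (f x)\<^sup>2 + (g x)\<^sup>2" for x
  proof -
    have "2 * \<bar>f x * g x\<bar> \<le> (f x)\<^sup>2 + (g x)\<^sup>2"
      using sum_squares_bound[of "\<bar>f x\<bar>" "\<bar>g x\<bar>"] by (simp add: abs_mult)
    then show ?thesis by linarith
  qed
  then show "AE x in M. norm (f x * g x) \<le> norm ((f x)\<^sup>2 + (g x)\<^sup>2)"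
    by simp
qed (use assms L2_measurable in measurable)

lemma L2_add:
  assumes "f \<in> L2 M" "g \<in> L2 M" shows "(\<lambda>x. f x + g x) \<in> L2 M"
proof -
  have "integrable M (\<lambda>x. (f x)\<^sup>2 + (g x)\<^sup>2 + 2 * (f x * g x))"
    using assms L2_mult_integrable L2_integrable_square by simp
  then show ?thesis
    using assms by (auto simp: L2_def power2_sum mult.assoc)
qed

lemma L2_cmult: "f \<in> L2 M \<Longrightarrow> (\<lambda>x. c * f x) \<in> L2 M"
  by (auto simp: L2_def power_mult_distrib)

lemma L2_diff: "f \<in> L2 M \<Longrightarrow> g \<in> L2 M \<Longrightarrow> (\<lambda>x. f x - g x) \<in> L2 M"
  using L2_add[of f "\<lambda>x. -1 * g x"] L2_cmult[of g "-1"] by simp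

lemma L2_zero: "(\<lambda>_. 0) \<in> L2 M" by (simp add: L2_def)

lemma L2_sum: "(\<And>i. i \<in> I \<Longrightarrow> f i \<in> L2 M) \<Longrightarrow> (\<lambda>x. \<Sum>i\<in>I. f i x) \<in> L2 M"
  by (induction I rule: infinite_finite_induct) (auto intro: L2_zero L2_add)

lemma l2_inner_add_left: "f \<in> L2 M \<Longrightarrow> g \<in> L2 M \<Longrightarrow> h \<in> L2 M \<Longrightarrow>
    l2_inner M (\<lambda>x. f x + g x) h = l2_inner M f h + l2_inner M g h"
  using L2_mult_integrable by (simp add: l2_inner_def distrib_right)

lemma l2_inner_diff_left: "f \<in> L2 M \<Longrightarrow> g \<in> L2 M \<Longrightarrow> h \<in> L2 M \<Longrightarrow>
    l2_inner M (\<lambda>x. f x - g x) h = l2_inner M f h - l2_inner M g h"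
  using L2_mult_integrable by (simp add: l2_inner_def left_diff_distrib)

lemma l2_inner_cmult_left: "l2_inner M (\<lambda>x. c * f x) h = c * l2_inner M f h"
  by (simp add: l2_inner_def mult.assoc)

lemma l2_inner_sum_left: "(\<And>i. i \<in> I \<Longrightarrow> f i \<in> L2 M) \<Longrightarrow> h \<in> L2 M \<Longrightarrow>
    l2_inner M (\<lambda>x. \<Sum>i\<in>I. f i x) h = (\<Sum>i\<in>I. l2_inner M (f i) h)"
  using L2_mult_integrable by (simp add: l2_inner_def sum_distrib_right)

lemma l2_inner_diff_right: "f \<in> L2 M \<Longrightarrow> g \<in> L2 M \<Longrightarrow> h \<in> L2 M \<Longrightarrow>
    l2_inner M h (\<lambda>x. f x - g x) = l2_inner M h f - l2_inner M h g"
  using l2_inner_diff_left by (simp add: l2_inner_commute[of M h])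

lemma l2_inner_cmult_right: "l2_inner M h (\<lambda>x. c * f x) = c * l2_inner M h f"
  using l2_inner_cmult_left by (simp add: l2_inner_commute[of M h])

lemma l2_inner_sum_right: "(\<And>i. i \<in> I \<Longrightarrow> f i \<in> L2 M) \<Longrightarrow> h \<in> L2 M \<Longrightarrow>
    l2_inner M h (\<lambda>x. \<Sum>i\<in>I. f i x) = (\<Sum>i\<in>I. l2_inner M h (f i))"
  by (simp add: l2_inner_commute[of M h] l2_inner_sum_left)

lemma l2_inner_self_nonneg: "0 \<le> l2_inner M f f"
  by (simp add: l2_inner_def)

lemma l2_inner_self_diff_cmult:
  assumes "f \<in> L2 M" "g \<in> L2 M"
  shows "l2_inner M (\<lambda>x. f x - t * g x) (\<lambda>x. f x - t * g x)
    = l2_inner M f f - 2 * t * l2_inner M f g + t\<^sup>2 * l2_inner M g g"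
  using assms
  by (simp add: l2_inner_diff_left l2_inner_diff_right l2_inner_cmult_left l2_inner_cmult_right
      L2_cmult L2_diff l2_inner_commute[of M g f] power2_eq_square algebra_simps)

text \<open>
  If \<open>f\<close> is up to \<open>\<delta>\<close> the shortest vector on the line \<open>f - t g\<close>, then it is nearly orthogonal to
  \<open>g\<close>. With \<open>\<delta> = l2_inner M f f\<close> this is the Cauchy-Schwarz inequality; a small \<open>\<delta>\<close> gives approximate
  projections.
\<close>

lemma l2_inner_square_le_gap:
  assumes f: "f \<in> L2 M" and g: "g \<in> L2 M"
    and gap: "\<And>t. l2_inner M f f - \<delta> \<le> l2_inner M (\<lambda>x. f x - t * g x) (\<lambda>x. f x - t * g x)"
  shows "(l2_inner M f g)\<^sup>2 \<le> \<delta> * l2_inner M g g"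
proof -
  define b c where "b = l2_inner M f g" and "c = l2_inner M g g"
  have quad: "2 * t * b \<le> \<delta> + t\<^sup>2 * c" for t
    using gap[of t] unfolding l2_inner_self_diff_cmult[OF f g] b_def c_def by simp
  have c: "c \<ge> 0" by (simp add: c_def l2_inner_self_nonneg)
  have "b\<^sup>2 \<le> \<delta> * c"
  proof (cases "c = 0")
    case True
    have "b = 0"
    proof (rule ccontr)
      assume "b \<noteq> 0"
      then show False using quad[of "(\<delta> + 1) / (2 * b)"] True by simp
    qed
    then show ?thesis using True by simp
  next
    case False
    with c have "c > 0" by simp
    then show ?thesis using quad[of "b / c"] by (simp add: field_simps power2_eq_square)
  qed
  then show ?thesis by (simp add: b_def c_def)
qed

lemma l2_Cauchy_Schwarz:
  assumes "f \<in> L2 M" "g \<in> L2 M"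
  shows "(l2_inner M f g)\<^sup>2 \<le> l2_inner M f f * l2_inner M g g"
  by (rule l2_inner_square_le_gap[OF assms]) (simp add: l2_inner_self_nonneg)

lemma l2_Cauchy_Schwarz_bounded:
  assumes "f \<in> L2 M" "g \<in> L2 M" "l2_inner M f f \<le> C\<^sup>2" "0 \<le> C"
  shows "\<bar>l2_inner M f g\<bar> \<le> C * sqrt (l2_inner M g g)"
proof -
  have "(l2_inner M f g)\<^sup>2 \<le> C\<^sup>2 * l2_inner M g g"
    using l2_Cauchy_Schwarz[OF assms(1,2)] mult_right_mono[OF assms(3) l2_inner_self_nonneg]
    by (rule order_trans)
  also have "\<dots> = (C * sqrt (l2_inner M g g))\<^sup>2"
    by (simp add: power_mult_distrib l2_inner_self_nonneg)
  finally have "\<bar>l2_inner M f g\<bar> \<le> \<bar>C * sqrt (l2_inner M g g)\<bar>"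
    by (simp only: abs_le_square_iff)
  then show ?thesis
    using assms(4) l2_inner_self_nonneg[of g] by simp
qed

end

lemma l2_bounded_insert: "l2_bounded M S \<Longrightarrow> l2_bounded M (insert f S)"
proof -
  assume "l2_bounded M S"
  then obtain C where "\<And>g. g \<in> S \<Longrightarrow> l2_norm M g \<le> C" by (auto simp: l2_bounded_def)
  then show ?thesis
    unfolding l2_bounded_def by (intro exI[of _ "max C (l2_norm M f)"]) (auto simp: le_max_iff_disj)
qed

lemma l2_boundedE:
  assumes "l2_bounded M S" "l2_bounded M T"
  obtains C where "C > 0" "\<forall>f\<in>S \<union> T. l2_inner M f f \<le> C\<^sup>2"
proof -
  obtain C0 C1 where C01: "\<And>f. f \<in> S \<Longrightarrow> l2_norm M f \<le> C0" "\<And>f. f \<in> T \<Longrightarrow> l2_norm M f \<le> C1"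
    using assms by (auto simp: l2_bounded_def)
  define C where "C = max 1 (max C0 C1)"
  have "l2_inner M f f \<le> C\<^sup>2" if "f \<in> S \<union> T" for f
  proof (rule sqrt_le_D)
    show "sqrt (l2_inner M f f) \<le> C" using C01[of f] that by (auto simp: C_def l2_norm_def)
  qed
  then show ?thesis by (intro that[of C]) (auto simp: C_def)
qed

context finite_measure
begin

lemma L2_bounded_function:
  assumes "f \<in> borel_measurable M" "\<And>x. x \<in> space M \<Longrightarrow> \<bar>f x\<bar> \<le> B"
  shows "f \<in> L2 M"
proof -
  have "(f x)\<^sup>2 \<le> B\<^sup>2" if "x \<in> space M" for x
    using assms(2)[OF that] by (metis abs_ge_zero power2_abs power_mono)
  then have "integrable M (\<lambda>x. (f x)\<^sup>2)"
    using assms(1) by (intro integrable_const_bound[of _ "B\<^sup>2"]) auto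
  with assms(1) show ?thesis by (simp add: L2_def)
qed

lemma L2_indicator: "A \<in> sets M \<Longrightarrow> indicator A \<in> L2 M"
  by (rule L2_bounded_function[of _ 1]) (auto simp: indicator_def)

lemma L2_simple_function: "simple_function M s \<Longrightarrow> (s :: 'a \<Rightarrow> real) \<in> L2 M"
proof (rule L2_bounded_function[of _ "Max ((\<lambda>x. \<bar>s x\<bar>) ` space M)"])
  assume s: "simple_function M s"
  then show "s \<in> borel_measurable M" by (rule borel_measurable_simple_function)
  have "finite ((\<lambda>x. \<bar>s x\<bar>) ` space M)"
    using simple_functionD(1)[OF s] by (simp flip: image_image)
  then show "\<bar>s x\<bar> \<le> Max ((\<lambda>x. \<bar>s x\<bar>) ` space M)" if "x \<in> space M" for x
    using that by auto
qed

lemma l2_inner_simple_function: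
  assumes s: "simple_function M s" and f: "f \<in> L2 M"
  shows "l2_inner M f s = (\<Sum>y\<in>s ` space M. y * l2_inner M f (indicator (s -` {y} \<inter> space M)))"
proof -
  have fin: "finite (s ` space M)" using s by (rule simple_functionD(1))
  have meas: "s -` {y} \<inter> space M \<in> sets M" for y using s by (rule simple_functionD(2))
  have rep: "s x = (\<Sum>y\<in>s ` space M. y * indicator (s -` {y} \<inter> space M) x)" if "x \<in> space M" for x
    using fin that by (subst sum.remove[of _ "s x"]) (auto intro!: sum.neutral)
  have "l2_inner M f s = l2_inner M f (\<lambda>x. \<Sum>y\<in>s ` space M. y * indicator (s -` {y} \<inter> space M) x)"
    unfolding l2_inner_def by (intro Bochner_Integration.integral_cong refl arg_cong2[where f = "(*)"] rep)
  also have "\<dots> = (\<Sum>y\<in>s ` space M. y * l2_inner M f (indicator (s -` {y} \<inter> space M)))"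
    using f meas by (subst l2_inner_sum_right) (auto intro!: L2_cmult L2_indicator simp: l2_inner_cmult_right)
  finally show ?thesis .
qed

lemma L2_simple_function_dense:
  assumes h: "h \<in> L2 M" and "e > 0"
  obtains s where "simple_function M s" "l2_inner M (\<lambda>x. h x - s x) (\<lambda>x. h x - s x) < e"
proof -
  have [measurable]: "h \<in> borel_measurable M" using h by (rule L2_measurable)
  from borel_measurable_implies_sequence_metric[of h M 0]
  obtain s where s': "\<forall>i. simple_function M (s i)" "\<forall>x\<in>space M. (\<lambda>i. s i x) \<longlonglongrightarrow> h x"
    "\<forall>i. \<forall>x\<in>space M. dist (s i x) 0 \<le> 2 * dist (h x) 0" by auto
  then have s: "\<And>i. simple_function M (s i)" "\<And>x. x \<in> space M \<Longrightarrow> (\<lambda>i. s i x) \<longlonglongrightarrow> h x"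
    "\<And>i x. x \<in> space M \<Longrightarrow> \<bar>s i x\<bar> \<le> 2 * \<bar>h x\<bar>" by simp_all
  have [measurable]: "s i \<in> borel_measurable M" for i
    using s(1) by (rule borel_measurable_simple_function)
  have "(\<lambda>i. \<integral>x. (h x - s i x)\<^sup>2 \<partial>M) \<longlonglongrightarrow> (\<integral>x. 0 \<partial>M)"
  proof (rule integral_dominated_convergence)
    show "integrable M (\<lambda>x. 9 * (h x)\<^sup>2)" using L2_integrable_square[OF h] by simp
    show "AE x in M. (\<lambda>i. (h x - s i x)\<^sup>2) \<longlonglongrightarrow> 0"
      using s(2) by (intro AE_I2) (auto intro!: tendsto_eq_intros)
    show "AE x in M. norm ((h x - s i x)\<^sup>2) \<le> 9 * (h x)\<^sup>2" for i
    proof (intro AE_I2)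
      fix x assume "x \<in> space M"
      then have "\<bar>h x - s i x\<bar> \<le> 3 * \<bar>h x\<bar>" using s(3)[of x i] by linarith
      then have "\<bar>h x - s i x\<bar>\<^sup>2 \<le> (3 * \<bar>h x\<bar>)\<^sup>2" by (intro power_mono) auto
      then show "norm ((h x - s i x)\<^sup>2) \<le> 9 * (h x)\<^sup>2" by (simp add: power_mult_distrib)
    qed
  qed auto
  then have "\<forall>\<^sub>F i in sequentially. (\<integral>x. (h x - s i x)\<^sup>2 \<partial>M) < e"
    using \<open>e > 0\<close> by (intro order_tendstoD(2)) auto
  then obtain i where "(\<integral>x. (h x - s i x)\<^sup>2 \<partial>M) < e"
    by (auto simp: eventually_sequentially)
  with s(1) show ?thesis by (intro that[of "s i"]) (simp_all add: l2_inner_def power2_eq_square)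
qed

end

section \<open>Weak compactness of bounded sets of intensities\<close>

text \<open>
  Without a cluster point, the open sets that \<open>F\<close> eventually avoids would cover \<open>K\<close>.
\<close>

lemma compact_imp_cluster_point:
  assumes K: "compact K" and F: "F \<noteq> bot" "eventually (\<lambda>x. x \<in> K) F"
  obtains x where "x \<in> K" "inf (nhds x) F \<noteq> bot"
proof (rule ccontr)
  assume *: "\<not> thesis"
  define \<T> where "\<T> = {U. open U \<and> eventually (\<lambda>x. x \<notin> U) F}"
  have cover: "K \<subseteq> \<Union>\<T>"
  proof
    fix x assume "x \<in> K"
    with * that have "inf (nhds x) F = bot" by blast
    then have "eventually (\<lambda>_. False) (inf (nhds x) F)" by simp
    then obtain P Q where PQ: "eventually P (nhds x)" "eventually Q F" "\<And>y. P y \<Longrightarrow> Q y \<Longrightarrow> False"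
      unfolding eventually_inf by auto
    from PQ(1) obtain U where "open U" "x \<in> U" "\<And>y. y \<in> U \<Longrightarrow> P y"
      by (auto simp: eventually_nhds)
    with PQ have "U \<in> \<T>" by (auto simp: \<T>_def elim!: eventually_mono)
    with \<open>x \<in> U\<close> show "x \<in> \<Union>\<T>" by blast
  qed
  have "open U" if "U \<in> \<T>" for U using that by (simp add: \<T>_def)
  with K cover obtain \<D> where \<D>: "\<D> \<subseteq> \<T>" "finite \<D>" "K \<subseteq> \<Union>\<D>"
    by (rule compactE)
  have "eventually (\<lambda>x. x \<notin> U) F" if "U \<in> \<D>" for U
    using that \<D>(1) unfolding \<T>_def by blast
  with \<D>(2) have "eventually (\<lambda>x. \<forall>U\<in>\<D>. x \<notin> U) F"
    by (intro eventually_ball_finite) blast+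
  with F(2) have "eventually (\<lambda>_. False) F"
    by eventually_elim (use \<D>(3) in blast)
  with F(1) show False by simp
qed

text \<open>
  Tychonoff's theorem: a cluster point of the family in the product of the intervals
  \<open>[- B c, B c]\<close> becomes a limit along a finer filter.
\<close>

lemma bounded_net_cluster:
  fixes I :: "'b \<Rightarrow> 'c \<Rightarrow> real"
  assumes F: "F \<noteq> bot" and bound: "\<And>p c. \<bar>I p c\<bar> \<le> B c"
  obtains F' \<phi> where "F' \<le> F" "F' \<noteq> bot" "\<And>c. ((\<lambda>p. I p c) \<longlongrightarrow> \<phi> c) F'"
proof -
  define K where "K = PiE UNIV (\<lambda>c. {- B c..B c})"
  have "compact K"
    unfolding K_def compactin_euclidean_iff[symmetric] euclidean_product_topology[symmetric] compactin_PiE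
    by simp
  moreover have "filtermap I F \<noteq> bot" using F by (simp add: filtermap_bot_iff)
  moreover have "eventually (\<lambda>x. x \<in> K) (filtermap I F)"
    using bound by (auto simp: K_def eventually_filtermap abs_le_iff minus_le_iff intro!: always_eventually)
  ultimately obtain \<phi> where \<phi>: "inf (nhds \<phi>) (filtermap I F) \<noteq> bot"
    by (rule compact_imp_cluster_point)
  define F' where "F' = inf (filtercomap I (nhds \<phi>)) F"
  have "F' \<noteq> bot"
  proof
    assume "F' = bot"
    then have "eventually (\<lambda>_. False) F'" by simp
    then obtain P Q where "eventually P (nhds \<phi>)" "eventually Q F" "\<And>p. P (I p) \<Longrightarrow> Q p \<Longrightarrow> False"
      unfolding F'_def eventually_inf eventually_filtercomap by blast
    then have "eventually (\<lambda>_. False) (inf (nhds \<phi>) (filtermap I F))"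
      unfolding eventually_inf eventually_filtermap
      by (intro exI[of _ P] exI[of _ "\<lambda>x. \<exists>p. x = I p \<and> Q p"]) (auto elim: eventually_mono)
    with \<phi> show False by simp
  qed
  have "filterlim I (nhds \<phi>) F'"
    unfolding F'_def by (rule filterlim_mono[OF filterlim_filtercomap order_refl inf_le1])
  then have "((\<lambda>p. I p c) \<longlongrightarrow> \<phi> c) F'" for c
  proof -
    have "continuous_on UNIV (\<lambda>x :: 'c \<Rightarrow> real. x c)" by (rule continuous_on_product_coordinates)
    from continuous_on_tendsto_compose[OF this \<open>filterlim I (nhds \<phi>) F'\<close>] show ?thesis by simp
  qed
  with \<open>F' \<noteq> bot\<close> show ?thesis by (intro that[of F' \<phi>]) (auto simp: F'_def)
qed

text \<open>
  Convergence on indicators extends to simple functions by linearity and to \<open>L\<^sub>2\<close> by density, since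
  the net is bounded.
\<close>

lemma (in finite_measure) setwise_imp_weak_convergence:
  assumes u: "\<And>p. u p \<in> L2 M" and f: "f \<in> L2 M"
    and C: "\<And>p. l2_inner M (u p) (u p) \<le> C\<^sup>2" "0 \<le> C"
    and lim: "\<And>A. A \<in> sets M \<Longrightarrow> ((\<lambda>p. l2_inner M (u p) (indicator A)) \<longlongrightarrow> l2_inner M f (indicator A)) F"
    and h: "h \<in> L2 M"
  shows "((\<lambda>p. l2_inner M (u p) h) \<longlongrightarrow> l2_inner M f h) F"
proof (rule tendstoI)
  fix e :: real assume "e > 0"
  \<comment> \<open>A common bound for the norms of the net and of its limit.\<close>
  define D where "D = C + sqrt (l2_inner M f f)"
  have D: "D \<ge> 0" "C \<le> D" "sqrt (l2_inner M f f) \<le> D"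
    using C(2) l2_inner_self_nonneg[of M f] by (auto simp: D_def)
  define \<delta> where "\<delta> = e / 3 / (D + 1)"
  have "\<delta> > 0" using \<open>e > 0\<close> D by (simp add: \<delta>_def)
  obtain t where t: "simple_function M t" "l2_inner M (\<lambda>x. h x - t x) (\<lambda>x. h x - t x) < \<delta>\<^sup>2"
    using L2_simple_function_dense[OF h, of "\<delta>\<^sup>2"] \<open>\<delta> > 0\<close> by auto
  note tL2 = L2_simple_function[OF t(1)]
  have close: "\<bar>l2_inner M g h - l2_inner M g t\<bar> < e / 3"
    if g: "g \<in> L2 M" "l2_inner M g g \<le> D\<^sup>2" for g
  proof -
    have "\<bar>l2_inner M g h - l2_inner M g t\<bar> = \<bar>l2_inner M g (\<lambda>x. h x - t x)\<bar>"
      using g h tL2 by (simp add: l2_inner_diff_right)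
    also have "\<dots> \<le> D * sqrt (l2_inner M (\<lambda>x. h x - t x) (\<lambda>x. h x - t x))"
      using g h tL2 D by (intro l2_Cauchy_Schwarz_bounded L2_diff)
    also have "\<dots> \<le> D * \<delta>"
      using t(2) \<open>\<delta> > 0\<close> D by (intro mult_left_mono real_le_lsqrt) auto
    also have "\<dots> < (D + 1) * \<delta>" using \<open>\<delta> > 0\<close> by simp
    also have "\<dots> = e / 3"
    proof -
      have "D + 1 \<noteq> 0" using D by simp
      from nonzero_eq_divide_eq[OF this, THEN iffD1, OF \<delta>_def] show ?thesis
        by (simp only: mult.commute)
    qed
    finally show ?thesis .
  qed
  have "((\<lambda>p. l2_inner M (u p) t) \<longlongrightarrow> l2_inner M f t) F"
    unfolding l2_inner_simple_function[OF t(1) u(1)] l2_inner_simple_function[OF t(1) f]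
    by (intro tendsto_sum tendsto_mult tendsto_const lim simple_functionD(2)[OF t(1)])
  then have "\<forall>\<^sub>F p in F. \<bar>l2_inner M (u p) t - l2_inner M f t\<bar> < e / 3"
    using \<open>e > 0\<close> by (auto dest: tendstoD[of _ _ _ "e / 3"] simp: dist_real_def)
  then show "\<forall>\<^sub>F p in F. dist (l2_inner M (u p) h) (l2_inner M f h) < e"
  proof eventually_elim
    fix p assume 1: "\<bar>l2_inner M (u p) t - l2_inner M f t\<bar> < e / 3"
    have "l2_inner M (u p) (u p) \<le> D\<^sup>2"
      using C(1)[of p] power_mono[OF D(2) C(2), of 2] by simp
    from close[OF u(1) this] have 2: "\<bar>l2_inner M (u p) h - l2_inner M (u p) t\<bar> < e / 3" .
    have "l2_inner M f f \<le> D\<^sup>2"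
      using D(3) by (simp add: sqrt_le_D)
    from close[OF f this] have 3: "\<bar>l2_inner M f h - l2_inner M f t\<bar> < e / 3" .
    from 1 2 3 show "dist (l2_inner M (u p) h) (l2_inner M f h) < e"
      unfolding dist_real_def by linarith
  qed
qed

text \<open>
  The set function \<open>\<phi>\<close> is finitely additive, and \<open>\<phi> A \<le> C sqrt (M A)\<close> by the Cauchy-Schwarz
  inequality. Hence it is a measure, absolutely continuous with respect to \<open>M\<close>, and has a density
  \<open>f\<close>. For a simple function \<open>0 \<le> s \<le> f\<close> the inequalities
  \<open>\<parallel>s\<parallel>\<^sup>2 \<le> \<langle>f, s\<rangle> = lim \<langle>u p, s\<rangle> \<le> C \<parallel>s\<parallel>\<close> give \<open>\<parallel>s\<parallel> \<le> C\<close>, and \<open>f \<in> L\<^sub>2\<close> follows by Fatou's lemma.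
\<close>

lemma (in finite_measure) weak_limit_exists:
  assumes F: "F \<noteq> bot"
    and u: "\<And>p. u p \<in> L2 M" "\<And>p. AE x in M. 0 \<le> u p x"
    and C: "\<And>p. l2_inner M (u p) (u p) \<le> C\<^sup>2" "0 \<le> C"
    and \<phi>: "\<And>A. A \<in> sets M \<Longrightarrow> ((\<lambda>p. l2_inner M (u p) (indicator A)) \<longlongrightarrow> \<phi> A) F"
  obtains f where "f \<in> L2 M" "\<forall>x. 0 \<le> f x" "\<forall>A\<in>sets M. l2_inner M f (indicator A) = \<phi> A"
proof -
  have indicator_norm: "l2_inner M (indicator A) (indicator A) = measure M A" if "A \<in> sets M" for A
    using that by (simp add: l2_inner_def flip: indicator_inter_arith)
  have pos: "0 \<le> \<phi> A" if A: "A \<in> sets M" for A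
  proof (rule tendsto_lowerbound[OF \<phi>[OF A] _ F])
    have "0 \<le> l2_inner M (u p) (indicator A)" for p
      unfolding l2_inner_def using u(2)[of p] by (intro integral_nonneg_AE) auto
    then show "\<forall>\<^sub>F p in F. 0 \<le> l2_inner M (u p) (indicator A)" by simp
  qed
  have le: "\<phi> A \<le> C * sqrt (measure M A)" if A: "A \<in> sets M" for A
  proof (rule tendsto_upperbound[OF \<phi>[OF A] _ F])
    have "l2_inner M (u p) (indicator A) \<le> C * sqrt (measure M A)" for p
      using l2_Cauchy_Schwarz_bounded[OF u(1) L2_indicator[OF A] C, of p] indicator_norm[OF A] by simp
    then show "\<forall>\<^sub>F p in F. l2_inner M (u p) (indicator A) \<le> C * sqrt (measure M A)" by simp
  qed
  have add: "\<phi> (A \<union> B) = \<phi> A + \<phi> B" if AB: "A \<in> sets M" "B \<in> sets M" "A \<inter> B = {}" for A B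
  proof (rule tendsto_unique[OF F \<phi>[OF sets.Un[OF AB(1,2)]]])
    have "l2_inner M (u p) (indicator (A \<union> B)) = l2_inner M (u p) (indicator A) + l2_inner M (u p) (indicator B)" for p
    proof -
      have "indicator (A \<union> B) = (\<lambda>x. indicator A x + indicator B x :: real)"
        using AB(3) by (auto simp: indicator_def fun_eq_iff)
      then show ?thesis
        using u(1)[of p] AB by (simp add: l2_inner_commute[of M "u p"] l2_inner_add_left L2_indicator)
    qed
    then show "((\<lambda>p. l2_inner M (u p) (indicator (A \<union> B))) \<longlongrightarrow> \<phi> A + \<phi> B) F"
      by (simp only:) (intro tendsto_add \<phi> AB)
  qed
  have \<phi>0: "\<phi> {} = 0" using le[of "{}"] pos[of "{}"] by simp
  define N where "N = measure_of (space M) (sets M) (\<lambda>A. ennreal (\<phi> A))"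
  have "countably_additive (sets M) (\<lambda>A. ennreal (\<phi> A))"
  proof (rule sets.empty_continuous_imp_countably_additive)
    show "positive (sets M) (\<lambda>A. ennreal (\<phi> A))" by (simp add: positive_def \<phi>0)
    show "additive (sets M) (\<lambda>A. ennreal (\<phi> A))"
      by (auto simp: additive_def add pos)
    fix A :: "nat \<Rightarrow> 'a set" assume A: "range A \<subseteq> sets M" "decseq A" "(\<Inter>i. A i) = {}"
    have "(\<lambda>i. measure M (A i)) \<longlonglongrightarrow> 0"
      using finite_Lim_measure_decseq[OF A(1,2)] A(3) by simp
    then have "(\<lambda>i. C * sqrt (measure M (A i))) \<longlonglongrightarrow> C * sqrt 0"
      by (intro tendsto_intros)
    then have "(\<lambda>i. \<phi> (A i)) \<longlonglongrightarrow> 0"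
      using A(1) le pos by (intro tendsto_sandwich[of "\<lambda>_. 0" "\<lambda>i. \<phi> (A i)"]) (auto intro!: always_eventually)
    from tendsto_ennrealI[OF this] show "(\<lambda>i. ennreal (\<phi> (A i))) \<longlonglongrightarrow> 0" by simp
  qed auto
  then have N: "emeasure N A = ennreal (\<phi> A)" if "A \<in> sets M" for A
    unfolding N_def using that \<phi>0
    by (intro emeasure_measure_of_sigma[OF sets.sigma_algebra_axioms]) (auto simp: positive_def)
  have sets_N: "sets N = sets M" by (simp add: N_def)
  have space_N: "space N = space M" by (simp add: N_def)
  have "finite_measure N" by standard (simp add: N space_N)
  moreover have "absolutely_continuous M N"
    unfolding absolutely_continuous_def
  proof
    fix A assume "A \<in> null_sets M"
    then have "A \<in> sets M" "measure M A = 0" by (auto simp: measure_def)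
    then show "A \<in> null_sets N" using le[of A] pos[of A] by (auto simp: null_sets_def sets_N N)
  qed
  ultimately obtain f where f[measurable]: "f \<in> borel_measurable M"
    and fN: "AE x in M. RN_deriv M N x = ennreal (f x)" and f0: "\<And>x. 0 \<le> f x"
    using real_RN_deriv[of N] sets_N by metis
  have "density M (RN_deriv M N) = N"
    using \<open>absolutely_continuous M N\<close> sets_N by (rule density_RN_deriv)
  moreover have "density M (RN_deriv M N) = density M (\<lambda>x. ennreal (f x))"
    using fN by (intro density_cong) auto
  ultimately have dens: "density M (\<lambda>x. ennreal (f x)) = N" by simp
  have f_nn: "(\<integral>\<^sup>+x. ennreal (f x * indicator A x) \<partial>M) = ennreal (\<phi> A)" if A: "A \<in> sets M" for A
    using N[OF A] A unfolding dens[symmetric]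
    by (subst (asm) emeasure_density) (auto simp: ennreal_mult' f0 ennreal_indicator)
  have f_int: "integrable M (\<lambda>x. f x * indicator A x)" "l2_inner M f (indicator A) = \<phi> A" if A: "A \<in> sets M" for A
  proof -
    show "integrable M (\<lambda>x. f x * indicator A x)"
      using f_nn[OF A] A by (intro integrableI_nonneg) (auto simp: f0)
    show "l2_inner M f (indicator A) = \<phi> A"
      unfolding l2_inner_def using A f_nn[OF A] pos[OF A] by (subst integral_eq_nn_integral) (auto simp: f0)
  qed
  have simple_bound: "l2_inner M s s \<le> C\<^sup>2" if s: "simple_function M s" "\<And>x. 0 \<le> s x" "\<And>x. s x \<le> f x" for s
  proof -
    note sL2 = L2_simple_function[OF s(1)]
    have [measurable]: "s -` {y} \<inter> space M \<in> sets M" for y using s(1) by (rule simple_functionD(2))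
    have fin: "finite (s ` space M)" using s(1) by (rule simple_functionD(1))
    have rep: "s x = (\<Sum>y\<in>s ` space M. y * indicator (s -` {y} \<inter> space M) x)" if "x \<in> space M" for x
      using fin that by (subst sum.remove[of _ "s x"]) (auto intro!: sum.neutral)
    have int: "integrable M (\<lambda>x. \<Sum>y\<in>s ` space M. y * (f x * indicator (s -` {y} \<inter> space M) x))"
      using f_int(1) by (intro Bochner_Integration.integrable_sum integrable_mult_right) auto
    have rep': "f x * s x = (\<Sum>y\<in>s ` space M. y * (f x * indicator (s -` {y} \<inter> space M) x))"
      if "x \<in> space M" for x
      by (subst rep[OF that]) (simp add: sum_distrib_left mult.left_commute)
    have "integrable M (\<lambda>x. f x * s x) \<longleftrightarrow>
        integrable M (\<lambda>x. \<Sum>y\<in>s ` space M. y * (f x * indicator (s -` {y} \<inter> space M) x))"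
      by (rule Bochner_Integration.integrable_cong[OF refl rep'])
    with int have "integrable M (\<lambda>x. f x * s x)" by blast
    then have "l2_inner M s s \<le> l2_inner M f s"
      unfolding l2_inner_def using s sL2 L2_mult_integrable[OF sL2 sL2]
      by (intro integral_mono mult_right_mono) auto
    also have "l2_inner M f s
        = (\<integral>x. (\<Sum>y\<in>s ` space M. y * (f x * indicator (s -` {y} \<inter> space M) x)) \<partial>M)"
      unfolding l2_inner_def by (rule Bochner_Integration.integral_cong[OF refl rep'])
    also have "\<dots> = (\<Sum>y\<in>s ` space M. y * l2_inner M f (indicator (s -` {y} \<inter> space M)))"
      unfolding l2_inner_def
      by (subst Bochner_Integration.integral_sum) (simp_all add: f_int(1) integrable_mult_right)
    also have "\<dots> = (\<Sum>y\<in>s ` space M. y * \<phi> (s -` {y} \<inter> space M))"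
      by (simp add: f_int(2))
    also have "\<dots> \<le> C * sqrt (l2_inner M s s)"
    proof (rule tendsto_upperbound[OF _ _ F])
      show "((\<lambda>p. l2_inner M (u p) s) \<longlongrightarrow> (\<Sum>y\<in>s ` space M. y * \<phi> (s -` {y} \<inter> space M))) F"
        unfolding l2_inner_simple_function[OF s(1) u(1)]
        by (intro tendsto_sum tendsto_mult tendsto_const \<phi>) simp
      have "l2_inner M (u p) s \<le> C * sqrt (l2_inner M s s)" for p
        using l2_Cauchy_Schwarz_bounded[OF u(1) sL2 C, of p] by simp
      then show "\<forall>\<^sub>F p in F. l2_inner M (u p) s \<le> C * sqrt (l2_inner M s s)" by simp
    qed
    finally have *: "l2_inner M s s \<le> C * sqrt (l2_inner M s s)" .
    define r where "r = sqrt (l2_inner M s s)"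
    have r: "r\<^sup>2 = l2_inner M s s" "r \<ge> 0" by (simp_all add: r_def l2_inner_self_nonneg)
    with * have "r * r \<le> C * r" by (simp add: power2_eq_square flip: r_def)
    with r(2) C(2) have "r \<le> C" by (cases "r = 0") auto
    from power_mono[OF this r(2), of 2] show ?thesis by (simp add: r(1))
  qed
  obtain s where s: "\<And>i. simple_function M (s i)" "incseq s" "\<And>i x. 0 \<le> s i x"
    and s_bdd: "\<And>x. bdd_above (range (\<lambda>i. s i x))" and f_SUP: "f = (\<Squnion>i. s i)"
    using borel_measurable_implies_simple_function_sequence_real[OF f f0] by auto
  have s_lim: "(\<lambda>i. s i x) \<longlonglongrightarrow> f x" for x
  proof -
    have "incseq (\<lambda>i. s i x)" using s(2) by (simp add: incseq_def le_fun_def)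
    from LIMSEQ_incseq_SUP[OF s_bdd this] show ?thesis unfolding f_SUP by (simp add: image_image)
  qed
  have s_le: "s i x \<le> f x" for i x
    using s(2) s_lim by (intro incseq_le) (auto simp: incseq_def le_fun_def)
  have [measurable]: "s i \<in> borel_measurable M" for i
    using s(1) by (rule borel_measurable_simple_function)
  have "(\<integral>\<^sup>+x. ennreal ((f x)\<^sup>2) \<partial>M) \<le> liminf (\<lambda>i. \<integral>\<^sup>+x. ennreal ((s i x)\<^sup>2) \<partial>M)"
  proof -
    have "ennreal ((f x)\<^sup>2) = liminf (\<lambda>i. ennreal ((s i x)\<^sup>2))" for x
      using s_lim[of x] by (intro lim_imp_Liminf[symmetric] tendsto_ennrealI tendsto_intros) auto
    then show ?thesis by (simp add: nn_integral_liminf)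
  qed
  also have "\<dots> \<le> ennreal (C\<^sup>2)"
  proof (rule Liminf_le)
    have "(\<integral>\<^sup>+x. ennreal ((s i x)\<^sup>2) \<partial>M) \<le> ennreal (C\<^sup>2)" for i
    proof -
      have "(\<integral>\<^sup>+x. ennreal ((s i x)\<^sup>2) \<partial>M) = ennreal (l2_inner M (s i) (s i))"
        using L2_integrable_square[OF L2_simple_function[OF s(1)], of i]
        by (subst nn_integral_eq_integral) (auto simp: l2_inner_def power2_eq_square)
      then show ?thesis using simple_bound[OF s(1,3) s_le] by (simp add: ennreal_leI)
    qed
    then show "\<forall>\<^sub>F i in sequentially. (\<integral>\<^sup>+x. ennreal ((s i x)\<^sup>2) \<partial>M) \<le> ennreal (C\<^sup>2)" by simp
  qed auto
  finally have "(\<integral>\<^sup>+x. ennreal ((f x)\<^sup>2) \<partial>M) < \<infinity>"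
    by (rule le_less_trans) simp
  then have fL2: "f \<in> L2 M" unfolding L2_def by (auto intro!: integrableI_nonneg)
  show ?thesis by (rule that[OF fL2]) (simp_all add: f0 f_int(2))
qed

text \<open>
  For a finite family \<open>\<A>\<close> and the tolerance \<open>1 / (n + 1)\<close> choose a pair of close elements. Along a
  filter on which the masses of the first components converge, those of the second components have the same
  limits.
\<close>

lemma (in finite_measure) weakly_close_imp_common_limit:
  assumes S: "S \<subseteq> L2 M" "\<forall>l\<in>S. AE x in M. 0 \<le> l x" "l2_bounded M S"
    and T: "T \<subseteq> L2 M" "\<forall>l\<in>T. AE x in M. 0 \<le> l x" "l2_bounded M T"
    and close: "\<forall>\<A> \<delta>. finite \<A> \<longrightarrow> \<A> \<subseteq> sets M \<longrightarrow> \<delta> > 0 \<longrightarrow> (\<exists>f\<in>S. \<exists>g\<in>T. \<forall>A\<in>\<A>. \<bar>l2_inner M f (indicator A) - l2_inner M g (indicator A)\<bar> < \<delta>)"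
  shows "\<exists>(F :: ('a set set \<times> nat) filter) u v l. F \<noteq> bot \<and> (\<forall>p. u p \<in> S) \<and> (\<forall>p. v p \<in> T) \<and>
    l \<in> L2 M \<and> (\<forall>x. 0 \<le> l x) \<and>
    (\<forall>h\<in>L2 M. ((\<lambda>p. l2_inner M (u p) h) \<longlongrightarrow> l2_inner M l h) F) \<and>
    (\<forall>h\<in>L2 M. ((\<lambda>p. l2_inner M (v p) h) \<longlongrightarrow> l2_inner M l h) F)"
proof -
  obtain C where "C > 0" and C2: "\<forall>l\<in>S \<union> T. l2_inner M l l \<le> C\<^sup>2"
    by (rule l2_boundedE[OF S(3) T(3)])
  then have C: "0 \<le> C" "\<And>l. l \<in> S \<union> T \<Longrightarrow> l2_inner M l l \<le> C\<^sup>2" by auto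
  \<comment> \<open>Vacuous unless the family is finite and measurable, so that a pair exists for every index \<open>p\<close>.\<close>
  define Q where "Q p f g \<longleftrightarrow> (finite (fst p) \<and> fst p \<subseteq> sets M \<longrightarrow>
     (\<forall>A\<in>fst p. \<bar>l2_inner M f (indicator A) - l2_inner M g (indicator A)\<bar> < 1 / real (Suc (snd p))))"
    for p :: "'a set set \<times> nat" and f g
  have "\<exists>f\<in>S. \<exists>g\<in>T. Q p f g" for p
  proof (cases "finite (fst p) \<and> fst p \<subseteq> sets M")
    case True
    then show ?thesis using close[rule_format, of "fst p" "1 / real (Suc (snd p))"] unfolding Q_def by auto
  next
    case False
    obtain f g where "f \<in> S" "g \<in> T" using close[rule_format, of "{}" 1] by auto
    moreover have "Q p f g" unfolding Q_def using False by (rule impI[OF notE])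
    ultimately show ?thesis by blast
  qed
  then have "\<exists>w. fst w \<in> S \<and> snd w \<in> T \<and> Q p (fst w) (snd w)" for p
    by (metis fst_conv snd_conv)
  then obtain w where w: "\<And>p. fst (w p) \<in> S \<and> snd (w p) \<in> T \<and> Q p (fst (w p)) (snd (w p))"
    by metis
  define u v where "u p = fst (w p)" and "v p = snd (w p)" for p
  have u: "u p \<in> S" and v: "v p \<in> T" and sel: "Q p (u p) (v p)" for p
    using w[of p] unfolding u_def v_def by blast+
  define F0 :: "('a set set \<times> nat) filter" where "F0 = finite_subsets_at_top (sets M) \<times>\<^sub>F sequentially"
  have F0: "F0 \<noteq> bot" by (simp add: F0_def prod_filter_eq_bot)
  have diff0: "((\<lambda>p. l2_inner M (u p) (indicator A) - l2_inner M (v p) (indicator A)) \<longlongrightarrow> 0) F0"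
    if A: "A \<in> sets M" for A
  proof (rule Lim_null_comparison)
    have "\<forall>\<^sub>F \<A> in finite_subsets_at_top (sets M). finite \<A> \<and> \<A> \<subseteq> sets M \<and> A \<in> \<A>"
      using A unfolding eventually_finite_subsets_at_top by (intro exI[of _ "{A}"]) auto
    then have "\<forall>\<^sub>F p in F0. finite (fst p) \<and> fst p \<subseteq> sets M \<and> A \<in> fst p"
      unfolding F0_def by (rule eventually_compose_filterlim[OF _ filterlim_fst])
    then show "\<forall>\<^sub>F p in F0. norm (l2_inner M (u p) (indicator A) - l2_inner M (v p) (indicator A))
        \<le> 1 / real (Suc (snd p))"
    proof eventually_elim
      case (elim p)
      then show ?case using sel[of p] unfolding Q_def by (simp add: less_imp_le)
    qed
    have "(\<lambda>n. 1 / real (Suc n)) \<longlonglongrightarrow> 0" by (rule LIMSEQ_Suc[OF lim_1_over_n])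
    then show "((\<lambda>p. 1 / real (Suc (snd p))) \<longlongrightarrow> 0) F0"
      unfolding F0_def by (rule filterlim_compose[OF _ filterlim_snd])
  qed
  define I where "I p A = (if A \<in> sets M then l2_inner M (u p) (indicator A) else 0)" for p A
  have "\<bar>I p A\<bar> \<le> C * sqrt (l2_inner M (indicator A) (indicator A))" for p A
  proof (cases "A \<in> sets M")
    case True
    have "u p \<in> L2 M" "l2_inner M (u p) (u p) \<le> C\<^sup>2" using u[of p] S C(2) by auto
    then show ?thesis
      unfolding I_def using True C(1) by (simp add: l2_Cauchy_Schwarz_bounded L2_indicator)
  next
    case False
    then show ?thesis using C(1) l2_inner_self_nonneg[of M "indicator A"] by (simp add: I_def)
  qed
  from bounded_net_cluster[OF F0, of I, OF this]
  obtain F \<phi> where F: "F \<le> F0" "F \<noteq> bot" and I\<phi>: "\<And>A. ((\<lambda>p. I p A) \<longlongrightarrow> \<phi> A) F" by metis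
  have u\<phi>: "((\<lambda>p. l2_inner M (u p) (indicator A)) \<longlongrightarrow> \<phi> A) F" if "A \<in> sets M" for A
    using I\<phi>[of A] that by (simp add: I_def)
  have v\<phi>: "((\<lambda>p. l2_inner M (v p) (indicator A)) \<longlongrightarrow> \<phi> A) F" if "A \<in> sets M" for A
    using tendsto_diff[OF u\<phi>[OF that] tendsto_mono[OF F(1) diff0[OF that]]] by simp
  have uL: "u p \<in> L2 M" "AE x in M. 0 \<le> u p x" "l2_inner M (u p) (u p) \<le> C\<^sup>2"
    and vL: "v p \<in> L2 M" "AE x in M. 0 \<le> v p x" "l2_inner M (v p) (v p) \<le> C\<^sup>2" for p
    using u[of p] v[of p] S T C(2) by auto
  obtain l where l: "l \<in> L2 M" "\<forall>x. 0 \<le> l x" "\<forall>A\<in>sets M. l2_inner M l (indicator A) = \<phi> A"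
    by (rule weak_limit_exists[OF F(2) uL C(1) u\<phi>])
  have ul: "((\<lambda>p. l2_inner M (u p) h) \<longlongrightarrow> l2_inner M l h) F" if "h \<in> L2 M" for h
  proof (rule setwise_imp_weak_convergence[OF uL(1) l(1) uL(3) C(1) _ that])
    show "((\<lambda>p. l2_inner M (u p) (indicator A)) \<longlongrightarrow> l2_inner M l (indicator A)) F" if "A \<in> sets M" for A
      unfolding bspec[OF l(3) that] using that by (rule u\<phi>)
  qed
  have vl: "((\<lambda>p. l2_inner M (v p) h) \<longlongrightarrow> l2_inner M l h) F" if "h \<in> L2 M" for h
  proof (rule setwise_imp_weak_convergence[OF vL(1) l(1) vL(3) C(1) _ that])
    show "((\<lambda>p. l2_inner M (v p) (indicator A)) \<longlongrightarrow> l2_inner M l (indicator A)) F" if "A \<in> sets M" for A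
      unfolding bspec[OF l(3) that] using that by (rule v\<phi>)
  qed
  show ?thesis
    by (intro exI[of _ F] exI[of _ u] exI[of _ v] exI[of _ l] conjI ballI allI F(2) u v l(1) spec[OF l(2)] ul vl)
qed

section \<open>Setwise continuity of the Poisson law\<close>

lemma measure_density_eq_l2_inner:
  assumes l: "l \<in> L2 M" "AE x in M. 0 \<le> l x" and M: "finite_measure M" and A: "A \<in> sets M"
  shows "measure (density M (\<lambda>x. ennreal (l x))) A = l2_inner M l (indicator A)"
proof -
  interpret finite_measure M by fact
  have [measurable]: "l \<in> borel_measurable M" using l(1) by (rule L2_measurable)
  have "emeasure (density M (\<lambda>x. ennreal (l x))) A = (\<integral>\<^sup>+x. ennreal (l x * indicator A x) \<partial>M)"
    using A by (subst emeasure_density) (auto simp: ennreal_mult'' ennreal_indicator)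
  also have "\<dots> = ennreal (l2_inner M l (indicator A))"
    unfolding l2_inner_def using l(2) A
    by (intro nn_integral_eq_integral L2_mult_integrable l L2_indicator) auto
  finally have "emeasure (density M (\<lambda>x. ennreal (l x))) A = ennreal (l2_inner M l (indicator A))" .
  moreover have "0 \<le> l2_inner M l (indicator A)"
    unfolding l2_inner_def using l(2) by (intro integral_nonneg_AE) auto
  ultimately show ?thesis by (simp add: measure_def)
qed

text \<open>
  The defining properties of a Poisson process concern single counts and independence for disjoint sets
  only. They determine the probabilities of all cell events, hence the law.
\<close>

lemma distr_poisson_process:
  assumes N: "poisson_process P \<mu> N" and \<mu>: "finite_measure \<mu>"
  shows "distr P (counting_algebra \<mu>) N = poisson_law \<mu>"
proof -
  interpret \<mu>: finite_measure \<mu> by fact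
  interpret P: prob_space P using N by (simp add: poisson_process_def)
  have [measurable]: "N \<in> measurable P (counting_algebra \<mu>)" using N by (simp add: poisson_process_def)
  show ?thesis
  proof (rule \<mu>.poisson_law_unique)
    show "prob_space (distr P (counting_algebra \<mu>) N)" by (rule P.prob_space_distr) simp
    fix c :: "'b \<Rightarrow> nat" and I n
    assume c[measurable]: "c \<in> measurable \<mu> (count_space UNIV)" and I: "finite I" "c ` space \<mu> \<subseteq> I"
    define B where "B i = c -` {i} \<inter> space \<mu>" for i
    have B: "B i \<in> sets \<mu>" for i unfolding B_def by measurable
    have "measure (distr P (counting_algebra \<mu>) N) (cell_event \<mu> c I n)
        = P.prob (N -` cell_event \<mu> c I n \<inter> space P)"
      using I by (intro measure_distr) auto
    also have "N -` cell_event \<mu> c I n \<inter> space P = {\<omega> \<in> space P. \<forall>i\<in>I. emeasure (N \<omega>) (B i) = of_nat (n i)}"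
      using measurable_space[OF \<open>N \<in> measurable P (counting_algebra \<mu>)\<close>]
      by (auto simp: cell_event_def B_def)
    also have "P.prob \<dots> = (\<Prod>i\<in>I. P.prob {\<omega> \<in> space P. emeasure (N \<omega>) (B i) = of_nat (n i)})"
    proof (cases "I = {}")
      case False
      have "disjoint_family_on B I" by (auto simp: disjoint_family_on_def B_def)
      then have indep: "P.indep_vars (\<lambda>_. borel) (\<lambda>i \<omega>. emeasure (N \<omega>) (B i)) I"
        using N I B unfolding poisson_process_def by blast
      have "P.prob (\<Inter>i\<in>I. (\<lambda>\<omega>. emeasure (N \<omega>) (B i)) -` {of_nat (n i)} \<inter> space P)
          = (\<Prod>i\<in>I. P.prob ((\<lambda>\<omega>. emeasure (N \<omega>) (B i)) -` {of_nat (n i)} \<inter> space P))"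
        using False I by (intro P.indep_varsD_finite[OF indep]) auto
      moreover have "(\<Inter>i\<in>I. (\<lambda>\<omega>. emeasure (N \<omega>) (B i)) -` {of_nat (n i)} \<inter> space P)
          = {\<omega> \<in> space P. \<forall>i\<in>I. emeasure (N \<omega>) (B i) = of_nat (n i)}"
        using False by auto
      moreover have "(\<lambda>\<omega>. emeasure (N \<omega>) (B i)) -` {of_nat (n i)} \<inter> space P
          = {\<omega> \<in> space P. emeasure (N \<omega>) (B i) = of_nat (n i)}" for i
        by auto
      ultimately show ?thesis by simp
    qed (simp add: P.prob_space)
    also have "\<dots> = (\<Prod>i\<in>I. measure \<mu> (B i) ^ n i / fact (n i) * exp (- measure \<mu> (B i)))"
      using N B by (simp add: poisson_process_def)
    finally show "measure (distr P (counting_algebra \<mu>) N) (cell_event \<mu> c I n) =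
      (\<Prod>i\<in>I. measure \<mu> (c -` {i} \<inter> space \<mu>) ^ n i / fact (n i) * exp (- measure \<mu> (c -` {i} \<inter> space \<mu>)))"
      by (simp add: B_def)
  qed simp
qed

text \<open>
  For \<open>P\<close> with density \<open>\<rho>\<close> relative to \<open>Q\<close> this says \<open>\<integral>\<rho>\<^sup>2 dQ \<le> D\<close>. Stated for all functions \<open>F\<close>,
  and not only for indicators, it passes to product measures.
\<close>

definition square_dominated :: "real \<Rightarrow> 'x measure \<Rightarrow> 'x measure \<Rightarrow> bool" where
  "square_dominated D Q P \<longleftrightarrow> prob_space P \<and> sets P = sets Q \<and>
     (\<forall>F\<in>borel_measurable Q. (\<integral>\<^sup>+x. F x \<partial>P)\<^sup>2 \<le> ennreal D * (\<integral>\<^sup>+x. (F x)\<^sup>2 \<partial>Q))"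

lemma square_dominated_measure:
  assumes P: "square_dominated D Q P" and Q: "finite_measure Q" and D: "D \<ge> 0" and E: "E \<in> sets Q"
  shows "(measure P E)\<^sup>2 \<le> D * measure Q E"
proof -
  interpret P: prob_space P using P by (simp add: square_dominated_def)
  interpret Q: finite_measure Q by fact
  have "indicator E \<in> borel_measurable Q" using E by (rule borel_measurable_indicator)
  then have "(\<integral>\<^sup>+x. indicator E x \<partial>P)\<^sup>2 \<le> ennreal D * (\<integral>\<^sup>+x. (indicator E x)\<^sup>2 \<partial>Q)"
    using P unfolding square_dominated_def by blast
  also have "(\<lambda>x. (indicator E x)\<^sup>2 :: ennreal) = indicator E" by (auto simp: indicator_def)
  finally have "(emeasure P E)\<^sup>2 \<le> ennreal D * emeasure Q E"
    using P E by (simp add: square_dominated_def)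
  then show ?thesis
    using D by (simp add: P.emeasure_eq_measure Q.emeasure_eq_measure ennreal_power flip: ennreal_mult)
qed

text \<open>
  Apply the inequality to one coordinate after the other; each contributes a factor \<open>D\<close>.
\<close>

lemma square_dominated_PiM:
  assumes "finite I" and P: "square_dominated D Q P" and Q: "prob_space Q" and D: "D \<ge> 0"
  shows "square_dominated (D ^ card I) (PiM I (\<lambda>_. Q)) (PiM I (\<lambda>_. P))"
proof -
  interpret P: prob_space P using P by (simp add: square_dominated_def)
  interpret Q: prob_space Q by fact
  interpret PP: product_sigma_finite "\<lambda>_::'a. P" by standard
  interpret QQ: product_sigma_finite "\<lambda>_::'a. Q" by standard
  have [measurable_cong]: "sets P = sets Q" using P by (simp add: square_dominated_def)
  have sets: "sets (PiM I (\<lambda>_::'a. P)) = sets (PiM I (\<lambda>_. Q))" for I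
    by (rule sets_PiM_cong) (auto simp: \<open>sets P = sets Q\<close>)
  have "(\<integral>\<^sup>+x. F x \<partial>PiM I (\<lambda>_. P))\<^sup>2 \<le> ennreal (D ^ card I) * (\<integral>\<^sup>+x. (F x)\<^sup>2 \<partial>PiM I (\<lambda>_. Q))"
    if "F \<in> borel_measurable (PiM I (\<lambda>_. Q))" for F
    using \<open>finite I\<close> that
  proof (induction I arbitrary: F)
    case empty
    then show ?case by (simp add: PP.nn_integral_empty QQ.nn_integral_empty)
  next
    case (insert i I)
    note [measurable] = insert.prems
    have [measurable]: "F \<in> borel_measurable (PiM (insert i I) (\<lambda>_. P))"
      using insert.prems measurable_cong_sets[OF sets refl] by blast
    have "(\<integral>\<^sup>+x. F x \<partial>PiM (insert i I) (\<lambda>_. P))\<^sup>2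
        = (\<integral>\<^sup>+x. (\<integral>\<^sup>+y. F (x(i := y)) \<partial>P) \<partial>PiM I (\<lambda>_. P))\<^sup>2"
      using insert.hyps by (simp add: PP.product_nn_integral_insert)
    also have "\<dots> \<le> ennreal (D ^ card I) * (\<integral>\<^sup>+x. (\<integral>\<^sup>+y. F (x(i := y)) \<partial>P)\<^sup>2 \<partial>PiM I (\<lambda>_. Q))"
      by (rule insert.IH) measurable
    also have "\<dots> \<le> ennreal (D ^ card I) *
        (\<integral>\<^sup>+x. ennreal D * (\<integral>\<^sup>+y. (F (x(i := y)))\<^sup>2 \<partial>Q) \<partial>PiM I (\<lambda>_. Q))"
    proof (intro mult_left_mono nn_integral_mono)
      fix x assume "x \<in> space (PiM I (\<lambda>_. Q))"
      then have "(\<lambda>y. F (x(i := y))) \<in> borel_measurable Q" by measurable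
      then show "(\<integral>\<^sup>+y. F (x(i := y)) \<partial>P)\<^sup>2 \<le> ennreal D * (\<integral>\<^sup>+y. (F (x(i := y)))\<^sup>2 \<partial>Q)"
        using P by (simp add: square_dominated_def)
    qed simp
    also have "\<dots> = ennreal (D ^ card I) * ennreal D * (\<integral>\<^sup>+x. (F x)\<^sup>2 \<partial>PiM (insert i I) (\<lambda>_. Q))"
      using insert.hyps by (simp add: QQ.product_nn_integral_insert nn_integral_cmult mult.assoc)
    also have "ennreal (D ^ card I) * ennreal D = ennreal (D ^ card (insert i I))"
      using insert.hyps D by (simp add: mult.commute flip: ennreal_mult)
    finally show ?case .
  qed
  moreover have "prob_space (PiM I (\<lambda>_. P))" by (intro prob_space_PiM P.prob_space_axioms)
  ultimately show ?thesis by (simp add: square_dominated_def sets)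
qed

text \<open>
  The measures of the tails \<open>A n \<union> A (n + 1) \<union> \<dots>\<close> are small uniformly in \<open>p\<close>, because they are bounded by
  \<open>sqrt (D \<cdot> Q(tail))\<close>. This reduces the union to finitely many of the sets.
\<close>

lemma setwise_limit_UN:
  fixes A :: "nat \<Rightarrow> 'x set"
  assumes Q: "finite_measure Q" and D: "D \<ge> 0"
    and P: "\<And>p. square_dominated D Q (P p)" and P0: "square_dominated D Q P0"
    and A: "disjoint_family A" "range A \<subseteq> sets Q"
    and lim: "\<And>i. ((\<lambda>p. measure (P p) (A i)) \<longlongrightarrow> measure P0 (A i)) F"
  shows "((\<lambda>p. measure (P p) (\<Union>i. A i)) \<longlongrightarrow> measure P0 (\<Union>i. A i)) F"
proof (rule tendstoI)
  interpret Q: finite_measure Q by fact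
  fix e :: real assume "e > 0"
  define R where "R n = (\<Union>i\<in>{n..}. A i)" for n
  have R: "R n \<in> sets Q" for n using A(2) by (auto simp: R_def)
  have "(\<lambda>n. measure Q (R n)) \<longlonglongrightarrow> measure Q (\<Inter>n. R n)"
    using R by (intro Q.finite_Lim_measure_decseq) (auto simp: decseq_def R_def intro: order_trans)
  moreover have "(\<Inter>n. R n) = {}"
  proof (rule ccontr)
    assume "(\<Inter>n. R n) \<noteq> {}"
    then obtain x where x: "\<And>n. x \<in> R n" by blast
    from x[of 0] obtain i where i: "x \<in> A i" by (auto simp: R_def)
    from x[of "Suc i"] obtain j where "j \<ge> Suc i" "x \<in> A j" by (auto simp: R_def)
    moreover from this have "A i \<inter> A j = {}" using A(1) by (auto simp: disjoint_family_on_def)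
    ultimately show False using i by blast
  qed
  ultimately have "(\<lambda>n. D * measure Q (R n)) \<longlonglongrightarrow> D * 0"
    by (intro tendsto_intros) simp
  then have "\<forall>\<^sub>F n in sequentially. D * measure Q (R n) < (e / 3)\<^sup>2"
    using \<open>e > 0\<close> by (intro order_tendstoD(2)) auto
  then obtain n where n: "D * measure Q (R n) < (e / 3)\<^sup>2"
    by (auto simp: eventually_sequentially)
  have split: "measure P' (\<Union>i. A i) = (\<Sum>i<n. measure P' (A i)) + measure P' (R n)"
    and small: "measure P' (R n) < e / 3" if P': "square_dominated D Q P'" for P'
  proof -
    interpret P': prob_space P' using P' by (simp add: square_dominated_def)
    have sets: "sets P' = sets Q" using P' by (simp add: square_dominated_def)
    have "(\<Union>i. A i) = (\<Union>i\<in>{..<n} \<union> {n..}. A i)"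
      by (rule arg_cong[where f = "\<lambda>I. \<Union>i\<in>I. A i"]) auto
    then have "(\<Union>i. A i) = (\<Union>i<n. A i) \<union> R n" by (simp only: UN_Un R_def)
    moreover have "(\<Union>i<n. A i) \<inter> R n = {}"
    proof (rule equals0I)
      fix x assume "x \<in> (\<Union>i<n. A i) \<inter> R n"
      then obtain i j where ij: "i < n" "n \<le> j" "x \<in> A i" "x \<in> A j" by (auto simp: R_def)
      then have "A i \<inter> A j = {}" using A(1) by (auto simp: disjoint_family_on_def)
      with ij show False by blast
    qed
    ultimately have "measure P' (\<Union>i. A i) = measure P' (\<Union>i<n. A i) + measure P' (R n)"
      using A(2) R by (simp add: sets P'.finite_measure_Union subset_eq)
    also have "measure P' (\<Union>i<n. A i) = (\<Sum>i<n. measure P' (A i))"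
      using A by (intro P'.finite_measure_finite_Union)
        (auto simp: sets intro: disjoint_family_on_mono)
    finally show "measure P' (\<Union>i. A i) = (\<Sum>i<n. measure P' (A i)) + measure P' (R n)" .
    have "(measure P' (R n))\<^sup>2 < (e / 3)\<^sup>2"
      using square_dominated_measure[OF P' Q D R[of n]] n by simp
    then show "measure P' (R n) < e / 3"
      by (rule power_less_imp_less_base) (use \<open>e > 0\<close> in simp)
  qed
  have "((\<lambda>p. \<Sum>i<n. measure (P p) (A i)) \<longlongrightarrow> (\<Sum>i<n. measure P0 (A i))) F"
    by (intro tendsto_sum lim)
  then have "\<forall>\<^sub>F p in F. dist (\<Sum>i<n. measure (P p) (A i)) (\<Sum>i<n. measure P0 (A i)) < e / 3"
    using \<open>e > 0\<close> by (intro tendstoD) auto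
  then show "\<forall>\<^sub>F p in F. dist (measure (P p) (\<Union>i. A i)) (measure P0 (\<Union>i. A i)) < e"
  proof eventually_elim
    case (elim p)
    show ?case
      using elim small[OF P[of p]] small[OF P0] measure_nonneg[of "P p" "R n"] measure_nonneg[of P0 "R n"]
      unfolding split[OF P[of p]] split[OF P0] dist_real_def by linarith
  qed
qed

lemma setwise_limit_compl:
  assumes "prob_space P0" "\<And>p. prob_space (P p)" "sets P0 = sets Q" "\<And>p. sets (P p) = sets Q"
    and "A \<in> sets Q" and "((\<lambda>p. measure (P p) A) \<longlongrightarrow> measure P0 A) F"
  shows "((\<lambda>p. measure (P p) (space Q - A)) \<longlongrightarrow> measure P0 (space Q - A)) F"
proof -
  have "measure R (space Q - A) = 1 - measure R A" if "prob_space R" "sets R = sets Q" for R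
    using prob_space.prob_compl[OF that(1), of A] assms(5) that(2) sets_eq_imp_space_eq[OF that(2)] by simp
  then show ?thesis using assms by (simp add: tendsto_diff)
qed

lemma setwise_limit_PiM:
  assumes I: "finite I" and Q: "prob_space Q" and D: "D \<ge> 0"
    and P: "\<And>p. square_dominated D Q (P p)" and P0: "square_dominated D Q P0"
    and lim: "\<And>E. E \<in> sets Q \<Longrightarrow> ((\<lambda>p. measure (P p) E) \<longlongrightarrow> measure P0 E) F"
    and E: "E \<in> sets (PiM I (\<lambda>_. Q))"
  shows "((\<lambda>p. measure (PiM I (\<lambda>_. P p)) E) \<longlongrightarrow> measure (PiM I (\<lambda>_. P0)) E) F"
proof -
  let ?Q = "PiM I (\<lambda>_. Q)"
  interpret Q': prob_space ?Q by (intro prob_space_PiM Q)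
  have sd: "square_dominated (D ^ card I) ?Q (PiM I (\<lambda>_. R))" if "square_dominated D Q R" for R
    using I that Q D by (rule square_dominated_PiM)
  have E: "E \<in> sigma_sets (\<Pi>\<^sub>E i\<in>I. space Q) (prod_algebra I (\<lambda>_. Q))"
    using E by (simp add: sets_PiM)
  from E show ?thesis
  proof (induction rule: sigma_sets_induct_disjoint[OF Int_stable_prod_algebra prod_algebra_sets_into_space,
        consumes 1, case_names basic empty compl union])
    case (basic A)
    then obtain X where X: "A = Pi\<^sub>E I X" "\<And>i. i \<in> I \<Longrightarrow> X i \<in> sets Q"
      by (auto simp: prod_algebra_eq_finite[OF I])
    have eq: "measure (PiM I (\<lambda>_. R)) A = (\<Prod>i\<in>I. measure R (X i))" if R: "square_dominated D Q R" for R
    proof -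
      interpret R: prob_space R using R by (simp add: square_dominated_def)
      interpret RR: product_sigma_finite "\<lambda>_. R" by standard
      have "sets R = sets Q" using R by (simp add: square_dominated_def)
      then have "emeasure (PiM I (\<lambda>_. R)) A = (\<Prod>i\<in>I. emeasure R (X i))"
        unfolding X(1) using X(2) I by (intro RR.emeasure_PiM) auto
      then have "emeasure (PiM I (\<lambda>_. R)) A = ennreal (\<Prod>i\<in>I. measure R (X i))"
        by (simp add: R.emeasure_eq_measure prod_ennreal)
      then show ?thesis by (subst measure_def) (simp add: prod_nonneg)
    qed
    show ?case unfolding eq[OF P] eq[OF P0] by (intro tendsto_prod lim X(2))
  next
    case (compl A)
    have "A \<in> sets ?Q" using compl(1) by (simp add: sets_PiM)
    then have "((\<lambda>p. measure (PiM I (\<lambda>_. P p)) (space ?Q - A)) \<longlongrightarrow> measure (PiM I (\<lambda>_. P0)) (space ?Q - A)) F"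
      using sd[OF P] sd[OF P0] compl(2)
      by (intro setwise_limit_compl) (auto simp: square_dominated_def)
    then show ?case by (simp add: space_PiM)
  next
    case (union A)
    then show ?case
      using Q'.finite_measure_axioms D sd[OF P] sd[OF P0]
      by (intro setwise_limit_UN[of ?Q "D ^ card I"]) (auto simp: sets_PiM)
  qed simp
qed

text \<open>
  The staircase approximation of \<open>t\<close> from below with steps of height \<open>1 / m\<close>.
\<close>

lemma layer_sum_approx:
  fixes t :: real
  assumes "0 \<le> t" "t \<le> 1" and "m > 0"
  shows "\<bar>t - (\<Sum>j=1..m. if real j / real m \<le> t then 1 / real m else 0)\<bar> \<le> 1 / real m"
proof -
  define k where "k = nat \<lfloor>real m * t\<rfloor>"
  have k: "real k \<le> real m * t" "real m * t < real k + 1"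
    using assms by (auto simp: k_def of_nat_nat)
  have "real m * t \<le> real m" using assms by (simp add: mult_left_le)
  with k have "k \<le> m" by linarith
  have "(real j / real m \<le> t) \<longleftrightarrow> j \<le> k" for j
  proof
    assume "real j / real m \<le> t"
    then have "real j \<le> real m * t" using assms by (simp add: field_simps)
    with k have "real j < real k + 1" by linarith
    then show "j \<le> k" by linarith
  next
    assume "j \<le> k"
    then have "real j \<le> real m * t" using k by linarith
    then show "real j / real m \<le> t" using assms by (simp add: field_simps)
  qed
  then have "(\<Sum>j=1..m. if real j / real m \<le> t then 1 / real m else 0)
      = (\<Sum>j=1..m. if j \<le> k then 1 / real m else 0)" by simp
  also have "\<dots> = (\<Sum>j=1..k. 1 / real m)"
    using \<open>k \<le> m\<close> by (intro sum.mono_neutral_cong_right) auto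
  also have "\<dots> = real k / real m" by simp
  finally have eq: "(\<Sum>j=1..m. if real j / real m \<le> t then 1 / real m else 0) = real k / real m" .
  have "t - real k / real m = (real m * t - real k) / real m"
    using assms by (simp add: field_simps)
  moreover have "\<bar>(real m * t - real k) / real m\<bar> \<le> 1 / real m"
    using k assms by (simp add: divide_right_mono)
  ultimately show ?thesis unfolding eq by simp
qed

text \<open>
  Up to \<open>1 / m\<close> the integral of \<open>K\<close> is the average of the measures of the level sets
  \<open>{x. j / m \<le> K x}\<close>, uniformly over all probability measures.
\<close>

lemma setwise_limit_integral:
  assumes P: "\<And>p. prob_space (P p)" "\<And>p. sets (P p) = sets Q"
    and P0: "prob_space P0" "sets P0 = sets Q"
    and lim: "\<And>E. E \<in> sets Q \<Longrightarrow> ((\<lambda>p. measure (P p) E) \<longlongrightarrow> measure P0 E) F"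
    and K: "K \<in> borel_measurable Q" "\<And>x. x \<in> space Q \<Longrightarrow> 0 \<le> K x \<and> K x \<le> (1::real)"
  shows "((\<lambda>p. \<integral>x. K x \<partial>P p) \<longlongrightarrow> (\<integral>x. K x \<partial>P0)) F"
proof (rule tendstoI)
  fix e :: real assume "e > 0"
  obtain m :: nat where m: "m > 0" "3 / e < real m"
    using reals_Archimedean2[of "max 1 (3 / e)"] by (metis max_less_iff_conj of_nat_0_less_iff less_trans zero_less_one)
  then have me: "1 / real m < e / 3" using \<open>e > 0\<close> by (simp add: field_simps)
  define E where "E j = {x \<in> space Q. real j / real m \<le> K x}" for j
  have E: "E j \<in> sets Q" for j unfolding E_def using K(1) by measurable
  have approx: "\<bar>(\<integral>x. K x \<partial>R) - (\<Sum>j=1..m. 1 / real m * measure R (E j))\<bar> \<le> 1 / real m"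
    if R: "prob_space R" "sets R = sets Q" for R
  proof -
    interpret R: prob_space R by fact
    have space: "space R = space Q" using R(2) by (rule sets_eq_imp_space_eq)
    have [measurable]: "K \<in> borel_measurable R" using K(1) measurable_cong_sets[OF R(2) refl] by blast
    have [measurable]: "E j \<in> sets R" for j using E R(2) by simp
    have intK: "integrable R K" using K(2) by (intro R.integrable_const_bound[of _ 1]) (auto simp: space)
    have "(\<Sum>j=1..m. 1 / real m * measure R (E j)) = (\<integral>x. (\<Sum>j=1..m. 1 / real m * indicator (E j) x) \<partial>R)"
      by (subst Bochner_Integration.integral_sum) (auto simp: R.emeasure_eq_measure)
    then have "(\<integral>x. K x \<partial>R) - (\<Sum>j=1..m. 1 / real m * measure R (E j))
        = (\<integral>x. K x - (\<Sum>j=1..m. 1 / real m * indicator (E j) x) \<partial>R)"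
      using intK by (subst Bochner_Integration.integral_diff) (auto simp: R.emeasure_eq_measure)
    also have "\<bar>\<dots>\<bar> \<le> (\<integral>x. \<bar>K x - (\<Sum>j=1..m. 1 / real m * indicator (E j) x)\<bar> \<partial>R)"
      by (rule integral_abs_bound)
    also have "\<dots> \<le> (\<integral>x. 1 / real m \<partial>R)"
    proof (rule integral_mono_AE')
      have "\<bar>K x - (\<Sum>j=1..m. 1 / real m * indicator (E j) x)\<bar> \<le> 1 / real m" if "x \<in> space R" for x
      proof -
        have "(\<Sum>j=1..m. 1 / real m * indicator (E j) x)
            = (\<Sum>j=1..m. if real j / real m \<le> K x then 1 / real m else 0)"
          using that by (intro sum.cong) (auto simp: E_def space)
        then show ?thesis using layer_sum_approx[of "K x" m] K(2)[of x] that m(1) by (simp add: space)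
      qed
      then show "AE x in R. \<bar>K x - (\<Sum>j=1..m. 1 / real m * indicator (E j) x)\<bar> \<le> 1 / real m" by simp
    qed auto
    finally show ?thesis by (simp add: R.prob_space)
  qed
  have "((\<lambda>p. \<Sum>j=1..m. 1 / real m * measure (P p) (E j)) \<longlongrightarrow> (\<Sum>j=1..m. 1 / real m * measure P0 (E j))) F"
    by (intro tendsto_sum tendsto_mult tendsto_const lim E)
  then have "\<forall>\<^sub>F p in F. dist (\<Sum>j=1..m. 1 / real m * measure (P p) (E j))
      (\<Sum>j=1..m. 1 / real m * measure P0 (E j)) < e / 3"
    using \<open>e > 0\<close> by (intro tendstoD) auto
  then show "\<forall>\<^sub>F p in F. dist (\<integral>x. K x \<partial>P p) (\<integral>x. K x \<partial>P0) < e"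
  proof eventually_elim
    case (elim p)
    show ?case
      using elim approx[OF P, of p] approx[OF P0] me unfolding dist_real_def by linarith
  qed
qed

context finite_measure
begin

lemma square_dominated_poisson_law:
  assumes l: "l \<in> L2 M" "AE x in M. 0 \<le> l x" "l2_inner M l l \<le> C\<^sup>2" and C: "C > 0"
  shows "square_dominated (exp (C\<^sup>2 + measure M (space M))) (poisson_law M)
    (poisson_law (density M (\<lambda>x. ennreal (l x))))"
proof -
  let ?\<mu> = "density M (\<lambda>x. ennreal (l x))"
  interpret \<mu>: finite_measure ?\<mu> by (rule finite_measure_density_L2[OF l(1)])
  have "(\<integral>\<^sup>+x. (ennreal (l x))\<^sup>2 \<partial>M) = (\<integral>\<^sup>+x. ennreal ((l x)\<^sup>2) \<partial>M)"
    using l(2) by (intro nn_integral_cong_AE) (auto simp: ennreal_power)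
  also have "\<dots> = ennreal (l2_inner M l l)"
    using L2_integrable_square[OF l(1)] by (subst nn_integral_eq_integral) (auto simp: l2_inner_def power2_eq_square)
  also have "\<dots> \<le> ennreal (C\<^sup>2)" using l(3) by (rule ennreal_leI)
  finally have "(\<integral>\<^sup>+x. (ennreal (l x))\<^sup>2 \<partial>M) \<le> ennreal (C\<^sup>2)" .
  then have "(\<integral>\<^sup>+m. F m \<partial>poisson_law ?\<mu>)\<^sup>2
      \<le> ennreal (exp (C\<^sup>2 + measure M (space M))) * (\<integral>\<^sup>+m. (F m)\<^sup>2 \<partial>poisson_law M)"
    if "F \<in> borel_measurable (counting_algebra M)" for F
    using that C by (intro poisson_law_square_le l(1)) auto
  moreover have "counting_algebra ?\<mu> = counting_algebra M" by (rule counting_algebra_cong) simp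
  moreover have "borel_measurable (poisson_law M) = borel_measurable (counting_algebra M)"
    by (rule measurable_cong_sets) auto
  ultimately show ?thesis
    using \<mu>.prob_space_poisson_law by (simp add: square_dominated_def)
qed

text \<open>
  The probability of a cell event is a continuous function of finitely many masses. Domination by the law
  with intensity \<open>1\<close> carries the convergence over to all events.
\<close>

lemma poisson_law_setwise_limit:
  assumes u: "\<And>p. u p \<in> L2 M" "\<And>p. AE x in M. 0 \<le> u p x" "\<And>p. l2_inner M (u p) (u p) \<le> C\<^sup>2"
    and l: "l \<in> L2 M" "AE x in M. 0 \<le> l x" "l2_inner M l l \<le> C\<^sup>2" and C: "C > 0"
    and lim: "\<And>A. A \<in> sets M \<Longrightarrow> ((\<lambda>p. l2_inner M (u p) (indicator A)) \<longlongrightarrow> l2_inner M l (indicator A)) F"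
    and E: "E \<in> sets (counting_algebra M)"
  shows "((\<lambda>p. measure (poisson_law (density M (\<lambda>x. ennreal (u p x)))) E)
    \<longlongrightarrow> measure (poisson_law (density M (\<lambda>x. ennreal (l x)))) E) F"
proof -
  note sd = square_dominated_poisson_law[OF _ _ _ C]
  interpret Q: prob_space "poisson_law M" by (rule prob_space_poisson_law)
  from E show ?thesis
  proof (induction rule: counting_algebra_induct)
    case (cell c I n)
    define B where "B i = c -` {i} \<inter> space M" for i
    have B: "B i \<in> sets M" for i unfolding B_def using cell(1) by measurable
    have eq: "measure (poisson_law (density M (\<lambda>x. ennreal (f x)))) (cell_event M c I n)
        = (\<Prod>i\<in>I. l2_inner M f (indicator (B i)) ^ n i / fact (n i) * exp (- l2_inner M f (indicator (B i))))"
      if f: "f \<in> L2 M" "AE x in M. 0 \<le> f x" for f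
    proof -
      let ?\<mu> = "density M (\<lambda>x. ennreal (f x))"
      interpret \<mu>: finite_measure ?\<mu> by (rule finite_measure_density_L2[OF f(1)])
      have w: "measure ?\<mu> (c -` {i} \<inter> space ?\<mu>) = l2_inner M f (indicator (B i))" for i
        using measure_density_eq_l2_inner[OF f finite_measure_axioms B[of i]] by (simp add: B_def)
      have "cell_event M c I n = cell_event ?\<mu> c I n"
        using counting_algebra_cong[of ?\<mu> M] by (simp add: cell_event_def)
      also have "measure (poisson_law ?\<mu>) \<dots> = (\<Prod>i\<in>I. measure ?\<mu> (c -` {i} \<inter> space ?\<mu>) ^ n i / fact (n i)
          * exp (- measure ?\<mu> (c -` {i} \<inter> space ?\<mu>)))"
        using cell by (intro \<mu>.measure_poisson_law_cell_event) auto
      finally show ?thesis unfolding w .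
    qed
    show ?case
      unfolding eq[OF u(1,2)] eq[OF l(1,2)]
      by (intro tendsto_prod tendsto_mult tendsto_divide tendsto_power tendsto_exp
          tendsto_minus lim B tendsto_const fact_nonzero)
  next
    case (compl A)
    then have "((\<lambda>p. measure (poisson_law (density M (\<lambda>x. ennreal (u p x)))) (space (poisson_law M) - A))
      \<longlongrightarrow> measure (poisson_law (density M (\<lambda>x. ennreal (l x)))) (space (poisson_law M) - A)) F"
      using sd[OF u] sd[OF l]
      by (intro setwise_limit_compl) (simp_all add: square_dominated_def)
    then show ?case by simp
  next
    case (union A)
    then show ?case
      using sd[OF u] sd[OF l]
      by (intro setwise_limit_UN[OF Q.finite_measure_axioms]) simp_all
  qed simp
qed

end

section \<open>Intensities that no test can tell apart\<close>

lemma distr_poisson_sample: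
  assumes M: "poisson_sample \<nu> M \<kappa> l" and l: "l \<in> L2 \<nu>" and \<nu>: "finite_measure \<nu>" and n: "n \<ge> 1"
  shows "distr (M l) (PiM {1..n} (\<lambda>_. counting_algebra \<nu>)) (\<lambda>\<omega>. \<lambda>i\<in>{1..n}. \<kappa> i \<omega>)
    = PiM {1..n} (\<lambda>_. poisson_law (density \<nu> (\<lambda>x. ennreal (l x))))"
    and "(\<lambda>\<omega>. \<lambda>i\<in>{1..n}. \<kappa> i \<omega>) \<in> measurable (M l) (PiM {1..n} (\<lambda>_. counting_algebra \<nu>))"
    and "\<And>i. i \<ge> 1 \<Longrightarrow> \<kappa> i \<in> measurable (M l) (counting_algebra \<nu>)"
proof -
  let ?\<mu> = "density \<nu> (\<lambda>x. ennreal (l x))"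
  interpret P: prob_space "M l" using M by (simp add: poisson_sample_def)
  have alg: "counting_algebra ?\<mu> = counting_algebra \<nu>" by (rule counting_algebra_cong) simp
  have N: "poisson_process (M l) ?\<mu> (\<kappa> i)" if "i \<ge> 1" for i
    using M that by (simp add: poisson_sample_def)
  then show rv: "\<And>i. i \<ge> 1 \<Longrightarrow> \<kappa> i \<in> measurable (M l) (counting_algebra \<nu>)"
    by (simp add: poisson_process_def alg)
  then show "(\<lambda>\<omega>. \<lambda>i\<in>{1..n}. \<kappa> i \<omega>) \<in> measurable (M l) (PiM {1..n} (\<lambda>_. counting_algebra \<nu>))"
    by (intro measurable_restrict) auto
  have fin: "finite_measure ?\<mu>"
    using finite_measure.finite_measure_density_L2[OF \<nu> l] .
  have "P.indep_vars (\<lambda>_. counting_algebra \<nu>) \<kappa> {1..}"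
    using M by (simp add: poisson_sample_def)
  then have "P.indep_vars (\<lambda>_. counting_algebra \<nu>) \<kappa> {1..n}"
    by (rule P.indep_vars_subset) auto
  then have "distr (M l) (PiM {1..n} (\<lambda>_. counting_algebra \<nu>)) (\<lambda>\<omega>. \<lambda>i\<in>{1..n}. \<kappa> i \<omega>)
      = PiM {1..n} (\<lambda>i. distr (M l) (counting_algebra \<nu>) (\<kappa> i))"
    using rv n by (subst (asm) P.indep_vars_iff_distr_eq_PiM') auto
  also have "\<dots> = PiM {1..n} (\<lambda>_. poisson_law ?\<mu>)"
    using distr_poisson_process[OF N fin] by (intro PiM_cong) (auto simp: alg)
  finally show "distr (M l) (PiM {1..n} (\<lambda>_. counting_algebra \<nu>)) (\<lambda>\<omega>. \<lambda>i\<in>{1..n}. \<kappa> i \<omega>)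
      = PiM {1..n} (\<lambda>_. poisson_law ?\<mu>)" .
qed

lemma nn_integral_test:
  assumes M: "poisson_sample \<nu> M \<kappa> l" and l: "l \<in> L2 \<nu>" and \<nu>: "finite_measure \<nu>" and n: "n \<ge> 1"
    and K: "is_test \<nu> n K"
  defines "P \<equiv> PiM {1..n} (\<lambda>_. poisson_law (density \<nu> (\<lambda>x. ennreal (l x))))"
  shows "(\<integral>\<^sup>+\<omega>. ennreal (K (\<lambda>i\<in>{1..n}. \<kappa> i \<omega>)) \<partial>M l) = ennreal (\<integral>k. K k \<partial>P)" (is ?A)
    and "(\<integral>\<^sup>+\<omega>. ennreal (1 - K (\<lambda>i\<in>{1..n}. \<kappa> i \<omega>)) \<partial>M l) = ennreal (1 - (\<integral>k. K k \<partial>P))" (is ?B)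
proof -
  let ?C = "PiM {1..n} (\<lambda>_. counting_algebra \<nu>)"
  note distr = distr_poisson_sample(1,2)[OF M l \<nu> n]
  interpret Ml: prob_space "M l" using M by (simp add: poisson_sample_def)
  interpret P: prob_space P
    unfolding P_def distr(1)[symmetric] by (rule Ml.prob_space_distr[OF distr(2)])
  have P: "P = distr (M l) ?C (\<lambda>\<omega>. \<lambda>i\<in>{1..n}. \<kappa> i \<omega>)" unfolding P_def distr(1) ..
  have [measurable]: "K \<in> borel_measurable ?C" using K by (simp add: is_test_def)
  have sets: "sets P = sets ?C" "space P = space ?C" by (simp_all add: P)
  have KP: "K \<in> borel_measurable P"
    unfolding measurable_cong_sets[OF sets(1) refl] by fact
  have K01: "0 \<le> K k \<and> K k \<le> 1" if "k \<in> space P" for k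
    using K that unfolding sets is_test_def by blast
  have int: "integrable P K"
    using K01 KP by (intro P.integrable_const_bound[of _ 1]) auto
  have KC: "(\<lambda>k. ennreal (K k)) \<in> borel_measurable P" "(\<lambda>k. ennreal (1 - K k)) \<in> borel_measurable P"
    using KP by measurable
  have "(\<integral>\<^sup>+\<omega>. ennreal (K (\<lambda>i\<in>{1..n}. \<kappa> i \<omega>)) \<partial>M l) = (\<integral>\<^sup>+k. ennreal (K k) \<partial>P)"
    unfolding P by (rule nn_integral_distr[OF distr(2) KC(1)[unfolded P], symmetric])
  also have "\<dots> = ennreal (\<integral>k. K k \<partial>P)"
    using int K01 by (intro nn_integral_eq_integral) auto
  finally show ?A .
  have "(\<integral>\<^sup>+\<omega>. ennreal (1 - K (\<lambda>i\<in>{1..n}. \<kappa> i \<omega>)) \<partial>M l) = (\<integral>\<^sup>+k. ennreal (1 - K k) \<partial>P)"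
    unfolding P by (rule nn_integral_distr[OF distr(2) KC(2)[unfolded P], symmetric])
  also have "\<dots> = ennreal (\<integral>k. 1 - K k \<partial>P)"
    using int K01 by (intro nn_integral_eq_integral) auto
  also have "(\<integral>k. 1 - K k \<partial>P) = 1 - (\<integral>k. K k \<partial>P)"
    using int by (simp add: P.prob_space)
  finally show ?B .
qed

text \<open>
  Along the filter the errors \<open>e (u p)\<close> and \<open>1 - e (v p)\<close> of a test converge to \<open>e l\<close> and
  \<open>1 - e l\<close>, where \<open>e f\<close> is its expectation for \<open>n\<close> independent Poisson processes with intensity
  \<open>f\<close>.
\<close>

lemma common_weak_limit_imp_indistinguishable:
  fixes F :: "'b filter"
  assumes \<nu>: "finite_measure \<nu>"
    and \<Theta>0: "\<And>l. l \<in> \<Theta>0 \<Longrightarrow> l \<in> L2 \<nu> \<and> (AE x in \<nu>. 0 \<le> l x) \<and> poisson_sample \<nu> M \<kappa> l" "l2_bounded \<nu> \<Theta>0"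
    and \<Theta>1: "\<And>l. l \<in> \<Theta>1 \<Longrightarrow> l \<in> L2 \<nu> \<and> (AE x in \<nu>. 0 \<le> l x) \<and> poisson_sample \<nu> M \<kappa> l" "l2_bounded \<nu> \<Theta>1"
    and F: "F \<noteq> bot" and u: "\<And>p. u p \<in> \<Theta>0" and v: "\<And>p. v p \<in> \<Theta>1"
    and l: "l \<in> L2 \<nu>" "\<And>x. 0 \<le> l x"
    and ul: "\<And>h. h \<in> L2 \<nu> \<Longrightarrow> ((\<lambda>p. l2_inner \<nu> (u p) h) \<longlongrightarrow> l2_inner \<nu> l h) F"
    and vl: "\<And>h. h \<in> L2 \<nu> \<Longrightarrow> ((\<lambda>p. l2_inner \<nu> (v p) h) \<longlongrightarrow> l2_inner \<nu> l h) F"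
  shows "indistinguishable \<nu> M \<kappa> \<Theta>0 \<Theta>1"
  unfolding indistinguishable_def
proof (intro allI impI)
  interpret finite_measure \<nu> by fact
  fix n :: nat and K assume n: "n \<ge> 1" and K: "is_test \<nu> n K"
  obtain C where C0: "C > 0" and C1: "\<forall>f\<in>insert l \<Theta>0 \<union> \<Theta>1. l2_inner \<nu> f f \<le> C\<^sup>2"
    by (rule l2_boundedE[OF l2_bounded_insert[OF \<Theta>0(2)] \<Theta>1(2)])
  then have C: "C > 0" "l2_inner \<nu> l l \<le> C\<^sup>2" "\<And>f. f \<in> \<Theta>0 \<union> \<Theta>1 \<Longrightarrow> l2_inner \<nu> f f \<le> C\<^sup>2"
    by auto
  define P where "P f = poisson_law (density \<nu> (\<lambda>x. ennreal (f x)))" for f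
  define e where "e f = (\<integral>k. K k \<partial>PiM {1..n} (\<lambda>_. P f))" for f
  let ?Q = "PiM {1..n} (\<lambda>_. poisson_law \<nu>)"
  have sets_Q: "sets ?Q = sets (PiM {1..n} (\<lambda>_. counting_algebra \<nu>))"
    by (intro sets_PiM_cong) auto
  have K': "K \<in> borel_measurable ?Q" "\<And>k. k \<in> space ?Q \<Longrightarrow> 0 \<le> K k \<and> K k \<le> 1"
    using K measurable_cong_sets[OF sets_Q refl] sets_eq_imp_space_eq[OF sets_Q]
    by (auto simp: is_test_def)
  have sd: "square_dominated (exp (C\<^sup>2 + measure \<nu> (space \<nu>))) (poisson_law \<nu>) (P f)"
    if "f \<in> L2 \<nu>" "AE x in \<nu>. 0 \<le> f x" "l2_inner \<nu> f f \<le> C\<^sup>2" for f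
    unfolding P_def using that C(1) by (rule square_dominated_poisson_law)
  have lim: "((\<lambda>p. e (g p)) \<longlongrightarrow> e l) F"
    if g: "\<And>p. g p \<in> L2 \<nu>" "\<And>p. AE x in \<nu>. 0 \<le> g p x" "\<And>p. l2_inner \<nu> (g p) (g p) \<le> C\<^sup>2"
      and gl: "\<And>h. h \<in> L2 \<nu> \<Longrightarrow> ((\<lambda>p. l2_inner \<nu> (g p) h) \<longlongrightarrow> l2_inner \<nu> l h) F" for g
  proof -
    have l': "AE x in \<nu>. 0 \<le> l x" using l(2) by simp
    have single: "((\<lambda>p. measure (P (g p)) E) \<longlongrightarrow> measure (P l) E) F" if "E \<in> sets (poisson_law \<nu>)" for E
      unfolding P_def using that
      by (intro poisson_law_setwise_limit[OF g l(1) l' C(2,1)] gl L2_indicator) auto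
    have multi: "((\<lambda>p. measure (PiM {1..n} (\<lambda>_. P (g p))) E) \<longlongrightarrow> measure (PiM {1..n} (\<lambda>_. P l)) E) F"
      if "E \<in> sets ?Q" for E
      by (rule setwise_limit_PiM[OF _ prob_space_poisson_law _ sd[OF g] sd[OF l(1) l' C(2)] single that]) auto
    have sdn: "square_dominated (exp (C\<^sup>2 + measure \<nu> (space \<nu>)) ^ card {1..n}) ?Q (PiM {1..n} (\<lambda>_. P f))"
      if "f \<in> L2 \<nu>" "AE x in \<nu>. 0 \<le> f x" "l2_inner \<nu> f f \<le> C\<^sup>2" for f
      by (rule square_dominated_PiM[OF _ sd[OF that] prob_space_poisson_law]) auto
    show ?thesis
      unfolding e_def using sdn[OF g] sdn[OF l(1) l' C(2)] multi K'
      by (intro setwise_limit_integral[where Q = ?Q]) (auto simp: square_dominated_def)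
  qed
  have "((\<lambda>p. e (u p)) \<longlongrightarrow> e l) F"
    using \<Theta>0(1)[OF u] C(3) u by (intro lim ul) auto
  moreover have "((\<lambda>p. e (v p)) \<longlongrightarrow> e l) F"
    using \<Theta>1(1)[OF v] C(3) v by (intro lim vl) auto
  ultimately have "((\<lambda>p. e (u p) + (1 - e (v p))) \<longlongrightarrow> e l + (1 - e l)) F"
    by (intro tendsto_intros)
  then have "((\<lambda>p. ennreal (e (u p) + (1 - e (v p)))) \<longlongrightarrow> ennreal (e l + (1 - e l))) F"
    by (rule tendsto_ennrealI)
  then have to1: "((\<lambda>p. ennreal (e (u p) + (1 - e (v p)))) \<longlongrightarrow> 1) F" by simp
  have le: "ennreal (e (u p) + (1 - e (v p))) \<le> test_alpha M \<kappa> \<Theta>0 n K + test_beta M \<kappa> \<Theta>1 n K" for p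
  proof -
    have "ennreal (e (u p)) \<le> test_alpha M \<kappa> \<Theta>0 n K"
      unfolding test_alpha_def e_def P_def using \<Theta>0(1)[OF u, of p] n K u[of p]
      by (subst nn_integral_test(1)[OF _ _ \<nu> n K, symmetric]) (auto intro: SUP_upper)
    moreover have "ennreal (1 - e (v p)) \<le> test_beta M \<kappa> \<Theta>1 n K"
      unfolding test_beta_def e_def P_def using \<Theta>1(1)[OF v, of p] n K v[of p]
      by (subst nn_integral_test(2)[OF _ _ \<nu> n K, symmetric]) (auto intro: SUP_upper)
    moreover have "ennreal (a + b) \<le> ennreal a + ennreal b" for a b
      by (cases "0 \<le> a"; cases "0 \<le> b") (auto simp: ennreal_neg ennreal_leI simp flip: ennreal_plus)
    ultimately show ?thesis by (meson add_mono order_trans)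
  qed
  show "1 \<le> test_alpha M \<kappa> \<Theta>0 n K + test_beta M \<kappa> \<Theta>1 n K"
    using tendsto_upperbound[OF to1 _ F] le by simp
qed

section \<open>Projections onto subspaces\<close>

lemma l2_subspaceD:
  assumes "l2_subspace M S"
  shows "S \<subseteq> L2 M" "(\<lambda>_. 0) \<in> S" "\<And>f g. f \<in> S \<Longrightarrow> g \<in> S \<Longrightarrow> (\<lambda>x. f x + g x) \<in> S"
    "\<And>c f. f \<in> S \<Longrightarrow> (\<lambda>x. c * f x) \<in> S"
    "\<And>f g. f \<in> S \<Longrightarrow> g \<in> L2 M \<Longrightarrow> AE x in M. f x = g x \<Longrightarrow> g \<in> S"
  using assms unfolding l2_subspace_def by simp_all

text \<open>
  Take \<open>h'\<close> such that its squared distance from \<open>h\<close> exceeds the infimum over \<open>S\<close> by less than \<open>\<delta>\<close>.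
\<close>

lemma approximate_projection:
  assumes S: "l2_subspace M S" and h: "h \<in> L2 M" and "\<delta> > 0"
  obtains h' where "h' \<in> S"
    "\<And>g. g \<in> S \<Longrightarrow> (l2_inner M (\<lambda>x. h x - h' x) g)\<^sup>2 \<le> \<delta> * l2_inner M g g"
proof -
  note SL = l2_subspaceD(1)[OF S] and S0 = l2_subspaceD(2)[OF S] and add = l2_subspaceD(3)[OF S]
    and cmult = l2_subspaceD(4)[OF S]
  define d where "d f = l2_inner M (\<lambda>x. h x - f x) (\<lambda>x. h x - f x)" for f
  have bdd: "bdd_below (d ` S)" by (intro bdd_belowI[of _ 0]) (auto simp: d_def l2_inner_self_nonneg)
  have "Inf (d ` S) < Inf (d ` S) + \<delta>" using \<open>\<delta> > 0\<close> by simp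
  then obtain h' where h': "h' \<in> S" "d h' < Inf (d ` S) + \<delta>"
    using S0 bdd cInf_less_iff[of "d ` S"] by blast
  show ?thesis
  proof (rule that[OF h'(1)])
    fix g assume g: "g \<in> S"
    show "(l2_inner M (\<lambda>x. h x - h' x) g)\<^sup>2 \<le> \<delta> * l2_inner M g g"
    proof (rule l2_inner_square_le_gap)
      show "(\<lambda>x. h x - h' x) \<in> L2 M" "g \<in> L2 M" using h h'(1) g SL by (auto intro: L2_diff)
      fix t
      have "(\<lambda>x. h' x + t * g x) \<in> S" using h'(1) g by (intro add cmult)
      then have "Inf (d ` S) \<le> d (\<lambda>x. h' x + t * g x)" using bdd by (intro cInf_lower) auto
      then have "d h' - \<delta> \<le> d (\<lambda>x. h' x + t * g x)" using h'(2) by linarith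
      then show "l2_inner M (\<lambda>x. h x - h' x) (\<lambda>x. h x - h' x) - \<delta>
          \<le> l2_inner M (\<lambda>x. h x - h' x - t * g x) (\<lambda>x. h x - h' x - t * g x)"
        by (simp add: d_def diff_diff_eq)
    qed
  qed
qed

text \<open>
  All functions that agree almost everywhere with a linear combination of \<open>B\<close>, as subspaces consist of all
  representatives.
\<close>

definition l2_span :: "'a measure \<Rightarrow> ('a \<Rightarrow> real) set \<Rightarrow> ('a \<Rightarrow> real) set" where
  "l2_span M B = {f \<in> L2 M. \<exists>c. AE x in M. f x = (\<Sum>b\<in>B. c b * b x)}"

lemma l2_spanI:
  assumes "f \<in> L2 M" "AE x in M. f x = (\<Sum>b\<in>B. c b * b x)"
  shows "f \<in> l2_span M B"
  unfolding l2_span_def mem_Collect_eq using assms by (intro conjI exI[of _ c])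

lemma l2_spanE:
  assumes "f \<in> l2_span M B"
  obtains c where "f \<in> L2 M" "AE x in M. f x = (\<Sum>b\<in>B. c b * b x)"
  using assms unfolding l2_span_def mem_Collect_eq by (elim conjE exE)

lemma l2_span_superset:
  assumes "finite B" "B \<subseteq> L2 M" shows "B \<subseteq> l2_span M B"
proof
  fix b assume b: "b \<in> B"
  have "b x = (\<Sum>b'\<in>B. (if b' = b then 1 else 0) * b' x)" for x
    using assms(1) b by (subst sum.remove[of _ b]) auto
  then have "AE x in M. b x = (\<Sum>b'\<in>B. (if b' = b then 1 else 0) * b' x)" by (intro AE_I2)
  with b assms(2) show "b \<in> l2_span M B" by (intro l2_spanI[where c = "\<lambda>b'. if b' = b then 1 else 0"]) auto
qed

lemma l2_subspace_span: "l2_subspace M (l2_span M B)"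
  unfolding l2_subspace_def
proof (intro conjI ballI allI impI)
  show "l2_span M B \<subseteq> L2 M" by (auto simp: l2_span_def)
  show "(\<lambda>_. 0) \<in> l2_span M B" by (rule l2_spanI[where c = "\<lambda>_. 0"]) (simp_all add: L2_zero)
next
  fix f g assume fg: "f \<in> l2_span M B" "g \<in> l2_span M B"
  obtain c where c: "f \<in> L2 M" "AE x in M. f x = (\<Sum>b\<in>B. c b * b x)" using fg(1) by (rule l2_spanE)
  obtain d where d: "g \<in> L2 M" "AE x in M. g x = (\<Sum>b\<in>B. d b * b x)" using fg(2) by (rule l2_spanE)
  have "AE x in M. f x + g x = (\<Sum>b\<in>B. (c b + d b) * b x)"
    using c(2) d(2) by eventually_elim (simp add: distrib_right sum.distrib)
  with L2_add[OF c(1) d(1)] show "(\<lambda>x. f x + g x) \<in> l2_span M B"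
    by (rule l2_spanI[where c = "\<lambda>b. c b + d b"])
next
  fix a f assume "f \<in> l2_span M B"
  then obtain c where c: "f \<in> L2 M" "AE x in M. f x = (\<Sum>b\<in>B. c b * b x)"
    by (rule l2_spanE)
  have "AE x in M. a * f x = (\<Sum>b\<in>B. (a * c b) * b x)"
    using c(2) by eventually_elim (simp add: sum_distrib_left mult.assoc)
  with L2_cmult[OF c(1)] show "(\<lambda>x. a * f x) \<in> l2_span M B"
    by (rule l2_spanI[where c = "\<lambda>b. a * c b"])
next
  fix f g assume f: "f \<in> l2_span M B" and "g \<in> L2 M" and fg: "AE x in M. f x = g x"
  obtain c where c: "AE x in M. f x = (\<Sum>b\<in>B. c b * b x)" using f by (rule l2_spanE)
  have "AE x in M. g x = (\<Sum>b\<in>B. c b * b x)"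
    using c fg by eventually_elim simp
  with \<open>g \<in> L2 M\<close> show "g \<in> l2_span M B" by (rule l2_spanI)
qed

lemma l2_finite_dim_span:
  assumes "finite B" "B \<subseteq> L2 M" shows "l2_finite_dim M (l2_span M B)"
  unfolding l2_finite_dim_def
proof (intro exI[of _ B] conjI ballI)
  fix f assume "f \<in> l2_span M B"
  then show "\<exists>c. AE x in M. f x = (\<Sum>b\<in>B. c b * b x)" by (rule l2_spanE) (rule exI)
qed (use assms l2_span_superset[OF assms] in simp_all)

lemma l2_subspace_sum:
  assumes S: "l2_subspace M S" and "\<And>b. b \<in> B \<Longrightarrow> b \<in> S"
  shows "(\<lambda>x. \<Sum>b\<in>B. c b * b x) \<in> S"
  using assms(2)
proof (induction B rule: infinite_finite_induct)
  case (insert b B)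
  then have "(\<lambda>x. c b * b x + (\<Sum>b\<in>B. c b * b x)) \<in> S"
    by (intro l2_subspaceD(3,4)[OF S]) simp_all
  with insert.hyps show ?case by simp
qed (simp_all add: l2_subspaceD(2)[OF S])

lemma l2_span_minimal:
  assumes S: "l2_subspace M S" and B: "B \<subseteq> S"
  shows "l2_span M B \<subseteq> S"
proof
  fix f assume "f \<in> l2_span M B"
  then obtain c where f: "f \<in> L2 M" and c: "AE x in M. f x = (\<Sum>b\<in>B. c b * b x)"
    by (rule l2_spanE)
  have "(\<lambda>x. \<Sum>b\<in>B. c b * b x) \<in> S" using B by (rule l2_subspace_sum[OF S subsetD])
  moreover have "AE x in M. (\<Sum>b\<in>B. c b * b x) = f x" using c by eventually_elim simp
  ultimately show "f \<in> S" by (rule l2_subspaceD(5)[OF S _ f])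
qed

lemma l2_closureD:
  assumes "f \<in> l2_closure M S" "finite H" "H \<subseteq> L2 M" "\<epsilon> > 0"
  shows "\<exists>g\<in>S. \<forall>h\<in>H. \<bar>l2_inner M (\<lambda>x. f x - g x) h\<bar> < \<epsilon>"
  using assms unfolding l2_closure_def by simp

text \<open>
  An indicator need not lie in \<open>\<Theta>\<close>, but on bounded subsets of \<open>\<Theta>\<close> its approximate projection
  \<open>h A\<close> onto \<open>\<Theta>\<close> has nearly the same inner products. The hypothesis, applied to the span of the functions
  \<open>h A\<close>, gives points of both closures with the same inner products with all of them, and these points are
  weakly approximated by elements of \<open>S\<close> and \<open>T\<close>.
\<close>

lemma (in finite_measure) inseparable_projections_imp_weakly_close:
  assumes \<Theta>: "l2_subspace M \<Theta>" and S: "S \<subseteq> \<Theta>" "l2_bounded M S" and T: "T \<subseteq> \<Theta>" "l2_bounded M T"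
    and insep: "\<not> (\<exists>\<Gamma>. l2_subspace M \<Gamma> \<and> l2_finite_dim M \<Gamma> \<and> \<Gamma> \<subseteq> \<Theta> \<and>
              l2_proj M \<Gamma> (l2_closure M S) \<inter> l2_proj M \<Gamma> (l2_closure M T) = {})"
  shows "\<forall>\<A> \<delta>. finite \<A> \<longrightarrow> \<A> \<subseteq> sets M \<longrightarrow> \<delta> > 0 \<longrightarrow> (\<exists>f\<in>S. \<exists>g\<in>T. \<forall>A\<in>\<A>.
    \<bar>l2_inner M f (indicator A) - l2_inner M g (indicator A)\<bar> < \<delta>)"
proof (intro allI impI)
  fix \<A> and \<delta> :: real assume \<A>: "finite \<A>" "\<A> \<subseteq> sets M" and "\<delta> > 0"
  have \<Theta>L: "\<Theta> \<subseteq> L2 M" using \<Theta> by (simp add: l2_subspace_def)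
  obtain C where "C > 0" and C2: "\<forall>f\<in>S \<union> T. l2_inner M f f \<le> C\<^sup>2"
    by (rule l2_boundedE[OF S(2) T(2)])
  then have C: "C > 0" "\<And>f. f \<in> S \<union> T \<Longrightarrow> l2_inner M f f \<le> C\<^sup>2" by auto
  \<comment> \<open>Replacing indicators will cost \<open>\<delta> / 6\<close> and weak approximation less than \<open>\<delta> / 3\<close>, each of them twice.\<close>
  define \<eta> where "\<eta> = (\<delta> / 6 / C)\<^sup>2"
  have "\<eta> > 0" using \<open>\<delta> > 0\<close> C by (simp add: \<eta>_def)
  have "\<exists>h. h \<in> \<Theta> \<and> (\<forall>g\<in>\<Theta>. (l2_inner M (\<lambda>x. indicator A x - h x) g)\<^sup>2 \<le> \<eta> * l2_inner M g g)"
    if "A \<in> \<A>" for A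
  proof -
    have "indicator A \<in> L2 M" using that \<A> by (intro L2_indicator) auto
    from approximate_projection[OF \<Theta> this \<open>\<eta> > 0\<close>] show ?thesis by metis
  qed
  then obtain h where h: "\<And>A. A \<in> \<A> \<Longrightarrow> h A \<in> \<Theta>"
    "\<And>A g. A \<in> \<A> \<Longrightarrow> g \<in> \<Theta> \<Longrightarrow> (l2_inner M (\<lambda>x. indicator A x - h A x) g)\<^sup>2 \<le> \<eta> * l2_inner M g g"
    by metis
  define B where "B = h ` \<A>"
  have B: "finite B" "B \<subseteq> \<Theta>" "B \<subseteq> L2 M" using \<A> h(1) \<Theta>L by (auto simp: B_def)
  define \<Gamma> where "\<Gamma> = l2_span M B"
  have "l2_subspace M \<Gamma>" "l2_finite_dim M \<Gamma>" "\<Gamma> \<subseteq> \<Theta>" and B\<Gamma>: "B \<subseteq> \<Gamma>"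
    unfolding \<Gamma>_def using l2_subspace_span l2_finite_dim_span[OF B(1,3)] l2_span_minimal[OF \<Theta> B(2)]
      l2_span_superset[OF B(1,3)] by auto
  with insep have "l2_proj M \<Gamma> (l2_closure M S) \<inter> l2_proj M \<Gamma> (l2_closure M T) \<noteq> {}" by blast
  then obtain k where k01: "k \<in> l2_proj M \<Gamma> (l2_closure M S)" "k \<in> l2_proj M \<Gamma> (l2_closure M T)"
    by blast
  from k01(1) obtain f0 where k: "k \<in> \<Gamma>" and f0: "f0 \<in> l2_closure M S"
      "\<forall>b\<in>\<Gamma>. l2_inner M (\<lambda>x. f0 x - k x) b = 0"
    unfolding l2_proj_def mem_Collect_eq by (elim conjE bexE)
  from k01(2) obtain f1 where f1: "f1 \<in> l2_closure M T"
      "\<forall>b\<in>\<Gamma>. l2_inner M (\<lambda>x. f1 x - k x) b = 0"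
    unfolding l2_proj_def mem_Collect_eq by (elim conjE bexE)
  have kL: "k \<in> L2 M" using k by (auto simp: \<Gamma>_def l2_span_def)
  have fL: "f0 \<in> L2 M" "f1 \<in> L2 M" using f0 f1 by (auto simp: l2_closure_def)
  have "\<delta> / 3 > 0" using \<open>\<delta> > 0\<close> by simp
  then have "\<exists>f\<in>S. \<forall>b\<in>B. \<bar>l2_inner M (\<lambda>x. f0 x - f x) b\<bar> < \<delta> / 3"
      "\<exists>g\<in>T. \<forall>b\<in>B. \<bar>l2_inner M (\<lambda>x. f1 x - g x) b\<bar> < \<delta> / 3"
    using l2_closureD[OF f0(1) B(1,3)] l2_closureD[OF f1(1) B(1,3)] by blast+
  then obtain f g where f: "f \<in> S" "\<And>b. b \<in> B \<Longrightarrow> \<bar>l2_inner M (\<lambda>x. f0 x - f x) b\<bar> < \<delta> / 3"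
    and g: "g \<in> T" "\<And>b. b \<in> B \<Longrightarrow> \<bar>l2_inner M (\<lambda>x. f1 x - g x) b\<bar> < \<delta> / 3"
    by metis
  have fgL: "f \<in> L2 M" "g \<in> L2 M" "f \<in> \<Theta>" "g \<in> \<Theta>" using f(1) g(1) S T \<Theta>L by auto
  have "\<bar>l2_inner M f (indicator A) - l2_inner M g (indicator A)\<bar> < \<delta>" if A: "A \<in> \<A>" for A
  proof -
    have b: "h A \<in> B" "h A \<in> L2 M" using A B by (auto simp: B_def)
    have iL: "indicator A \<in> L2 M" using A \<A> by (intro L2_indicator) auto
    have rem: "\<bar>l2_inner M q (indicator A) - l2_inner M q (h A)\<bar> \<le> \<delta> / 6"
      if q: "q \<in> \<Theta>" "l2_inner M q q \<le> C\<^sup>2" for q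
    proof -
      have "q \<in> L2 M" using q \<Theta>L by auto
      then have "(l2_inner M q (indicator A) - l2_inner M q (h A))\<^sup>2
          = (l2_inner M (\<lambda>x. indicator A x - h A x) q)\<^sup>2"
        using b iL by (simp add: l2_inner_diff_left l2_inner_commute[of M q])
      also have "\<dots> \<le> \<eta> * C\<^sup>2"
        using h(2)[OF A q(1)] mult_left_mono[OF q(2), of \<eta>] \<open>\<eta> > 0\<close> by linarith
      also have "\<dots> = (\<delta> / 6)\<^sup>2" using C(1) by (simp add: \<eta>_def power_divide)
      finally have "\<bar>l2_inner M q (indicator A) - l2_inner M q (h A)\<bar> \<le> \<bar>\<delta> / 6\<bar>"
        by (simp only: abs_le_square_iff)
      then show ?thesis using \<open>\<delta> > 0\<close> by simp
    qed
    have 1: "l2_inner M f0 (h A) = l2_inner M k (h A)" "l2_inner M f1 (h A) = l2_inner M k (h A)"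
      using bspec[OF f0(2) subsetD[OF B\<Gamma> b(1)]] bspec[OF f1(2) subsetD[OF B\<Gamma> b(1)]] fL kL b(2) by (simp_all add: l2_inner_diff_left)
    have 2: "\<bar>l2_inner M f0 (h A) - l2_inner M f (h A)\<bar> < \<delta> / 3"
        "\<bar>l2_inner M f1 (h A) - l2_inner M g (h A)\<bar> < \<delta> / 3"
      using f(2)[OF b(1)] g(2)[OF b(1)] fL fgL b(2) by (simp_all add: l2_inner_diff_left)
    have 3: "\<bar>l2_inner M f (indicator A) - l2_inner M f (h A)\<bar> \<le> \<delta> / 6"
        "\<bar>l2_inner M g (indicator A) - l2_inner M g (h A)\<bar> \<le> \<delta> / 6"
      using rem[OF fgL(3) C(2)] rem[OF fgL(4) C(2)] f(1) g(1) by blast+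
    from 1 2 3 show ?thesis by linarith
  qed
  with f(1) g(1) show "\<exists>f\<in>S. \<exists>g\<in>T. \<forall>A\<in>\<A>.
      \<bar>l2_inner M f (indicator A) - l2_inner M g (indicator A)\<bar> < \<delta>" by blast
qed

lemma weak_limit_in_l2_closure:
  assumes F: "F \<noteq> bot" and u: "\<And>p. u p \<in> S" "S \<subseteq> L2 M" and l: "l \<in> L2 M"
    and lim: "\<And>h. h \<in> L2 M \<Longrightarrow> ((\<lambda>p. l2_inner M (u p) h) \<longlongrightarrow> l2_inner M l h) F"
  shows "l \<in> l2_closure M S"
  unfolding l2_closure_def
proof (intro CollectI conjI allI impI l)
  fix H and \<epsilon> :: real assume H: "finite H" "H \<subseteq> L2 M" and "\<epsilon> > 0"
  have "\<forall>\<^sub>F p in F. \<bar>l2_inner M (u p) h - l2_inner M l h\<bar> < \<epsilon>" if "h \<in> H" for h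
    using tendstoD[OF lim \<open>\<epsilon> > 0\<close>, of h] that H(2) by (auto simp: dist_real_def)
  then have "\<forall>\<^sub>F p in F. \<forall>h\<in>H. \<bar>l2_inner M (u p) h - l2_inner M l h\<bar> < \<epsilon>"
    using H(1) by (intro eventually_ball_finite) auto
  then obtain p where p: "\<And>h. h \<in> H \<Longrightarrow> \<bar>l2_inner M (u p) h - l2_inner M l h\<bar> < \<epsilon>"
    using eventually_happens'[OF F] by blast
  have "\<bar>l2_inner M (\<lambda>x. l x - u p x) h\<bar> < \<epsilon>" if "h \<in> H" for h
  proof -
    have "h \<in> L2 M" "u p \<in> L2 M" using that H u by auto
    then show ?thesis using p[OF that] l by (simp add: l2_inner_diff_left abs_minus_commute)
  qed
  with u(1) show "\<exists>g\<in>S. \<forall>h\<in>H. \<bar>l2_inner M (\<lambda>x. l x - g x) h\<bar> < \<epsilon>" by blast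
qed

text \<open>
  Gram-Schmidt: with \<open>p\<close> and \<open>r\<close> the components of \<open>f\<close> and \<open>b\<close> orthogonal to \<open>B\<close>, the vector
  \<open>q = p - t r\<close> is orthogonal to \<open>B\<close> and to \<open>r\<close>.
\<close>

lemma finite_projection_exists:
  assumes "finite B" "B \<subseteq> L2 M" "f \<in> L2 M"
  shows "\<exists>c. \<forall>b\<in>B. l2_inner M (\<lambda>x. f x - (\<Sum>b\<in>B. c b * b x)) b = 0"
  using assms
proof (induction B arbitrary: f)
  case (insert b B)
  define comb where "comb c = (\<lambda>x. \<Sum>b\<in>B. c b * b x)" for c :: "('a \<Rightarrow> real) \<Rightarrow> real"
  have BL: "B \<subseteq> L2 M" "b \<in> L2 M" using insert.prems by auto
  have combL: "comb c \<in> L2 M" for c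
    unfolding comb_def using BL by (intro L2_sum L2_cmult) auto
  have orth: "l2_inner M q (comb c) = 0" if "q \<in> L2 M" "\<And>b. b \<in> B \<Longrightarrow> l2_inner M q b = 0" for q c
    unfolding comb_def using that BL
    by (subst l2_inner_sum_right) (auto intro: L2_cmult simp: l2_inner_cmult_right)
  obtain c where c: "\<And>a. a \<in> B \<Longrightarrow> l2_inner M (\<lambda>x. f x - comb c x) a = 0"
    using insert.IH[OF BL(1) insert.prems(2)] unfolding comb_def by blast
  obtain d where d: "\<And>a. a \<in> B \<Longrightarrow> l2_inner M (\<lambda>x. b x - comb d x) a = 0"
    using insert.IH[OF BL(1,2)] unfolding comb_def by blast
  define p r where "p = (\<lambda>x. f x - comb c x)" and "r = (\<lambda>x. b x - comb d x)"
  have pr: "p \<in> L2 M" "r \<in> L2 M"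
    unfolding p_def r_def using insert.prems BL combL by (auto intro: L2_diff)
  \<comment> \<open>If \<open>b\<close> depends linearly on \<open>B\<close>, then \<open>r\<close> vanishes a.e. and \<open>t = 0\<close> by the convention for division.\<close>
  define t where "t = l2_inner M p r / l2_inner M r r"
  define q where "q = (\<lambda>x. p x - t * r x)"
  have q: "q \<in> L2 M" unfolding q_def using pr by (intro L2_diff L2_cmult)
  have qB: "l2_inner M q a = 0" if "a \<in> B" for a
    unfolding q_def using that BL pr c[OF that] d[OF that]
    by (subst l2_inner_diff_left) (auto intro: L2_cmult simp: l2_inner_cmult_left simp flip: p_def r_def)
  have "l2_inner M q r = l2_inner M p r - t * l2_inner M r r"
    unfolding q_def using pr by (simp add: l2_inner_diff_left l2_inner_cmult_left L2_cmult)
  also have "\<dots> = 0"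
    using l2_Cauchy_Schwarz[OF pr] by (cases "l2_inner M r r = 0") (auto simp: t_def)
  finally have "l2_inner M q r = 0" .
  then have "l2_inner M q b = 0"
    using orth[OF q qB, of d] q BL combL unfolding r_def by (simp add: l2_inner_diff_right)
  with qB have qall: "\<forall>a\<in>insert b B. l2_inner M q a = 0" by simp
  define c' where "c' a = (if a = b then t else c a - t * d a)" for a
  have "q x = f x - (\<Sum>a\<in>insert b B. c' a * a x)" for x
  proof -
    have "(\<Sum>a\<in>B. c' a * a x) = (\<Sum>a\<in>B. (c a - t * d a) * a x)"
      using insert.hyps by (intro sum.cong) (auto simp: c'_def)
    also have "\<dots> = comb c x - t * comb d x"
      by (simp add: comb_def left_diff_distrib sum_subtractf sum_distrib_left mult.assoc)
    finally show ?thesis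
      using insert.hyps by (simp add: c'_def q_def p_def r_def algebra_simps)
  qed
  then have "q = (\<lambda>x. f x - (\<Sum>a\<in>insert b B. c' a * a x))" by (rule ext)
  with qall show ?case by auto
qed simp

text \<open>
  The projection of the common point onto \<open>\<Gamma>\<close> belongs to both sets.
\<close>

lemma common_point_imp_projections_meet:
  assumes \<Gamma>: "l2_subspace M \<Gamma>" "l2_finite_dim M \<Gamma>"
    and f: "f \<in> l2_closure M S" "f \<in> l2_closure M T"
  shows "l2_proj M \<Gamma> (l2_closure M S) \<inter> l2_proj M \<Gamma> (l2_closure M T) \<noteq> {}"
proof -
  obtain B where B: "finite B" "B \<subseteq> \<Gamma>" "\<And>g. g \<in> \<Gamma> \<Longrightarrow> \<exists>c. AE x in M. g x = (\<Sum>b\<in>B. c b * b x)"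
    using \<Gamma>(2) unfolding l2_finite_dim_def by blast
  have \<Gamma>L: "\<Gamma> \<subseteq> L2 M" using \<Gamma>(1) by (simp add: l2_subspace_def)
  have fL: "f \<in> L2 M" using f(1) by (simp add: l2_closure_def)
  have BL: "B \<subseteq> L2 M" using B \<Gamma>L by blast
  obtain c where c: "\<And>b. b \<in> B \<Longrightarrow> l2_inner M (\<lambda>x. f x - (\<Sum>b\<in>B. c b * b x)) b = 0"
    using finite_projection_exists[OF B(1) BL fL] by blast
  define g where "g = (\<lambda>x. \<Sum>b\<in>B. c b * b x)"
  have g: "g \<in> \<Gamma>" unfolding g_def using B by (intro l2_subspace_sum[OF \<Gamma>(1)]) auto
  have fg: "(\<lambda>x. f x - g x) \<in> L2 M" using g \<Gamma>L fL by (intro L2_diff) auto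
  have orth: "l2_inner M (\<lambda>x. f x - g x) h = 0" if h: "h \<in> \<Gamma>" for h
  proof -
    obtain d where d: "AE x in M. h x = (\<Sum>b\<in>B. d b * b x)" using B(3)[OF h] by blast
    have sL: "(\<lambda>x. \<Sum>b\<in>B. d b * b x) \<in> L2 M" using BL by (intro L2_sum L2_cmult) auto
    have meas: "(\<lambda>x. (f x - g x) * k x) \<in> borel_measurable M" if "k \<in> L2 M" for k
      by (rule borel_measurable_times[OF L2_measurable[OF fg] L2_measurable[OF that]])
    have "l2_inner M (\<lambda>x. f x - g x) h = l2_inner M (\<lambda>x. f x - g x) (\<lambda>x. \<Sum>b\<in>B. d b * b x)"
      unfolding l2_inner_def
    proof (rule integral_cong_AE[OF meas meas])
      show "h \<in> L2 M" using h \<Gamma>L by blast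
      show "AE x in M. (f x - g x) * h x = (f x - g x) * (\<Sum>b\<in>B. d b * b x)"
        using d by eventually_elim simp
    qed (rule sL)
    also have "\<dots> = (\<Sum>b\<in>B. d b * l2_inner M (\<lambda>x. f x - g x) b)"
      using BL fg by (subst l2_inner_sum_right) (auto intro: L2_cmult simp: l2_inner_cmult_right)
    also have "\<dots> = 0" using c by (simp add: g_def)
    finally show ?thesis .
  qed
  have "g \<in> l2_proj M \<Gamma> \<Psi>" if "f \<in> \<Psi>" for \<Psi>
    unfolding l2_proj_def mem_Collect_eq by (intro conjI bexI[of _ f] ballI g that orth)
  with f show ?thesis by blast
qed

section \<open>Tests based on average counts\<close>

lemma (in prob_space) expectation_square_sum_indep:
  fixes Y :: "'i \<Rightarrow> 'a \<Rightarrow> real"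
  assumes "finite I" "indep_vars (\<lambda>_. borel) Y I"
    and "\<And>i. i \<in> I \<Longrightarrow> integrable M (\<lambda>\<omega>. (Y i \<omega>)\<^sup>2)" "\<And>i. i \<in> I \<Longrightarrow> integrable M (Y i)"
    and "\<And>i. i \<in> I \<Longrightarrow> expectation (Y i) = 0"
  shows "integrable M (\<lambda>\<omega>. (\<Sum>i\<in>I. Y i \<omega>)\<^sup>2) \<and>
    expectation (\<lambda>\<omega>. (\<Sum>i\<in>I. Y i \<omega>)\<^sup>2) = (\<Sum>i\<in>I. expectation (\<lambda>\<omega>. (Y i \<omega>)\<^sup>2))"
  using assms
proof (induction I)
  case (insert i I)
  define S where "S \<omega> = (\<Sum>i\<in>I. Y i \<omega>)" for \<omega>
  have "indep_vars (\<lambda>_. borel) Y I" using insert.prems(1) by (rule indep_vars_subset) auto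
  with insert have IH: "integrable M (\<lambda>\<omega>. (S \<omega>)\<^sup>2)"
      "expectation (\<lambda>\<omega>. (S \<omega>)\<^sup>2) = (\<Sum>i\<in>I. expectation (\<lambda>\<omega>. (Y i \<omega>)\<^sup>2))"
    by (auto simp: S_def)
  have S: "integrable M S" "expectation S = 0"
    using insert.prems unfolding S_def by (auto simp: Bochner_Integration.integral_sum)
  have indep: "indep_var borel (Y i) borel S"
    using indep_vars_sum[OF insert.hyps insert.prems(1)] by (simp add: S_def[abs_def])
  have prod: "integrable M (\<lambda>\<omega>. Y i \<omega> * S \<omega>)" "expectation (\<lambda>\<omega>. Y i \<omega> * S \<omega>) = 0"
    using insert.prems S indep_var_integrable[OF indep] indep_var_lebesgue_integral[OF indep] by auto
  have eq: "(\<Sum>i\<in>insert i I. Y i \<omega>)\<^sup>2 = (Y i \<omega>)\<^sup>2 + (S \<omega>)\<^sup>2 + 2 * (Y i \<omega> * S \<omega>)" for \<omega>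
    using insert.hyps by (simp add: S_def power2_sum)
  show ?case unfolding eq using insert.hyps insert.prems(2) IH prod by simp
qed simp

text \<open>
  With \<open>p\<close> for the Poisson weights, \<open>(k + 1) p (k + 1) = w p k\<close>; so every factorial moment arises from
  the preceding one by a shift of the index.
\<close>

lemma poisson_weight_sums:
  fixes w :: real
  shows "(\<lambda>k. w ^ k / fact k * exp (- w)) sums 1"
    and "(\<lambda>k. real k * (w ^ k / fact k * exp (- w))) sums w"
    and "(\<lambda>k. real k * (real k - 1) * (w ^ k / fact k * exp (- w))) sums w\<^sup>2"
proof -
  define p where "p k = w ^ k / fact k * exp (- w)" for k
  have "(\<lambda>k. w ^ k / fact k) sums exp w"
    using exp_converges[of w] by (simp add: scaleR_conv_of_real divide_inverse mult.commute)
  from sums_mult2[OF this, of "exp (- w)"] have p: "p sums 1"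
    by (simp add: p_def[abs_def] flip: exp_add)
  have Suc: "real (Suc k) * p (Suc k) = w * p k" for k
    by (simp add: p_def divide_simps)
  have "(\<lambda>k. real (Suc k) * p (Suc k)) sums w"
    unfolding Suc using sums_mult[OF p, of w] by simp
  then have 1: "(\<lambda>k. real k * p k) sums w"
    by (subst (asm) sums_Suc_iff) simp
  have Suc2: "real (Suc k) * (real (Suc k) - 1) * p (Suc k) = w * (real k * p k)" for k
    using Suc[of k] by (simp add: mult.left_commute mult.commute)
  have "(\<lambda>k. real (Suc k) * (real (Suc k) - 1) * p (Suc k)) sums (w * w)"
    unfolding Suc2 using 1 by (rule sums_mult)
  then have 2: "(\<lambda>k. real k * (real k - 1) * p k) sums w\<^sup>2"
    by (subst (asm) sums_Suc_iff) (simp add: power2_eq_square)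
  show "(\<lambda>k. w ^ k / fact k * exp (- w)) sums 1" using p by (simp add: p_def[abs_def])
  show "(\<lambda>k. real k * (w ^ k / fact k * exp (- w))) sums w" using 1 by (simp add: p_def)
  show "(\<lambda>k. real k * (real k - 1) * (w ^ k / fact k * exp (- w))) sums w\<^sup>2" using 2 by (simp add: p_def)
qed

lemma (in prob_space) poisson_count_moments:
  fixes Z :: "'a \<Rightarrow> nat"
  assumes Z[measurable]: "Z \<in> measurable M (count_space UNIV)" and w: "w \<ge> 0"
    and pois: "\<And>k. prob {\<omega> \<in> space M. Z \<omega> = k} = w ^ k / fact k * exp (- w)"
  shows "integrable M (\<lambda>\<omega>. real (Z \<omega>) - w)" "expectation (\<lambda>\<omega>. real (Z \<omega>) - w) = 0"
    and "integrable M (\<lambda>\<omega>. (real (Z \<omega>) - w)\<^sup>2)" "expectation (\<lambda>\<omega>. (real (Z \<omega>) - w)\<^sup>2) = w"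
proof -
  define p where "p k = w ^ k / fact k * exp (- w)" for k
  have p0: "p k \<ge> 0" for k using w by (simp add: p_def)
  let ?d = "density (count_space UNIV) (\<lambda>k. ennreal (p k))"
  have d: "distr M (count_space UNIV) Z = ?d"
  proof (rule measure_eqI_countable[where A = UNIV])
    fix k
    have "emeasure (distr M (count_space UNIV) Z) {k} = emeasure M {\<omega> \<in> space M. Z \<omega> = k}"
      by (subst emeasure_distr) (auto intro: arg_cong[where f = "emeasure M"])
    also have "\<dots> = ennreal (p k)" by (simp add: emeasure_eq_measure pois p_def)
    also have "\<dots> = emeasure ?d {k}"
      by (subst emeasure_density) (auto simp: nn_integral_indicator_singleton)
    finally show "emeasure (distr M (count_space UNIV) Z) {k} = emeasure ?d {k}" .
  qed auto
  have moment: "integrable M (\<lambda>\<omega>. g (Z \<omega>)) \<and> expectation (\<lambda>\<omega>. g (Z \<omega>)) = s"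
    if g: "(\<lambda>k. p k * g k) sums s" "summable (\<lambda>k. \<bar>p k * g k\<bar>)" for g :: "nat \<Rightarrow> real" and s
  proof -
    have int: "integrable (count_space UNIV) (\<lambda>k. p k * g k)"
      using g(2) by (simp add: integrable_count_space_nat_iff)
    have "integrable (distr M (count_space UNIV) Z) g"
      unfolding d using int p0 by (subst integrable_density) auto
    moreover have "integral\<^sup>L (distr M (count_space UNIV) Z) g = s"
      unfolding d using int p0 sums_unique[OF g(1)]
      by (subst integral_density) (auto simp: integral_count_space_nat)
    ultimately show ?thesis
      by (simp add: integrable_distr_eq integral_distr)
  qed
  note sums = poisson_weight_sums[of w, folded p_def]
  have sq: "(\<lambda>k. p k * (real k - w)\<^sup>2) sums w"
  proof -
    have "(\<lambda>k. real k * (real k - 1) * p k + (1 - 2 * w) * (real k * p k) + w\<^sup>2 * p k)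
        sums (w\<^sup>2 + (1 - 2 * w) * w + w\<^sup>2 * 1)"
      by (intro sums_add sums_mult sums)
    moreover have "real k * (real k - 1) * p k + (1 - 2 * w) * (real k * p k) + w\<^sup>2 * p k
        = p k * (real k - w)\<^sup>2" for k
      by (simp add: power2_eq_square algebra_simps)
    moreover have "w\<^sup>2 + (1 - 2 * w) * w + w\<^sup>2 * 1 = w" by (simp add: power2_eq_square algebra_simps)
    ultimately show ?thesis by simp
  qed
  have lin: "(\<lambda>k. p k * (real k - w)) sums 0"
    using sums_diff[OF sums(2) sums_mult[OF sums(1), of w]] by (simp add: algebra_simps)
  have abs_lin: "summable (\<lambda>k. \<bar>p k * (real k - w)\<bar>)"
  proof (rule summable_comparison_test'[where N = 0])
    show "summable (\<lambda>k. real k * p k + w * p k)"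
      using sums by (intro summable_add summable_mult) (auto simp: sums_iff)
    show "norm \<bar>p k * (real k - w)\<bar> \<le> real k * p k + w * p k" for k
    proof -
      have "\<bar>real k - w\<bar> \<le> real k + w" using w by linarith
      have "norm \<bar>p k * (real k - w)\<bar> = p k * \<bar>real k - w\<bar>" by (simp add: abs_mult p0)
      also have "\<dots> \<le> p k * (real k + w)"
        using \<open>\<bar>real k - w\<bar> \<le> real k + w\<close> p0[of k] by (rule mult_left_mono)
      finally show ?thesis by (simp add: algebra_simps)
    qed
  qed
  have "summable (\<lambda>k. \<bar>p k * (real k - w)\<^sup>2\<bar>)" using sq p0 by (simp add: abs_mult sums_iff)
  with moment[OF sq] show "integrable M (\<lambda>\<omega>. (real (Z \<omega>) - w)\<^sup>2)" "expectation (\<lambda>\<omega>. (real (Z \<omega>) - w)\<^sup>2) = w"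
    by auto
  show "integrable M (\<lambda>\<omega>. real (Z \<omega>) - w)" "expectation (\<lambda>\<omega>. real (Z \<omega>) - w) = 0"
    using moment[OF lin abs_lin] by auto
qed

text \<open>
  Chebyshev's inequality: the counts \<open>\<kappa> i (A)\<close> are independent with mean and variance
  \<open>\<integral>\<^sub>A l d\<nu>\<close>.
\<close>

lemma count_average_deviation:
  assumes M: "poisson_sample \<nu> M \<kappa> l" and l: "l \<in> L2 \<nu>" "AE x in \<nu>. 0 \<le> l x"
    and \<nu>: "finite_measure \<nu>" and n: "n \<ge> 1" and A: "A \<in> sets \<nu>" and "a > 0"
  shows "measure (M l) {\<omega> \<in> space (M l). a \<le>
      \<bar>(\<Sum>i=1..n. enn2real (emeasure (\<kappa> i \<omega>) A)) / real n - l2_inner \<nu> l (indicator A)\<bar>}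
    \<le> l2_inner \<nu> l (indicator A) / (real n * a\<^sup>2)"
proof -
  interpret P: prob_space "M l" using M by (simp add: poisson_sample_def)
  let ?\<mu> = "density \<nu> (\<lambda>x. ennreal (l x))"
  define w where "w = l2_inner \<nu> l (indicator A)"
  have w: "measure ?\<mu> A = w" unfolding w_def by (rule measure_density_eq_l2_inner[OF l \<nu> A])
  then have "w \<ge> 0" by (metis measure_nonneg)
  note rv = distr_poisson_sample(3)[OF M l(1) \<nu> n]
  define Y where "Y i \<omega> = enn2real (emeasure (\<kappa> i \<omega>) A) - w" for i \<omega>
  have Y: "integrable (M l) (Y i)" "P.expectation (Y i) = 0"
      "integrable (M l) (\<lambda>\<omega>. (Y i \<omega>)\<^sup>2)" "P.expectation (\<lambda>\<omega>. (Y i \<omega>)\<^sup>2) = w" if i: "i \<ge> 1" for i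
  proof -
    have [measurable]: "(\<lambda>\<omega>. emeasure (\<kappa> i \<omega>) A) \<in> borel_measurable (M l)"
      by (rule measurable_compose[OF rv[OF i] measurable_emeasure_counting[OF A]])
    \<comment> \<open>The count as a natural number; rounding changes nothing because counts are integers.\<close>
    define Z where "Z \<omega> = nat \<lfloor>enn2real (emeasure (\<kappa> i \<omega>) A)\<rfloor>" for \<omega>
    have Z[measurable]: "Z \<in> measurable (M l) (count_space UNIV)" unfolding Z_def by measurable
    have count: "\<exists>k. emeasure (\<kappa> i \<omega>) A = of_nat k" if "\<omega> \<in> space (M l)" for \<omega>
      using measurable_space[OF rv[OF i] that] A by (auto simp: space_counting_algebra)
    have real_Z: "real (Z \<omega>) = enn2real (emeasure (\<kappa> i \<omega>) A)"
      and Z_eq: "Z \<omega> = k \<longleftrightarrow> emeasure (\<kappa> i \<omega>) A = of_nat k" if \<omega>: "\<omega> \<in> space (M l)" for \<omega> k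
    proof -
      obtain j where j: "emeasure (\<kappa> i \<omega>) A = of_nat j" using count[OF \<omega>] by blast
      then have "Z \<omega> = j" by (simp add: Z_def enn2real_of_nat)
      with j show "real (Z \<omega>) = enn2real (emeasure (\<kappa> i \<omega>) A)" "Z \<omega> = k \<longleftrightarrow> emeasure (\<kappa> i \<omega>) A = of_nat k"
        by (simp_all add: enn2real_of_nat)
    qed
    have "P.prob {\<omega> \<in> space (M l). Z \<omega> = k} = w ^ k / fact k * exp (- w)" for k
    proof -
      have "{\<omega> \<in> space (M l). Z \<omega> = k} = {\<omega> \<in> space (M l). emeasure (\<kappa> i \<omega>) A = of_nat k}"
        using Z_eq by auto
      moreover have "P.prob {\<omega> \<in> space (M l). emeasure (\<kappa> i \<omega>) A = of_nat k}
          = measure ?\<mu> A ^ k / fact k * exp (- measure ?\<mu> A)"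
        using M i A by (simp add: poisson_sample_def poisson_process_def)
      ultimately show ?thesis by (simp add: w)
    qed
    note moments = P.poisson_count_moments[OF Z \<open>w \<ge> 0\<close> this]
    have eq: "\<omega> \<in> space (M l) \<Longrightarrow> Y i \<omega> = real (Z \<omega>) - w" for \<omega> by (simp add: Y_def real_Z)
    show "integrable (M l) (Y i)" using moments(1) Bochner_Integration.integrable_cong[of "M l" "M l" "Y i" "\<lambda>\<omega>. real (Z \<omega>) - w"] eq by simp
    show "P.expectation (Y i) = 0" using moments(2) Bochner_Integration.integral_cong[of "M l" "M l" "Y i" "\<lambda>\<omega>. real (Z \<omega>) - w"] eq by simp
    have eq2: "\<omega> \<in> space (M l) \<Longrightarrow> (Y i \<omega>)\<^sup>2 = (real (Z \<omega>) - w)\<^sup>2" for \<omega> by (simp add: eq)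
    show "integrable (M l) (\<lambda>\<omega>. (Y i \<omega>)\<^sup>2)" using moments(3) Bochner_Integration.integrable_cong[of "M l" "M l" "\<lambda>\<omega>. (Y i \<omega>)\<^sup>2" "\<lambda>\<omega>. (real (Z \<omega>) - w)\<^sup>2"] eq2 by simp
    show "P.expectation (\<lambda>\<omega>. (Y i \<omega>)\<^sup>2) = w" using moments(4) Bochner_Integration.integral_cong[of "M l" "M l" "\<lambda>\<omega>. (Y i \<omega>)\<^sup>2" "\<lambda>\<omega>. (real (Z \<omega>) - w)\<^sup>2"] eq2 by simp
  qed
  have "P.indep_vars (\<lambda>_. counting_algebra \<nu>) \<kappa> {1..}"
    using M by (simp add: poisson_sample_def)
  then have "P.indep_vars (\<lambda>_. counting_algebra \<nu>) \<kappa> {1..n}"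
    by (rule P.indep_vars_subset) auto
  moreover have "(\<lambda>m. enn2real (emeasure m A) - w) \<in> borel_measurable (counting_algebra \<nu>)"
  proof -
    note measurable_emeasure_counting[OF A, measurable]
    show ?thesis by measurable
  qed
  ultimately have "P.indep_vars (\<lambda>_. borel) (\<lambda>i \<omega>. enn2real (emeasure (\<kappa> i \<omega>) A) - w) {1..n}"
    by (rule P.indep_vars_compose2)
  then have indep: "P.indep_vars (\<lambda>_. borel) Y {1..n}" by (simp add: Y_def[abs_def])
  have sum: "integrable (M l) (\<lambda>\<omega>. (\<Sum>i=1..n. Y i \<omega>)\<^sup>2)"
      "P.expectation (\<lambda>\<omega>. (\<Sum>i=1..n. Y i \<omega>)\<^sup>2) = real n * w"
    using P.expectation_square_sum_indep[OF _ indep] Y by auto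
  define S where "S \<omega> = (\<Sum>i=1..n. Y i \<omega>) / real n" for \<omega>
  have S: "integrable (M l) (\<lambda>\<omega>. (S \<omega>)\<^sup>2)" "P.expectation (\<lambda>\<omega>. (S \<omega>)\<^sup>2) = w / real n"
    using sum n by (simp_all add: S_def power_divide power2_eq_square)
  have "S \<in> borel_measurable (M l)"
    unfolding S_def using Y(1) by (intro borel_measurable_divide borel_measurable_sum) auto
  then have "P.prob {\<omega> \<in> space (M l). a \<le> \<bar>S \<omega>\<bar>} \<le> P.expectation (\<lambda>\<omega>. (S \<omega>)\<^sup>2) / a\<^sup>2"
    using S(1) \<open>a > 0\<close> by (intro P.second_moment_method) auto
  moreover have "S \<omega> = (\<Sum>i=1..n. enn2real (emeasure (\<kappa> i \<omega>) A)) / real n - w" for \<omega>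
    using n by (simp add: S_def Y_def sum_subtractf diff_divide_distrib)
  ultimately show ?thesis using S(2) by (simp add: w_def)
qed

definition count_average :: "nat \<Rightarrow> (nat \<Rightarrow> 'a measure) \<Rightarrow> 'a set \<Rightarrow> real" where
  "count_average n k A = (\<Sum>i=1..n. enn2real (emeasure (k i) A)) / real n"

definition proximity_test ::
  "'a measure \<Rightarrow> 'a set set \<Rightarrow> real \<Rightarrow> ('a \<Rightarrow> real) set \<Rightarrow> nat \<Rightarrow> (nat \<Rightarrow> 'a measure) \<Rightarrow> real" where
  "proximity_test \<nu> \<A> a S n k =
     (if \<exists>f\<in>S. \<forall>A\<in>\<A>. \<bar>count_average n k A - l2_inner \<nu> f (indicator A)\<bar> < a then 0 else 1)"

text \<open>
  The acceptance region is a union over the arbitrary set \<open>S\<close>, but it is determined by the vector of total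
  counts in the sets of \<open>\<A>\<close>, which has countably many values.
\<close>

lemma is_test_proximity_test:
  assumes \<A>: "finite \<A>" "\<A> \<subseteq> sets \<nu>"
  shows "is_test \<nu> n (proximity_test \<nu> \<A> a S n)"
proof -
  let ?C = "PiM {1..n} (\<lambda>_. counting_algebra \<nu>)"
  define V where "V = {v \<in> \<A> \<rightarrow>\<^sub>E (UNIV :: nat set).
      \<exists>f\<in>S. \<forall>A\<in>\<A>. \<bar>real (v A) / real n - l2_inner \<nu> f (indicator A)\<bar> < a}"
  have "countable V"
    by (rule countable_subset[OF _ countable_PiE[of \<A> "\<lambda>_. UNIV"]]) (use \<A> in \<open>auto simp: V_def\<close>)
  define W where "W v = {k \<in> space ?C. \<forall>A\<in>\<A>. (\<Sum>i=1..n. enn2real (emeasure (k i) A)) = real (v A)}" for v :: "'a set \<Rightarrow> nat"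
  have W: "W v \<in> sets ?C" for v
    unfolding W_def
  proof (rule sets.sets_Collect_finite_All)
    fix A assume "A \<in> \<A>"
    have [measurable]: "(\<lambda>k. emeasure (k i) A) \<in> borel_measurable ?C" if "i \<in> {1..n}" for i
    proof -
      have "(\<lambda>k. k i) \<in> measurable ?C (counting_algebra \<nu>)"
        using that by (rule measurable_component_singleton)
      moreover have "(\<lambda>m. emeasure m A) \<in> borel_measurable (counting_algebra \<nu>)"
        using \<open>A \<in> \<A>\<close> \<A> by (intro measurable_emeasure_counting) auto
      ultimately show ?thesis by (rule measurable_compose)
    qed
    have "(\<lambda>k. \<Sum>i=1..n. enn2real (emeasure (k i) A)) \<in> borel_measurable ?C"
      by measurable
    then show "{k \<in> space ?C. (\<Sum>i=1..n. enn2real (emeasure (k i) A)) = real (v A)} \<in> sets ?C"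
      by measurable
  qed (use \<A> in auto)
  define acc where "acc k \<longleftrightarrow> (\<exists>f\<in>S. \<forall>A\<in>\<A>. \<bar>count_average n k A - l2_inner \<nu> f (indicator A)\<bar> < a)" for k
  have "{k \<in> space ?C. acc k} = (\<Union>v\<in>V. W v)"
  proof (intro equalityI subsetI)
    fix k assume "k \<in> {k \<in> space ?C. acc k}"
    then have k: "k \<in> space ?C" and acc: "acc k" by auto
    have "\<exists>j. enn2real (emeasure (k i) A) = real j" if iA: "i \<in> {1..n}" "A \<in> \<A>" for i A
    proof -
      have "k i \<in> space (counting_algebra \<nu>)" using k iA by (auto simp: space_PiM)
      moreover have "A \<in> sets \<nu>" using iA \<A> by auto
      ultimately obtain j where "emeasure (k i) A = of_nat j" unfolding space_counting_algebra by blast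
      then show ?thesis by (auto simp: enn2real_of_nat)
    qed
    then obtain c where c: "\<And>i A. i \<in> {1..n} \<Longrightarrow> A \<in> \<A> \<Longrightarrow> enn2real (emeasure (k i) A) = real (c i A)"
      by metis
    define v where "v = restrict (\<lambda>A. \<Sum>i=1..n. c i A) \<A>"
    have v: "(\<Sum>i=1..n. enn2real (emeasure (k i) A)) = real (v A)" if "A \<in> \<A>" for A
      using c that by (simp add: v_def)
    then have "v \<in> V" using acc by (auto simp: V_def acc_def count_average_def v_def)
    moreover have "k \<in> W v" using k v by (simp add: W_def)
    ultimately show "k \<in> (\<Union>v\<in>V. W v)" by blast
  qed (auto simp: V_def W_def acc_def count_average_def, blast)
  then have "{k \<in> space ?C. acc k} \<in> sets ?C"
    using \<open>countable V\<close> W by (simp add: sets.countable_UN'')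
  then have meas: "(\<lambda>k. if acc k then 0 else 1 :: real) \<in> borel_measurable ?C"
    by (intro measurable_If) auto
  have eq: "proximity_test \<nu> \<A> a S n = (\<lambda>k. if acc k then 0 else 1)"
    by (rule ext) (simp only: proximity_test_def acc_def)
  show ?thesis
    unfolding is_test_def eq
  proof (intro conjI ballI)
    fix k
    show "0 \<le> (if acc k then 0 else 1 :: real)" "(if acc k then 0 else 1 :: real) \<le> 1"
      by (cases "acc k"; simp only: if_True if_False order_refl zero_le_one)+
  qed (rule meas)
qed

text \<open>
  One estimate for both kinds of error: \<open>E\<close> will be the test itself if \<open>l\<close> is a hypothesis and one minus
  the test if \<open>l\<close> is an alternative. An error requires that some average count deviates by at least \<open>a\<close>
  from its mean.
\<close>

lemma proximity_test_error:
  assumes \<nu>: "finite_measure \<nu>" and \<A>: "finite \<A>" "\<A> \<subseteq> sets \<nu>" and "a > 0" and n: "n \<ge> 1"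
    and l: "l \<in> L2 \<nu>" "AE x in \<nu>. 0 \<le> l x" "poisson_sample \<nu> M \<kappa> l"
    and L: "\<And>A. A \<in> \<A> \<Longrightarrow> l2_inner \<nu> l (indicator A) \<le> L"
    and err: "\<And>k. \<forall>A\<in>\<A>. \<bar>count_average n k A - l2_inner \<nu> l (indicator A)\<bar> < a \<Longrightarrow> E k = (0::real)"
    and E: "\<And>k. E k \<le> 1"
  shows "(\<integral>\<^sup>+\<omega>. ennreal (E (\<lambda>i\<in>{1..n}. \<kappa> i \<omega>)) \<partial>M l) \<le> ennreal (real (card \<A>) * L / (real n * a\<^sup>2))"
proof -
  interpret P: prob_space "M l" using l(3) by (simp add: poisson_sample_def)
  note rv = distr_poisson_sample(3)[OF l(3,1) \<nu> n]
  define D where "D A = {\<omega> \<in> space (M l). a \<le>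
      \<bar>(\<Sum>i=1..n. enn2real (emeasure (\<kappa> i \<omega>) A)) / real n - l2_inner \<nu> l (indicator A)\<bar>}" for A
  have D: "D A \<in> sets (M l)" if "A \<in> \<A>" for A
  proof -
    have "A \<in> sets \<nu>" using that \<A> by auto
    then have [measurable]: "(\<lambda>\<omega>. emeasure (\<kappa> i \<omega>) A) \<in> borel_measurable (M l)" if "i \<in> {1..n}" for i
      using that by (intro measurable_compose[OF rv measurable_emeasure_counting]) auto
    show ?thesis unfolding D_def by measurable
  qed
  have avg: "count_average n (\<lambda>i\<in>{1..n}. \<kappa> i \<omega>) A = (\<Sum>i=1..n. enn2real (emeasure (\<kappa> i \<omega>) A)) / real n" for \<omega> A
    by (simp add: count_average_def)
  have "(\<integral>\<^sup>+\<omega>. ennreal (E (\<lambda>i\<in>{1..n}. \<kappa> i \<omega>)) \<partial>M l) \<le> (\<integral>\<^sup>+\<omega>. indicator (\<Union>A\<in>\<A>. D A) \<omega> \<partial>M l)"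
  proof (rule nn_integral_mono)
    fix \<omega> assume \<omega>: "\<omega> \<in> space (M l)"
    show "ennreal (E (\<lambda>i\<in>{1..n}. \<kappa> i \<omega>)) \<le> indicator (\<Union>A\<in>\<A>. D A) \<omega>"
    proof (cases "\<omega> \<in> (\<Union>A\<in>\<A>. D A)")
      case True
      then show ?thesis using E by (simp add: ennreal_leI)
    next
      case False
      have "E (\<lambda>i\<in>{1..n}. \<kappa> i \<omega>) = 0"
        by (rule err, unfold avg) (use False \<omega> in \<open>auto simp: D_def not_le\<close>)
      then show ?thesis by simp
    qed
  qed
  also have "\<dots> = ennreal (P.prob (\<Union>A\<in>\<A>. D A))"
  proof -
    have "(\<Union>A\<in>\<A>. D A) \<in> sets (M l)" using D \<A>(1) by (intro sets.finite_UN) auto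
    then show ?thesis by (simp add: P.emeasure_eq_measure)
  qed
  also have "\<dots> \<le> ennreal (\<Sum>A\<in>\<A>. P.prob (D A))"
    using D \<A> by (intro ennreal_leI P.finite_measure_subadditive_finite) auto
  also have "\<dots> \<le> ennreal (\<Sum>A\<in>\<A>. L / (real n * a\<^sup>2))"
  proof (intro ennreal_leI sum_mono)
    fix A assume A: "A \<in> \<A>"
    have "P.prob (D A) \<le> l2_inner \<nu> l (indicator A) / (real n * a\<^sup>2)"
      unfolding D_def using A \<A> by (intro count_average_deviation[OF l(3,1,2) \<nu> n _ \<open>a > 0\<close>]) auto
    also have "\<dots> \<le> L / (real n * a\<^sup>2)" using L[OF A] by (intro divide_right_mono) auto
    finally show "P.prob (D A) \<le> L / (real n * a\<^sup>2)" .
  qed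
  finally show ?thesis by simp
qed

text \<open>
  With the radius \<open>a = \<delta> / 2\<close> average counts cannot be within \<open>a\<close> both of the masses of an \<open>f \<in> \<Theta>\<^sub>0\<close> and of
  those of a \<open>g \<in> \<Theta>\<^sub>1\<close>, so \<open>proximity_test_error\<close> bounds both errors by \<open>\<epsilon> n\<close>, of order \<open>1 / n\<close>.
\<close>

lemma separated_imp_distinguishable:
  assumes \<nu>: "finite_measure \<nu>"
    and \<Theta>0: "\<And>l. l \<in> \<Theta>0 \<Longrightarrow> l \<in> L2 \<nu> \<and> (AE x in \<nu>. 0 \<le> l x) \<and> poisson_sample \<nu> M \<kappa> l" "l2_bounded \<nu> \<Theta>0"
    and \<Theta>1: "\<And>l. l \<in> \<Theta>1 \<Longrightarrow> l \<in> L2 \<nu> \<and> (AE x in \<nu>. 0 \<le> l x) \<and> poisson_sample \<nu> M \<kappa> l" "l2_bounded \<nu> \<Theta>1"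
    and \<A>: "finite \<A>" "\<A> \<subseteq> sets \<nu>" and "\<delta> > 0"
    and sep: "\<And>f g. f \<in> \<Theta>0 \<Longrightarrow> g \<in> \<Theta>1 \<Longrightarrow>
      \<exists>A\<in>\<A>. \<delta> \<le> \<bar>l2_inner \<nu> f (indicator A) - l2_inner \<nu> g (indicator A)\<bar>"
  shows "distinguishable \<nu> M \<kappa> \<Theta>0 \<Theta>1"
  unfolding distinguishable_def
proof (intro allI impI)
  interpret finite_measure \<nu> by fact
  fix \<alpha> :: real assume \<alpha>: "0 < \<alpha>" "\<alpha> < 1"
  obtain C where C: "C > 0" "\<forall>f\<in>\<Theta>0 \<union> \<Theta>1. l2_inner \<nu> f f \<le> C\<^sup>2"
    by (rule l2_boundedE[OF \<Theta>0(2) \<Theta>1(2)])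
  define L where "L = C * sqrt (measure \<nu> (space \<nu>))"
  have L: "l2_inner \<nu> f (indicator A) \<le> L" if f: "f \<in> \<Theta>0 \<union> \<Theta>1" and A: "A \<in> \<A>" for f A
  proof -
    have "l2_inner \<nu> f f \<le> C\<^sup>2" "C \<ge> 0" using C f by auto
    moreover have A': "A \<in> sets \<nu>" "f \<in> L2 \<nu>" using A \<A> f \<Theta>0(1) \<Theta>1(1) by auto
    ultimately have "\<bar>l2_inner \<nu> f (indicator A)\<bar> \<le> C * sqrt (l2_inner \<nu> (indicator A) (indicator A))"
      using l2_Cauchy_Schwarz_bounded[OF A'(2) L2_indicator[OF A'(1)], of C] by blast
    then have "l2_inner \<nu> f (indicator A) \<le> C * sqrt (l2_inner \<nu> (indicator A) (indicator A))"
      by linarith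
    also have "l2_inner \<nu> (indicator A) (indicator A) = measure \<nu> A"
      using A' by (simp add: l2_inner_def flip: indicator_inter_arith)
    also have "C * sqrt (measure \<nu> A) \<le> L"
      unfolding L_def by (intro mult_left_mono real_sqrt_le_mono bounded_measure) (use C in simp)
    finally show ?thesis .
  qed
  define a where "a = \<delta> / 2"
  have "a > 0" using \<open>\<delta> > 0\<close> by (simp add: a_def)
  define \<epsilon> where "\<epsilon> n = real (card \<A>) * L / (real n * a\<^sup>2)" for n :: nat
  let ?T = "proximity_test \<nu> \<A> a \<Theta>0"
  have alpha: "test_alpha M \<kappa> \<Theta>0 n (?T n) \<le> ennreal (\<epsilon> n)" if n: "n \<ge> 1" for n
    unfolding test_alpha_def \<epsilon>_def
  proof (rule SUP_least)
    fix l assume l: "l \<in> \<Theta>0"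
    show "(\<integral>\<^sup>+\<omega>. ennreal (?T n (\<lambda>i\<in>{1..n}. \<kappa> i \<omega>)) \<partial>M l) \<le> ennreal (real (card \<A>) * L / (real n * a\<^sup>2))"
      using \<Theta>0(1)[OF l] l L
      by (intro proximity_test_error[OF \<nu> \<A> \<open>a > 0\<close> n]) (auto simp: proximity_test_def)
  qed
  have beta: "test_beta M \<kappa> \<Theta>1 n (?T n) \<le> ennreal (\<epsilon> n)" if n: "n \<ge> 1" for n
    unfolding test_beta_def \<epsilon>_def
  proof (rule SUP_least)
    fix l assume l: "l \<in> \<Theta>1"
    have "1 - ?T n k = 0" if k: "\<forall>A\<in>\<A>. \<bar>count_average n k A - l2_inner \<nu> l (indicator A)\<bar> < a" for k
    proof -
      have "\<not> (\<exists>f\<in>\<Theta>0. \<forall>A\<in>\<A>. \<bar>count_average n k A - l2_inner \<nu> f (indicator A)\<bar> < a)"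
      proof
        assume "\<exists>f\<in>\<Theta>0. \<forall>A\<in>\<A>. \<bar>count_average n k A - l2_inner \<nu> f (indicator A)\<bar> < a"
        then obtain f where f: "f \<in> \<Theta>0" "\<forall>A\<in>\<A>. \<bar>count_average n k A - l2_inner \<nu> f (indicator A)\<bar> < a" by blast
        obtain A where "A \<in> \<A>" "\<delta> \<le> \<bar>l2_inner \<nu> f (indicator A) - l2_inner \<nu> l (indicator A)\<bar>"
          using sep[OF f(1) l] by blast
        moreover have "\<bar>count_average n k A - l2_inner \<nu> f (indicator A)\<bar> < a"
            "\<bar>count_average n k A - l2_inner \<nu> l (indicator A)\<bar> < a"
          using f(2) k \<open>A \<in> \<A>\<close> by blast+
        ultimately show False unfolding a_def by linarith
      qed
      then show ?thesis by (simp add: proximity_test_def)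
    qed
    then show "(\<integral>\<^sup>+\<omega>. ennreal (1 - ?T n (\<lambda>i\<in>{1..n}. \<kappa> i \<omega>)) \<partial>M l) \<le> ennreal (real (card \<A>) * L / (real n * a\<^sup>2))"
      using \<Theta>1(1)[OF l] l L
      by (intro proximity_test_error[OF \<nu> \<A> \<open>a > 0\<close> n]) (auto simp: proximity_test_def)
  qed
  \<comment> \<open>For small \<open>n\<close> only the trivial test is sure to respect the level \<open>\<alpha>\<close>.\<close>
  define K where "K n = (if \<epsilon> n < \<alpha> then ?T n else (\<lambda>_. 0))" for n
  have \<epsilon>0: "\<epsilon> \<longlonglongrightarrow> 0"
  proof -
    have "\<epsilon> = (\<lambda>n. (real (card \<A>) * L / a\<^sup>2) * (1 / real n))"
      by (auto simp: \<epsilon>_def)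
    moreover have "(\<lambda>n. (real (card \<A>) * L / a\<^sup>2) * (1 / real n)) \<longlonglongrightarrow> (real (card \<A>) * L / a\<^sup>2) * 0"
      by (intro tendsto_mult tendsto_const lim_1_over_n)
    ultimately show ?thesis by simp
  qed
  show "\<exists>K. (\<forall>n\<ge>1. is_test \<nu> n (K n) \<and> test_alpha M \<kappa> \<Theta>0 n (K n) < ennreal \<alpha>) \<and>
      (\<lambda>n. test_beta M \<kappa> \<Theta>1 n (K n)) \<longlonglongrightarrow> 0"
  proof (intro exI[of _ K] conjI allI impI)
    fix n :: nat assume n: "n \<ge> 1"
    show "is_test \<nu> n (K n)"
      using is_test_proximity_test[OF \<A>] by (auto simp: K_def is_test_def)
    show "test_alpha M \<kappa> \<Theta>0 n (K n) < ennreal \<alpha>"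
    proof (cases "\<epsilon> n < \<alpha>")
      case True
      then show ?thesis
        using alpha[OF n] \<alpha>(1) by (simp add: K_def) (meson ennreal_lessI le_less_trans)
    next
      case False
      have "test_alpha M \<kappa> \<Theta>0 n (\<lambda>_. 0) \<le> 0" unfolding test_alpha_def by (intro SUP_least) simp
      then show ?thesis using False \<alpha>(1) by (simp add: K_def)
    qed
  next
    have "\<forall>\<^sub>F n in sequentially. \<epsilon> n < \<alpha> \<and> n \<ge> 1"
      using order_tendstoD(2)[OF \<epsilon>0 \<alpha>(1)] eventually_ge_at_top[of 1] by eventually_elim simp
    then have upper: "\<forall>\<^sub>F n in sequentially. test_beta M \<kappa> \<Theta>1 n (K n) \<le> ennreal (\<epsilon> n)"
      by eventually_elim (simp add: K_def beta)
    have lim: "(\<lambda>n. ennreal (\<epsilon> n)) \<longlonglongrightarrow> 0"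
      using tendsto_ennrealI[OF \<epsilon>0] by simp
    have lower: "\<forall>\<^sub>F n in sequentially. 0 \<le> test_beta M \<kappa> \<Theta>1 n (K n)" by simp
    show "(\<lambda>n. test_beta M \<kappa> \<Theta>1 n (K n)) \<longlonglongrightarrow> 0"
      by (rule tendsto_sandwich[OF lower upper tendsto_const lim])
  qed
qed

section \<open>The criterion for distinguishability\<close>

theorem theorem2p11:
  fixes \<nu> :: "'a::t2_space measure"
    and \<Theta> \<Theta>0 \<Theta>1 :: "('a \<Rightarrow> real) set"
    and M :: "('a \<Rightarrow> real) \<Rightarrow> 'w measure"
    and \<kappa> :: "nat \<Rightarrow> 'w \<Rightarrow> 'a measure"
  assumes "sets \<nu> = sets borel" and "finite_measure \<nu>"
    and "l2_subspace \<nu> \<Theta>" and "l2_closed \<nu> \<Theta>" and "(\<lambda>_. 1) \<in> \<Theta>"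
    and "\<Theta>0 \<subseteq> \<Theta>" and "\<Theta>1 \<subseteq> \<Theta>"
    and "\<And>l. l \<in> \<Theta>0 \<union> \<Theta>1 \<Longrightarrow> AE x in \<nu>. 0 \<le> l x"
    and "\<And>l. l \<in> \<Theta>0 \<union> \<Theta>1 \<Longrightarrow> poisson_sample \<nu> M \<kappa> l"
    and "l2_bounded \<nu> \<Theta>0" and "l2_bounded \<nu> \<Theta>1"
  shows "(\<not> (\<exists>\<Gamma>. l2_subspace \<nu> \<Gamma> \<and> l2_finite_dim \<nu> \<Gamma> \<and> \<Gamma> \<subseteq> \<Theta> \<and>
              l2_proj \<nu> \<Gamma> (l2_closure \<nu> \<Theta>0) \<inter> l2_proj \<nu> \<Gamma> (l2_closure \<nu> \<Theta>1) = {})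
           \<longrightarrow> indistinguishable \<nu> M \<kappa> \<Theta>0 \<Theta>1)
       \<and> ((\<exists>\<Gamma>. l2_subspace \<nu> \<Gamma> \<and> l2_finite_dim \<nu> \<Gamma> \<and> \<Gamma> \<subseteq> \<Theta> \<and>
              l2_proj \<nu> \<Gamma> (l2_closure \<nu> \<Theta>0) \<inter> l2_proj \<nu> \<Gamma> (l2_closure \<nu> \<Theta>1) = {})
           \<longrightarrow> distinguishable \<nu> M \<kappa> \<Theta>0 \<Theta>1)"
proof (intro conjI impI)
  interpret finite_measure \<nu> by fact
  have \<Theta>L: "\<Theta> \<subseteq> L2 \<nu>" using assms(3) by (simp add: l2_subspace_def)
  have L: "\<Theta>0 \<subseteq> L2 \<nu>" "\<Theta>1 \<subseteq> L2 \<nu>" using assms(6,7) \<Theta>L by auto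
  have \<Theta>0: "\<And>l. l \<in> \<Theta>0 \<Longrightarrow> l \<in> L2 \<nu> \<and> (AE x in \<nu>. 0 \<le> l x) \<and> poisson_sample \<nu> M \<kappa> l"
    and \<Theta>1: "\<And>l. l \<in> \<Theta>1 \<Longrightarrow> l \<in> L2 \<nu> \<and> (AE x in \<nu>. 0 \<le> l x) \<and> poisson_sample \<nu> M \<kappa> l"
    using assms(8,9) L by auto
  have nonneg: "\<forall>l\<in>\<Theta>0. AE x in \<nu>. 0 \<le> l x" "\<forall>l\<in>\<Theta>1. AE x in \<nu>. 0 \<le> l x"
    using assms(8) by auto
  {
    assume insep: "\<not> (\<exists>\<Gamma>. l2_subspace \<nu> \<Gamma> \<and> l2_finite_dim \<nu> \<Gamma> \<and> \<Gamma> \<subseteq> \<Theta> \<and>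
              l2_proj \<nu> \<Gamma> (l2_closure \<nu> \<Theta>0) \<inter> l2_proj \<nu> \<Gamma> (l2_closure \<nu> \<Theta>1) = {})"
    obtain F :: "('a set set \<times> nat) filter" and u v l
      where F: "F \<noteq> bot" and u: "\<forall>p. u p \<in> \<Theta>0" and v: "\<forall>p. v p \<in> \<Theta>1"
        and l: "l \<in> L2 \<nu>" "\<forall>x. 0 \<le> l x"
        and ul: "\<forall>h\<in>L2 \<nu>. ((\<lambda>p. l2_inner \<nu> (u p) h) \<longlongrightarrow> l2_inner \<nu> l h) F"
        and vl: "\<forall>h\<in>L2 \<nu>. ((\<lambda>p. l2_inner \<nu> (v p) h) \<longlongrightarrow> l2_inner \<nu> l h) F"
      using weakly_close_imp_common_limit[OF L(1) nonneg(1) assms(10) L(2) nonneg(2) assms(11)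
          inseparable_projections_imp_weakly_close[OF assms(3,6,10,7,11) insep]]
      by (elim exE conjE)
    show "indistinguishable \<nu> M \<kappa> \<Theta>0 \<Theta>1"
      by (rule common_weak_limit_imp_indistinguishable[OF assms(2) \<Theta>0 assms(10) \<Theta>1 assms(11) F
            spec[OF u] spec[OF v] l(1) spec[OF l(2)] bspec[OF ul] bspec[OF vl]])
  }
  {
    assume "\<exists>\<Gamma>. l2_subspace \<nu> \<Gamma> \<and> l2_finite_dim \<nu> \<Gamma> \<and> \<Gamma> \<subseteq> \<Theta> \<and>
              l2_proj \<nu> \<Gamma> (l2_closure \<nu> \<Theta>0) \<inter> l2_proj \<nu> \<Gamma> (l2_closure \<nu> \<Theta>1) = {}"
    then obtain \<Gamma> where \<Gamma>: "l2_subspace \<nu> \<Gamma>" "l2_finite_dim \<nu> \<Gamma>"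
      "l2_proj \<nu> \<Gamma> (l2_closure \<nu> \<Theta>0) \<inter> l2_proj \<nu> \<Gamma> (l2_closure \<nu> \<Theta>1) = {}" by blast
    have "\<exists>\<A> \<delta>. finite \<A> \<and> \<A> \<subseteq> sets \<nu> \<and> \<delta> > 0 \<and> (\<forall>f\<in>\<Theta>0. \<forall>g\<in>\<Theta>1.
        \<exists>A\<in>\<A>. \<delta> \<le> \<bar>l2_inner \<nu> f (indicator A) - l2_inner \<nu> g (indicator A)\<bar>)"
    proof (rule ccontr)
      assume no_sep: "\<not> ?thesis"
      have close: "\<forall>\<A> \<delta>. finite \<A> \<longrightarrow> \<A> \<subseteq> sets \<nu> \<longrightarrow> \<delta> > 0 \<longrightarrow> (\<exists>f\<in>\<Theta>0. \<exists>g\<in>\<Theta>1. \<forall>A\<in>\<A>.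
          \<bar>l2_inner \<nu> f (indicator A) - l2_inner \<nu> g (indicator A)\<bar> < \<delta>)"
      proof (intro allI impI, rule ccontr)
        fix \<A> and \<delta> :: real assume that: "finite \<A>" "\<A> \<subseteq> sets \<nu>" "\<delta> > 0"
        assume "\<not> (\<exists>f\<in>\<Theta>0. \<exists>g\<in>\<Theta>1. \<forall>A\<in>\<A>.
          \<bar>l2_inner \<nu> f (indicator A) - l2_inner \<nu> g (indicator A)\<bar> < \<delta>)"
        then have "\<forall>f\<in>\<Theta>0. \<forall>g\<in>\<Theta>1. \<exists>A\<in>\<A>. \<delta> \<le> \<bar>l2_inner \<nu> f (indicator A) - l2_inner \<nu> g (indicator A)\<bar>"
          by (simp add: not_less)
        with that no_sep show False by blast
      qed
      obtain F :: "('a set set \<times> nat) filter" and u v l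
        where F: "F \<noteq> bot" and u: "\<forall>p. u p \<in> \<Theta>0" and v: "\<forall>p. v p \<in> \<Theta>1" and l: "l \<in> L2 \<nu>"
        and ul: "\<forall>h\<in>L2 \<nu>. ((\<lambda>p. l2_inner \<nu> (u p) h) \<longlongrightarrow> l2_inner \<nu> l h) F"
        and vl: "\<forall>h\<in>L2 \<nu>. ((\<lambda>p. l2_inner \<nu> (v p) h) \<longlongrightarrow> l2_inner \<nu> l h) F"
        using weakly_close_imp_common_limit[OF L(1) nonneg(1) assms(10) L(2) nonneg(2) assms(11) close]
        by (elim exE conjE)
      have "l \<in> l2_closure \<nu> \<Theta>0" by (rule weak_limit_in_l2_closure[OF F spec[OF u] L(1) l bspec[OF ul]])
      moreover have "l \<in> l2_closure \<nu> \<Theta>1" by (rule weak_limit_in_l2_closure[OF F spec[OF v] L(2) l bspec[OF vl]])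
      ultimately show False using common_point_imp_projections_meet[OF \<Gamma>(1,2)] \<Gamma>(3) by blast
    qed
    then obtain \<A> \<delta> where \<A>: "finite \<A>" "\<A> \<subseteq> sets \<nu>" and \<delta>: "\<delta> > 0" and
      sep: "\<And>f g. f \<in> \<Theta>0 \<Longrightarrow> g \<in> \<Theta>1 \<Longrightarrow>
        \<exists>A\<in>\<A>. \<delta> \<le> \<bar>l2_inner \<nu> f (indicator A) - l2_inner \<nu> g (indicator A)\<bar>"
      by blast
    show "distinguishable \<nu> M \<kappa> \<Theta>0 \<Theta>1"
      by (rule separated_imp_distinguishable[OF assms(2) \<Theta>0 assms(10) \<Theta>1 assms(11) \<A> \<delta> sep])
  }
qed

end
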